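(* Consider the GIN-with-mean-readout class $\mathcal F'$ described in the context, under assumptions (i), (ii) (for layers $1,\dots,L+1$) and (v). Let $\delta\in(0,1)$ and put $C_1=\sum_{i=1}^{r'}\frac{b_i^{(L+1)}}{\kappa_i^{(L+1)}}$, $C_2=\sum_{l=1}^L\sum_{i=1}^r\big(\frac{b_i^{(l)}}{\kappa_i^{(l)}}\big)^{2/3}$ and $R_G'=c^{2L}\|\mathbf X\|_2^2\ln(2\bar d^2)\Big(\prod_{l=1}^L\big(\prod_{i=1}^r\kappa_i^{(l)}\big)^2\Big)\big(3C_2^2C_1+3C_2C_1^2+C_1^3\big)$. Then with probability at least $1-\delta$ over the i.i.d. draw of the sample from any distribution on $\mathcal X\times\{1,\dots,K\}$, every $f\in\mathcal F'$ satisfies $$L_\gamma(f)\le\hat L_\gamma(f)+3\gamma\sqrt{\frac{\ln(2/\delta)}{2N}}+\frac{8\gamma+24\mu\big(\prod_{i=1}^{r'}\kappa_i^{(L+1)}\big)\sqrt{R_G+R_G'}\,\ln N}{N}.$$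
   Context: Graphs and data. A sample consists of $N$ labeled graphs $(G_i,y_i)$, $i\in[N]$, drawn i.i.d., where $G_i=(\mathbf A_i,\mathbf X_i)$, $\mathbf A_i\in\{0,1\}^{n_i\times n_i}$ is the symmetric adjacency matrix of an undirected graph with $n_i$ nodes, $\mathbf X_i\in\mathbb R^{n_i\times d_0}$, $y_i\in\{1,\dots,K\}$. Let $\mathbf X=[\mathbf X_1^\top,\dots,\mathbf X_N^\top]^\top$, $\mathbf A=\mathrm{diag}(\mathbf A_1,\dots,\mathbf A_N)$, $\tilde{\mathbf A}=\mathbf A+\mathbf I$. $\|\cdot\|_2$ is the Frobenius norm, $\|\cdot\|_\sigma$ the spectral norm, $\|\mathbf M\|_{2,1}=\sum_j\|\mathbf M_{:,j}\|_2$. GIN message passing network. Fix $L,r\ge1$ and widths $d_i^{(l)}$ with $d_0^{(1)}=d_0$, $d_0^{(l)}=d_r^{(l-1)}$, $d:=d_r^{(L)}$. With weights $\mathbf W_i^{(l)}\in\mathbb R^{d_{i-1}^{(l)}\times d_i^{(l)}}$ and entrywise activation $\sigma$, $\mathbf H^{(0)}=\mathbf X$ and $\mathbf H^{(l)}=\sigma(\cdots\sigma(\sigma(\tilde{\mathbf A}\mathbf H^{(l-1)}\mathbf W_1^{(l)})\mathbf W_2^{(l)})\cdots\mathbf W_{r-1}^{(l)})\mathbf W_r^{(l)}$; $\mathbf H^{(L)}$ stacks per-graph blocks $\mathbf H_i\in\mathbb R^{n_i\times d}$ (the same recursion on $(\mathbf A_i+\mathbf I,\mathbf X_i)$), defining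 $\mathbf H_G$ for any graph $G$. GIN with mean readout. For a graph $G$ with $n_G$ nodes, $\mathbf z_G=\frac1{n_G}\mathbf 1^\top\mathbf H_G\in\mathbb R^{1\times d}$, followed by an $r'$-layer MLP with weights $\mathbf W_i^{(L+1)}$ (input width $d$, output width $K$): $f(G)=\sigma(\cdots\sigma(\mathbf z_G\mathbf W_1^{(L+1)})\cdots\mathbf W_{r'-1}^{(L+1)})\mathbf W_{r'}^{(L+1)}\in\mathbb R^K$. $\mathcal F'$ is the class of such $f$ with weights in the constraint sets. Assumptions. (i) $\sigma$ is 1-Lipschitz with $\sigma(0)=0$; (ii) $\|\mathbf W_i^{(l)}\|_\sigma\le\kappa_i^{(l)}$, $\|\mathbf W_i^{(l)}\|_{2,1}\le b_i^{(l)}$ for all weights (including $l=L+1$); (v) $l_\gamma:\mathbb R^K\times\{1,\dots,K\}\to[0,\gamma]$ with $l_\gamma(\cdot,y)$ $\mu$-Lipschitz w.r.t. the Euclidean norm. Risks: $L_\gamma(f)=\mathbb E[l_\gamma(f(G),y)]$, $\hat L_\gamma(f)=\frac1N\sum_i l_\gamma(f(G_i),y_i)$. Constants: $c=\|\tilde{\mathbf A}\|_\sigma$, $\bar d$ the maximum of all widths, $R_G=c^{2L}\|\mathbf X\|_2^2\ln(2\bar d^2)\Big(\prod_{l=1}^L\big(\prod_{i=1}^r\kappa_i^{(l)}\big)^2\Big)\Big(\sum_{l=1}^L\sum_{i=1}^r\big(b_i^{(l)}/\kappa_i^{(l)}\big)^{2/3}\Big)^3$. *)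

theory Defs
  imports "HOL-Probability.Probability" "Jordan_Normal_Form.Matrix"
begin

definition vnorm :: "real vec \<Rightarrow> real" where
  "vnorm v = sqrt (\<Sum>i<dim_vec v. (v $ i)^2)"

definition frob_norm :: "real mat \<Rightarrow> real" where
  "frob_norm M = sqrt (\<Sum>i<dim_row M. \<Sum>j<dim_col M. (M $$ (i,j))^2)"

definition spec_norm :: "real mat \<Rightarrow> real" where
  "spec_norm M = (SUP v \<in> {v. dim_vec v = dim_col M \<and> vnorm v \<le> 1}. vnorm (M *\<^sub>v v))"

definition norm21 :: "real mat \<Rightarrow> real" where
  "norm21 M = (\<Sum>j<dim_col M. vnorm (col M j))"

text \<open>A graph is a pair (adjacency matrix A, node feature matrix X).\<close>
type_synonym graph = "real mat \<times> real mat"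

definition nnodes :: "graph \<Rightarrow> nat" where
  "nnodes G = dim_row (fst G)"

definition valid_graph :: "nat \<Rightarrow> graph \<Rightarrow> bool" where
  "valid_graph d0 G \<longleftrightarrow> (let A = fst G; X = snd G; n = dim_row A in
     A \<in> carrier_mat n n \<and> X \<in> carrier_mat n d0 \<and> transpose_mat A = A \<and>
     (\<forall>i<n. \<forall>j<n. A $$ (i,j) = 0 \<or> A $$ (i,j) = 1))"

fun blockdiag :: "real mat list \<Rightarrow> real mat" where
  "blockdiag [] = 0\<^sub>m 0 0"
| "blockdiag (M # Ms) = (let B = blockdiag Ms in
     four_block_mat M (0\<^sub>m (dim_row M) (dim_col B)) (0\<^sub>m (dim_row B) (dim_col M)) B)"

definition vstack :: "nat \<Rightarrow> real mat list \<Rightarrow> real mat" where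
  "vstack d Ms = mat_of_rows d (concat (map rows Ms))"

fun chain :: "(real \<Rightarrow> real) \<Rightarrow> real mat \<Rightarrow> (nat \<Rightarrow> real mat) \<Rightarrow> nat \<Rightarrow> real mat" where
  "chain \<sigma> M W 0 = M"
| "chain \<sigma> M W (Suc 0) = M * W 1"
| "chain \<sigma> M W (Suc (Suc k)) = map_mat \<sigma> (chain \<sigma> M W (Suc k)) * W (Suc (Suc k))"

fun gin_H :: "(real \<Rightarrow> real) \<Rightarrow> nat \<Rightarrow> (nat \<Rightarrow> nat \<Rightarrow> real mat) \<Rightarrow> graph \<Rightarrow> nat \<Rightarrow> real mat" where
  "gin_H \<sigma> r W G 0 = snd G"
| "gin_H \<sigma> r W G (Suc l) =
     chain \<sigma> ((fst G + 1\<^sub>m (nnodes G)) * gin_H \<sigma> r W G l) (W (Suc l)) r"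

definition gin_mean :: "(real \<Rightarrow> real) \<Rightarrow> nat \<Rightarrow> nat \<Rightarrow> nat \<Rightarrow> (nat \<Rightarrow> nat \<Rightarrow> real mat) \<Rightarrow> graph \<Rightarrow> real vec" where
  "gin_mean \<sigma> L r r' W G =
     (let H = gin_H \<sigma> r W G L;
          z = (1 / real (nnodes G)) \<cdot>\<^sub>m (mat 1 (nnodes G) (\<lambda>_. 1) * H)
      in row (chain \<sigma> z (W (L+1)) r') 0)"

definition admissible_weights ::
  "nat \<Rightarrow> nat \<Rightarrow> nat \<Rightarrow> (nat \<Rightarrow> nat \<Rightarrow> nat) \<Rightarrow> (nat \<Rightarrow> nat \<Rightarrow> real) \<Rightarrow> (nat \<Rightarrow> nat \<Rightarrow> real)
    \<Rightarrow> (nat \<Rightarrow> nat \<Rightarrow> real mat) \<Rightarrow> bool" where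
  "admissible_weights L r r' dw \<kappa> b W \<longleftrightarrow>
     (\<forall>l\<in>{1..L+1}. \<forall>i\<in>{1..(if l = L+1 then r' else r)}.
        W l i \<in> carrier_mat (dw l (i-1)) (dw l i) \<and>
        spec_norm (W l i) \<le> \<kappa> l i \<and> norm21 (W l i) \<le> b l i)"

definition GIN_mean_class ::
  "(real \<Rightarrow> real) \<Rightarrow> nat \<Rightarrow> nat \<Rightarrow> nat \<Rightarrow> (nat \<Rightarrow> nat \<Rightarrow> nat) \<Rightarrow> (nat \<Rightarrow> nat \<Rightarrow> real)
    \<Rightarrow> (nat \<Rightarrow> nat \<Rightarrow> real) \<Rightarrow> (graph \<Rightarrow> real vec) set" where
  "GIN_mean_class \<sigma> L r r' dw \<kappa> b =
     {gin_mean \<sigma> L r r' W | W. admissible_weights L r r' dw \<kappa> b W}"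

definition true_risk :: "((graph \<times> nat) measure) \<Rightarrow> (real vec \<Rightarrow> nat \<Rightarrow> real) \<Rightarrow> (graph \<Rightarrow> real vec) \<Rightarrow> real" where
  "true_risk D l f = (\<integral>z. l (f (fst z)) (snd z) \<partial>D)"

definition emp_risk :: "nat \<Rightarrow> (nat \<Rightarrow> graph \<times> nat) \<Rightarrow> (real vec \<Rightarrow> nat \<Rightarrow> real) \<Rightarrow> (graph \<Rightarrow> real vec) \<Rightarrow> real" where
  "emp_risk N S l f = (1 / real N) * (\<Sum>i<N. l (f (fst (S i))) (snd (S i)))"

definition sample_A :: "nat \<Rightarrow> (nat \<Rightarrow> graph \<times> nat) \<Rightarrow> real mat" where
  "sample_A N S = blockdiag (map (\<lambda>i. fst (fst (S i))) [0..<N])"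

definition sample_X :: "nat \<Rightarrow> nat \<Rightarrow> (nat \<Rightarrow> graph \<times> nat) \<Rightarrow> real mat" where
  "sample_X d0 N S = vstack d0 (map (\<lambda>i. snd (fst (S i))) [0..<N])"

definition sample_c :: "nat \<Rightarrow> (nat \<Rightarrow> graph \<times> nat) \<Rightarrow> real" where
  "sample_c N S = (let A = sample_A N S in spec_norm (A + 1\<^sub>m (dim_row A)))"

end

(*
  Write t for the ratios b/kappa of the layers. Fix a sample and replace every kappa by
  min kappa b, which is legitimate because the spectral norm is at most the (2,1)-norm.

  Covering. One linear layer Y |-> Y W with a (2,1)-bound on W is covered by Maurey's empirical
  method; clipping the cover points to the ball that contains the true outputs keeps the norm bounds
  of the later layers, and then the radii relative to these bounds simply add up along the network.
  Optimising the relative radii gives log-covering numbers R/eps^2 for the vectors of losses, with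
  the exponent 2/3 for all layers. For the readout layers the theorem has t instead of
  t powr (2/3); the two are reconciled by the gain in the product of the norms when t < 1.

  Generalisation. Chaining over dyadic radii turns this into a Rademacher bound. Only one bounded
  difference inequality is needed: the maximal deviation minus twice the Rademacher average has
  nonpositive mean and changes by at most 3 gamma / N when one sample point changes.
  No sigma-algebra on the graphs is prescribed, so suprema are taken over a countable
  set of weights that is dense entrywise, and the bound passes to all weights by pointwise limits.
*)
theory Submission
  imports Defs
begin

section \<open>Bounded differences\<close>

text \<open>The right-hand side depends on the drawn sample through \<open>sample_c\<close> and
  \<open>sample_X\<close>, so covering numbers can be used only once the sample is fixed.
  Concentration must therefore deliver the empirical Rademacher average, not its mean. Subtracting
  it before bounded differences are applied costs \<gamma> + 2 \<gamma> per sample point and leaves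
  one bad event, so ln (1 / \<delta>) suffices where two events would need ln (2 / \<delta>).

  The obstacle is the exponent 1 of the readout ratios: for t < 1 it asks for less than t powr
  (2/3), which is what the optimisation produces. After passing to min \<kappa> b each ratio is max
  1 t and the product of norms carries a factor min 1 t. The gap is closed by n * (product of w^2)
  <= (sum of w^3) for n >= 2 numbers in (0,1]; a GIN layer and a readout layer always provide two.
  All layers then share one sum, and the cube of C2 + C1 expands into the factors of R_G and R_G'.

  The constants 8 \<gamma> and 24 are twice the 4 \<gamma> and 12 of the chaining bound. The 2 in
  exp (2 R / \<epsilon>^2) pays for rounding the numbers of Maurey atoms up.\<close>

lemma (in prob_space) Hoeffdings_lemma_integral:
  fixes f :: "'a \<Rightarrow> real"
  assumes f [measurable]: "f \<in> borel_measurable M"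
    and bd: "\<And>x. x \<in> space M \<Longrightarrow> f x \<in> {a..b}" and "l > 0"
  shows "expectation (\<lambda>x. exp (l * (f x - expectation f))) \<le> exp (l\<^sup>2 * (b - a)\<^sup>2 / 8)"
proof -
  interpret interval_bounded_random_variable M f a b
    by unfold_locales (rule f, rule AE_I2, rule bd)
  have "expectation (\<lambda>x. exp (l * (f x - expectation f)))
      = enn2real (nn_integral M (\<lambda>x. exp (l * (f x - expectation f))))"
    by (rule integral_eq_nn_integral) simp_all
  also have "\<dots> \<le> enn2real (ennreal (exp (l\<^sup>2 * (b - a)\<^sup>2 / 8)))"
    by (intro enn2real_mono Hoeffdings_lemma_nn_integral \<open>l > 0\<close>) auto
  finally show ?thesis by simp
qed

abbreviation (in prob_space) iid :: "'i set \<Rightarrow> ('i \<Rightarrow> 'a) measure" where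
  "iid I \<equiv> PiM I (\<lambda>_. M)"

lemma (in prob_space) upd_in_space:
  assumes "x \<in> space (iid I)" "y \<in> space M"
  shows "x(i := y) \<in> space (iid (insert i I))"
  using assms unfolding space_PiM PiE_insert_eq by (auto intro!: image_eqI[where x = "(y, x)"])

lemma (in prob_space) integrable_bounded:
  fixes f :: "'a \<Rightarrow> real"
  assumes "f \<in> borel_measurable M" "\<And>x. x \<in> space M \<Longrightarrow> \<bar>f x\<bar> \<le> B"
  shows "integrable M f"
  by (rule integrable_const_bound[where B = B]) (use assms in auto)

lemma (in prob_space) abs_expectation_le:
  fixes f :: "'a \<Rightarrow> real"
  assumes "f \<in> borel_measurable M" "\<And>x. x \<in> space M \<Longrightarrow> \<bar>f x\<bar> \<le> B"
  shows "\<bar>expectation f\<bar> \<le> B"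
proof -
  have i: "integrable M f" by (rule integrable_bounded) fact+
  have "\<bar>expectation f\<bar> \<le> expectation (\<lambda>x. \<bar>f x\<bar>)"
    by (rule integral_abs_bound)
  also have "\<dots> \<le> expectation (\<lambda>x. B)"
    by (rule integral_mono) (use i assms in auto)
  finally show ?thesis by (simp add: prob_space)
qed

lemma (in prob_space) measurable_PiM_insert:
  assumes "h \<in> borel_measurable (iid (insert j I))"
  shows "(\<lambda>(x, y). h (x(j := y))) \<in> borel_measurable (iid I \<Otimes>\<^sub>M M)"
  using measurable_compose[OF measurable_add_dim assms] by (simp add: split_beta')

text \<open>Both orders of Fubini are provided because symmetrisation integrates the new coordinate
  innermost in one step and outermost in the next; boundedness supplies the integrability.\<close>

lemma (in prob_space) integral_PiM_insert:
  fixes h :: "_ \<Rightarrow> real"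
  assumes "finite I" "j \<notin> I" "h \<in> borel_measurable (iid (insert j I))"
    and bd: "\<And>x. x \<in> space (iid (insert j I)) \<Longrightarrow> \<bar>h x\<bar> \<le> B"
  shows "integral\<^sup>L (iid (insert j I)) h = (\<integral>x. (\<integral>y. h (x(j := y)) \<partial>M) \<partial>iid I)"
    and "integral\<^sup>L (iid (insert j I)) h = (\<integral>y. (\<integral>x. h (x(j := y)) \<partial>iid I) \<partial>M)"
proof -
  interpret product_sigma_finite "\<lambda>_. M" by unfold_locales
  interpret P: prob_space "iid (insert j I)" by (rule prob_space_PiM) unfold_locales
  interpret Q: prob_space "iid I" by (rule prob_space_PiM) unfold_locales
  interpret QM: pair_prob_space "iid I" M ..
  show 1: "integral\<^sup>L (iid (insert j I)) h = (\<integral>x. (\<integral>y. h (x(j := y)) \<partial>M) \<partial>iid I)"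
    by (rule product_integral_insert) (use assms in \<open>auto intro!: P.integrable_bounded\<close>)
  have "integrable (iid I \<Otimes>\<^sub>M M) (\<lambda>(x, y). h (x(j := y)))"
  proof (rule QM.integrable_bounded[OF measurable_PiM_insert[OF assms(3)], where B = B])
    fix z assume "z \<in> space (iid I \<Otimes>\<^sub>M M)"
    then have "(fst z)(j := snd z) \<in> space (iid (insert j I))"
      by (intro upd_in_space) (auto simp: space_pair_measure)
    from bd[OF this] show "\<bar>case z of (x, y) \<Rightarrow> h (x(j := y))\<bar> \<le> B"
      by (simp add: split_beta)
  qed
  then show "integral\<^sup>L (iid (insert j I)) h = (\<integral>y. (\<integral>x. h (x(j := y)) \<partial>iid I) \<partial>M)"
    unfolding 1 by (rule QM.Fubini_integral[symmetric])
qed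

lemma (in prob_space) measurable_section:
  assumes "h \<in> borel_measurable (iid (insert j I))"
    and "x \<in> space (iid I)"
  shows "(\<lambda>y. h (x(j := y))) \<in> borel_measurable M"
  using measurable_Pair2[OF measurable_PiM_insert[OF assms(1)] assms(2)] by simp

lemma (in prob_space) measurable_section':
  assumes "h \<in> borel_measurable (iid (insert j I))"
    and "y \<in> space M"
  shows "(\<lambda>x. h (x(j := y))) \<in> borel_measurable (iid I)"
  using measurable_Pair1[OF measurable_PiM_insert[OF assms(1)] assms(2)] by simp

lemma (in prob_space) integrable_PiM_insert:
  fixes h :: "_ \<Rightarrow> real"
  assumes h: "h \<in> borel_measurable (iid (insert j I))"
    and bd: "\<And>x. x \<in> space (iid (insert j I)) \<Longrightarrow> \<bar>h x\<bar> \<le> B"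
  shows "integrable (iid I) (\<lambda>x. \<integral>y. h (x(j := y)) \<partial>M)"
    and "integrable M (\<lambda>y. \<integral>x. h (x(j := y)) \<partial>iid I)"
proof -
  interpret Q: prob_space "iid I" by (rule prob_space_PiM) unfold_locales
  note [measurable] = measurable_PiM_insert[OF h]
  show "integrable (iid I) (\<lambda>x. \<integral>y. h (x(j := y)) \<partial>M)"
  proof (rule Q.integrable_bounded[where B = B])
    fix x assume x: "x \<in> space (iid I)"
    show "\<bar>\<integral>y. h (x(j := y)) \<partial>M\<bar> \<le> B"
      by (intro abs_expectation_le measurable_section[OF h x] bd upd_in_space x)
  qed measurable
  from measurable_compose[OF measurable_pair_swap' measurable_PiM_insert[OF h]]
  have [measurable]: "(\<lambda>(y, x). h (x(j := y))) \<in> borel_measurable (M \<Otimes>\<^sub>M iid I)"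
    by (simp add: split_beta')
  show "integrable M (\<lambda>y. \<integral>x. h (x(j := y)) \<partial>iid I)"
  proof (rule integrable_bounded[where B = B])
    fix y assume y: "y \<in> space M"
    show "\<bar>\<integral>x. h (x(j := y)) \<partial>iid I\<bar> \<le> B"
      by (intro Q.abs_expectation_le measurable_section'[OF h y] bd upd_in_space y)
  qed measurable
qed

text \<open>Integrating out coordinate \<open>j\<close> leaves \<open>g\<close>, which inherits the
  bounded differences, so the induction hypothesis controls its exponential moment. With the other
  coordinates fixed, \<open>h\<close> varies in an interval of length \<open>c\<close>, and
  Hoeffding's lemma contributes one factor. The induction takes the place of a martingale.\<close>

lemma (in prob_space) bounded_differences_mgf:
  fixes h :: "('i \<Rightarrow> 'a) \<Rightarrow> real"
  assumes "finite I" and "h \<in> borel_measurable (iid I)"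
    and "\<And>x. x \<in> space (iid I) \<Longrightarrow> \<bar>h x\<bar> \<le> B"
    and "\<And>x i y. x \<in> space (iid I) \<Longrightarrow> i \<in> I \<Longrightarrow> y \<in> space M \<Longrightarrow>
           \<bar>h (x(i := y)) - h x\<bar> \<le> c"
    and s: "s > 0"
  shows "(\<integral>x. exp (s * (h x - (\<integral>x. h x \<partial>iid I))) \<partial>iid I)
           \<le> exp (s\<^sup>2 * (real (card I) * c\<^sup>2) / 8)"
  using assms(1-4)
proof (induction I arbitrary: h rule: finite_induct)
  \<comment> \<open>The product over no coordinates has a single point, the function that is
    \<open>undefined\<close> everywhere, so \<open>h\<close> equals its mean.\<close>
  case empty
  have "integral\<^sup>L (PiM {} (\<lambda>_. M)) f = f (\<lambda>_. undefined)" for f :: "('i \<Rightarrow> 'a) \<Rightarrow> real"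
    unfolding PiM_empty by (subst lebesgue_integral_count_space_finite) auto
  from this[of h] this[of "\<lambda>x. exp (s * (h x - h (\<lambda>_. undefined)))"] show ?case by simp
next
  case (insert j I)
  interpret P: prob_space "iid (insert j I)" by (rule prob_space_PiM) unfold_locales
  interpret Q: prob_space "iid I" by (rule prob_space_PiM) unfold_locales
  note h[measurable] = insert.prems(1)
  note sec = measurable_section[OF h]
  note pair[measurable] = measurable_PiM_insert[OF h]
  note upd = upd_in_space
  define g where "g x = (\<integral>y. h (x(j := y)) \<partial>M)" for x
  let ?e = "\<integral>x. h x \<partial>iid (insert j I)"
  have g[measurable]: "g \<in> borel_measurable (iid I)"
    unfolding g_def by measurable
  have gB: "\<bar>g x\<bar> \<le> B" if "x \<in> space (iid I)" for x
    unfolding g_def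
    by (rule abs_expectation_le) (use that in \<open>auto intro!: sec insert.prems upd\<close>)
  have secint: "integrable M (\<lambda>y. h (x(j := y)))" if "x \<in> space (iid I)" for x
    by (rule integrable_bounded[where B = B]) (use that in \<open>auto intro!: sec insert.prems upd\<close>)
  have gd: "\<bar>g (x(i := y)) - g x\<bar> \<le> c" if x: "x \<in> space (iid I)" and i: "i \<in> I" and y: "y \<in> space M" for x i y
  proof -
    have x': "x(i := y) \<in> space (iid I)"
      using upd[OF x y, of i] i by (simp add: insert_absorb)
    have "g (x(i := y)) - g x = (\<integral>z. (h (x(i := y, j := z)) - h (x(j := z))) \<partial>M)"
      unfolding g_def using secint[OF x] secint[OF x'] by simp
    also have "\<bar>\<dots>\<bar> \<le> c"
    proof (rule abs_expectation_le)
      show "(\<lambda>z. h (x(i := y, j := z)) - h (x(j := z))) \<in> borel_measurable M"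
        by (rule borel_measurable_diff[OF sec[OF x'] sec[OF x]])
      fix z assume z: "z \<in> space M"
      have "i \<noteq> j" using i insert.hyps by auto
      then have eq: "x(i := y, j := z) = x(j := z, i := y)" by (rule fun_upd_twist)
      show "\<bar>h (x(i := y, j := z)) - h (x(j := z))\<bar> \<le> c"
        unfolding eq by (rule insert.prems(3)[OF upd[OF x z] _ y]) (use i in simp)
    qed
    finally show ?thesis .
  qed
  have eg: "(\<integral>x. g x \<partial>iid I) = ?e"
    unfolding g_def by (rule integral_PiM_insert(1)[symmetric, where B = B]) (use insert in auto)
  have eB: "\<bar>?e\<bar> \<le> B" by (rule P.abs_expectation_le) (use insert in auto)
  define F where "F x = exp (s * (h x - ?e))" for x
  have F: "F \<in> borel_measurable (iid (insert j I))"
    "\<And>x. x \<in> space (iid (insert j I)) \<Longrightarrow> \<bar>F x\<bar> \<le> exp (s * (2 * B))"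
  proof -
    show "F \<in> borel_measurable (iid (insert j I))" unfolding F_def by measurable
    fix x assume "x \<in> space (iid (insert j I))"
    then have "\<bar>h x\<bar> \<le> B" by (rule insert.prems(2))
    then show "\<bar>F x\<bar> \<le> exp (s * (2 * B))" using eB s by (simp add: F_def)
  qed
  have egB: "exp (s * (g x - ?e)) \<le> exp (s * (2 * B))" if "x \<in> space (iid I)" for x
    using gB[OF that] eB s by auto
  have inner: "(\<integral>y. F (x(j := y)) \<partial>M) \<le> exp (s * (g x - ?e)) * exp (s\<^sup>2 * c\<^sup>2 / 8)"
    if x: "x \<in> space (iid I)" for x
  proof -
    \<comment> \<open>Any two values of the section differ by at most \<open>c\<close>. Anchoring
      the interval at the infimum gives length \<open>c\<close>; centring it at one value would give
      2 c and spoil the constant.\<close>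
    define a where "a = (INF y\<in>space M. h (x(j := y)))"
    have bdd: "bdd_below ((\<lambda>y. h (x(j := y))) ` space M)"
    proof (rule bdd_belowI2[where m = "-B"])
      fix y assume "y \<in> space M"
      from insert.prems(2)[OF upd[OF x this]] show "- B \<le> h (x(j := y))"
        by linarith
    qed
    have "h (x(j := y)) \<in> {a..a + c}" if y: "y \<in> space M" for y
    proof -
      have "a \<le> h (x(j := y))" unfolding a_def by (rule cINF_lower[OF bdd y])
      moreover have "h (x(j := y)) - c \<le> a" unfolding a_def
      proof (rule cINF_greatest)
        show "space M \<noteq> {}" using y by auto
        fix z assume z: "z \<in> space M"
        have "\<bar>h (x(j := z, j := y)) - h (x(j := z))\<bar> \<le> c"
          by (rule insert.prems(3)[OF upd[OF x z] _ y]) simp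
        then show "h (x(j := y)) - c \<le> h (x(j := z))"
          unfolding fun_upd_upd by linarith
      qed
      ultimately show ?thesis by auto
    qed
    from Hoeffdings_lemma_integral[OF sec[OF x] this s]
    have H: "(\<integral>y. exp (s * (h (x(j := y)) - g x)) \<partial>M) \<le> exp (s\<^sup>2 * c\<^sup>2 / 8)"
      by (simp add: g_def)
    have "(\<integral>y. F (x(j := y)) \<partial>M)
        = (\<integral>y. exp (s * (g x - ?e)) * exp (s * (h (x(j := y)) - g x)) \<partial>M)"
      by (simp add: F_def exp_add[symmetric] algebra_simps)
    also have "\<dots> = exp (s * (g x - ?e)) * (\<integral>y. exp (s * (h (x(j := y)) - g x)) \<partial>M)"
      by (rule integral_mult_right_zero)
    also have "\<dots> \<le> exp (s * (g x - ?e)) * exp (s\<^sup>2 * c\<^sup>2 / 8)"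
      by (rule mult_left_mono[OF H]) simp
    finally show ?thesis .
  qed
  have "(\<integral>x. F x \<partial>iid (insert j I)) = (\<integral>x. (\<integral>y. F (x(j := y)) \<partial>M) \<partial>iid I)"
    by (rule integral_PiM_insert(1)[OF insert.hyps F])
  also have "\<dots> \<le> (\<integral>x. exp (s * (g x - ?e)) * exp (s\<^sup>2 * c\<^sup>2 / 8) \<partial>iid I)"
  proof (rule integral_mono[OF integrable_PiM_insert(1)[OF F]], assumption)
    show "integrable (iid I) (\<lambda>x. exp (s * (g x - ?e)) * exp (s\<^sup>2 * c\<^sup>2 / 8))"
    proof (intro integrable_mult_left impI Q.integrable_bounded[where B = "exp (s * (2 * B))"])
      show "(\<lambda>x. exp (s * (g x - ?e))) \<in> borel_measurable (iid I)" by measurable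
      fix x assume "x \<in> space (iid I)"
      from egB[OF this] show "\<bar>exp (s * (g x - ?e))\<bar> \<le> exp (s * (2 * B))" by simp
    qed
  qed (rule inner)
  also have "\<dots> = (\<integral>x. exp (s * (g x - ?e)) \<partial>iid I) * exp (s\<^sup>2 * c\<^sup>2 / 8)"
    by (rule integral_mult_left_zero)
  also have "\<dots> \<le> exp (s\<^sup>2 * (real (card I) * c\<^sup>2) / 8) * exp (s\<^sup>2 * c\<^sup>2 / 8)"
    using insert.IH[OF g gB gd] by (simp add: eg)
  also have "\<dots> = exp (s\<^sup>2 * (real (card (insert j I)) * c\<^sup>2) / 8)"
    using insert.hyps by (simp add: exp_add[symmetric] field_simps)
  finally show ?case unfolding F_def .
qed

lemma (in prob_space) McDiarmid:
  fixes h :: "('i \<Rightarrow> 'a) \<Rightarrow> real"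
  assumes fin: "finite I" and ne: "I \<noteq> {}" and h[measurable]: "h \<in> borel_measurable (iid I)"
    and B: "\<And>x. x \<in> space (iid I) \<Longrightarrow> \<bar>h x\<bar> \<le> B"
    and d: "\<And>x i y. x \<in> space (iid I) \<Longrightarrow> i \<in> I \<Longrightarrow> y \<in> space M \<Longrightarrow>
           \<bar>h (x(i := y)) - h x\<bar> \<le> c"
    and c: "c > 0" and t: "t > 0"
  shows "measure (iid I) {x \<in> space (iid I). h x - (\<integral>x. h x \<partial>iid I) \<ge> t}
           \<le> exp (- 2 * t\<^sup>2 / (real (card I) * c\<^sup>2))"
proof -
  interpret Q: prob_space "iid I" by (rule prob_space_PiM) unfold_locales
  define K where "K = real (card I) * c\<^sup>2"
  have K: "K > 0" using fin ne c by (simp add: K_def card_gt_0_iff)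
  \<comment> \<open>The minimiser of -s t + s^2 K / 8.\<close>
  define s where "s = 4 * t / K"
  have s: "s > 0" using K t by (simp add: s_def)
  let ?e = "\<integral>x. h x \<partial>iid I"
  have eB: "\<bar>?e\<bar> \<le> B" by (rule Q.abs_expectation_le) (use B in auto)
  have "measure (iid I) {x \<in> space (iid I). h x - ?e \<ge> t}
      \<le> exp (- s * t) * (\<integral>x\<in>space (iid I). exp (s * (h x - ?e)) \<partial>iid I)"
  proof (rule Q.Chernoff_ineq_ge[OF s])
    show "set_integrable (iid I) (space (iid I)) (\<lambda>x. exp (s * (h x - ?e)))"
      unfolding set_integrable_def
    proof (intro integrable_mult_indicator sets.top, rule Q.integrable_bounded[where B = "exp (s * (2 * B))"])
      fix x assume "x \<in> space (iid I)"
      then show "\<bar>exp (s * (h x - ?e))\<bar> \<le> exp (s * (2 * B))"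
        using B[of x] eB s by auto
    qed measurable
  qed simp
  also have "\<dots> = exp (- s * t) * (\<integral>x. exp (s * (h x - ?e)) \<partial>iid I)"
    by (simp add: set_lebesgue_integral_def indicator_def cong: Bochner_Integration.integral_cong)
  also have "\<dots> \<le> exp (- s * t) * exp (s\<^sup>2 * (real (card I) * c\<^sup>2) / 8)"
    by (intro mult_left_mono bounded_differences_mgf[OF fin h B d s]) auto
  also have "\<dots> = exp (- s * t + s\<^sup>2 * K / 8)" by (simp add: exp_add[symmetric] K_def)
  also have "- s * t + s\<^sup>2 * K / 8 = - 2 * t\<^sup>2 / K"
    using K by (simp add: s_def field_simps power2_eq_square)
  finally show ?thesis by (simp add: K_def)
qed

section \<open>Symmetrisation and uniform deviation\<close>

abbreviation signs :: "'i set \<Rightarrow> ('i \<Rightarrow> real) set" where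
  "signs I \<equiv> PiE I (\<lambda>_. {-1, 1})"

text \<open>The expectation over independent uniform signs, as a finite sum, so that no second
  probability space has to be combined with that of the sample.\<close>

definition savg :: "'i set \<Rightarrow> (('i \<Rightarrow> real) \<Rightarrow> real) \<Rightarrow> real" where
  "savg I F = (\<Sum>s\<in>signs I. F s) / 2 ^ card I"

lemma savg_empty: "savg {} F = F (\<lambda>_. undefined)"
  by (simp add: savg_def)

lemma card_signs: "finite I \<Longrightarrow> card (signs I) = 2 ^ card I"
  by (simp add: card_PiE numeral_2_eq_2)

lemma savg_insert:
  assumes "finite I" "j \<notin> I"
  shows "savg (insert j I) F = (savg I (\<lambda>s. F (s(j := 1))) + savg I (\<lambda>s. F (s(j := -1)))) / 2"
proof -
  have "(\<Sum>s\<in>signs (insert j I). F s)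
      = (\<Sum>(y, s)\<in>{-1, 1} \<times> signs I. F (s(j := y)))"
    unfolding PiE_insert_eq
    by (subst sum.reindex[OF inj_combinator[OF assms(2)]]) (simp add: split_beta')
  also have "\<dots> = (\<Sum>y\<in>{-1, 1}. \<Sum>s\<in>signs I. F (s(j := y)))"
    by (rule sum.cartesian_product[symmetric])
  finally show ?thesis using assms by (simp add: savg_def field_simps)
qed

lemma savg_mono:
  assumes "\<And>s. s \<in> signs I \<Longrightarrow> F s \<le> G s"
  shows "savg I F \<le> savg I G"
  unfolding savg_def by (intro divide_right_mono sum_mono assms) auto

lemma savg_const: "finite I \<Longrightarrow> savg I (\<lambda>_. c) = c"
  by (simp add: savg_def card_signs)

lemma savg_add: "savg I (\<lambda>s. F s + G s) = savg I F + savg I G"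
  by (simp add: savg_def sum.distrib add_divide_distrib)

lemma savg_diff: "savg I (\<lambda>s. F s - G s) = savg I F - savg I G"
  by (simp add: savg_def sum_subtractf diff_divide_distrib)

lemma savg_cmult: "savg I (\<lambda>s. c * F s) = c * savg I F"
  by (simp add: savg_def sum_distrib_left)

lemma savg_sum: "savg I (\<lambda>s. \<Sum>j\<in>J. F j s) = (\<Sum>j\<in>J. savg I (F j))"
  unfolding savg_def by (subst sum.swap) (simp add: sum_divide_distrib)

lemma abs_savg_le:
  assumes "finite I" "\<And>s. s \<in> signs I \<Longrightarrow> \<bar>F s\<bar> \<le> K"
  shows "\<bar>savg I F\<bar> \<le> K"
proof -
  have "savg I F \<le> savg I (\<lambda>_. K)" by (rule savg_mono) (drule assms(2), linarith)
  moreover have "savg I (\<lambda>_. - K) \<le> savg I F" by (rule savg_mono) (drule assms(2), linarith)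
  ultimately show ?thesis using assms(1) by (simp add: savg_const abs_le_iff)
qed

lemma signs_abs: "s \<in> signs I \<Longrightarrow> i \<in> I \<Longrightarrow> \<bar>s i\<bar> = 1"
  by (drule PiE_mem) auto

lemma bdd_above_abs:
  fixes f :: "nat \<Rightarrow> real"
  assumes "\<And>n. \<bar>f n\<bar> \<le> K"
  shows "bdd_above (range f)"
  by (rule bdd_aboveI2[where M = K]) (use assms in \<open>auto simp: abs_le_iff\<close>)

lemma abs_SUP_le:
  fixes f :: "nat \<Rightarrow> real"
  assumes "\<And>n. \<bar>f n\<bar> \<le> K"
  shows "\<bar>SUP n. f n\<bar> \<le> K"
proof -
  have "(SUP n. f n) \<le> K" by (rule cSUP_least) (use assms in \<open>auto simp: abs_le_iff\<close>)
  moreover have "f 0 \<le> (SUP n. f n)" by (rule cSUP_upper[OF _ bdd_above_abs[OF assms]]) auto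
  ultimately show ?thesis using assms[of 0] by linarith
qed

lemma SUP_diff_le:
  fixes f g :: "nat \<Rightarrow> real"
  assumes g: "\<And>n. \<bar>g n\<bar> \<le> K" and d: "\<And>n. \<bar>f n - g n\<bar> \<le> c"
  shows "(SUP n. f n) - (SUP n. g n) \<le> c"
proof -
  have "(SUP n. f n) \<le> (SUP n. g n) + c"
  proof (rule cSUP_least)
    fix n
    have "g n \<le> (SUP n. g n)" by (rule cSUP_upper[OF _ bdd_above_abs[OF g]]) auto
    then show "f n \<le> (SUP n. g n) + c" using d[of n] by linarith
  qed auto
  then show ?thesis by simp
qed

lemma abs_SUP_diff_le:
  fixes f g :: "nat \<Rightarrow> real"
  assumes "\<And>n. \<bar>f n\<bar> \<le> K" "\<And>n. \<bar>g n\<bar> \<le> K" and d: "\<And>n. \<bar>f n - g n\<bar> \<le> c"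
  shows "\<bar>(SUP n. f n) - (SUP n. g n)\<bar> \<le> c"
  using SUP_diff_le[of g K f c] SUP_diff_le[of f K g c] assms
  by (simp add: abs_le_iff abs_minus_commute)

lemma measurable_SUP_bounded:
  fixes f :: "nat \<Rightarrow> 'a \<Rightarrow> real"
  assumes "\<And>n. f n \<in> borel_measurable N" "\<And>n x. x \<in> space N \<Longrightarrow> \<bar>f n x\<bar> \<le> K"
  shows "(\<lambda>x. SUP n. f n x) \<in> borel_measurable N"
  by (rule borel_measurable_cSUP) (use assms in \<open>auto intro!: bdd_above_abs\<close>)

locale bounded_losses = prob_space M for M :: "'a measure" +
  fixes l :: "nat \<Rightarrow> 'a \<Rightarrow> real" and \<gamma> :: real
  assumes l_meas [measurable]: "\<And>n. l n \<in> borel_measurable M"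
    and l_bound: "\<And>n x. x \<in> space M \<Longrightarrow> 0 \<le> l n x \<and> l n x \<le> \<gamma>"
begin

lemma l_abs: "x \<in> space M \<Longrightarrow> \<bar>l n x\<bar> \<le> \<gamma>"
  using l_bound[of x n] by auto

lemma l_int: "integrable M (l n)"
  by (rule integrable_bounded[where B = \<gamma>]) (use l_abs in auto)

definition risk :: "nat \<Rightarrow> real" where "risk n = expectation (l n)"

lemma risk_abs: "\<bar>risk n\<bar> \<le> \<gamma>"
  unfolding risk_def by (rule abs_expectation_le) (use l_abs in auto)

text \<open>Splitting \<open>A\<close> evenly between the risk and the loss makes a ghost sample unnecessary.\<close>
lemma symmetrize_one:
  assumes A: "\<And>n. \<bar>A n\<bar> \<le> K"
  shows "(\<integral>x. (SUP n. A n + (risk n - l n x)) \<partial>M)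
    \<le> ((\<integral>x. (SUP n. A n + 2 * l n x) \<partial>M) + (\<integral>x. (SUP n. A n - 2 * l n x) \<partial>M)) / 2"
proof -
  have b1: "\<bar>A n + 2 * l n x\<bar> \<le> K + 2 * \<gamma>" "\<bar>A n - 2 * l n x\<bar> \<le> K + 2 * \<gamma>"
    "\<bar>A n + (risk n - l n x)\<bar> \<le> K + 2 * \<gamma>" if "x \<in> space M" for x n
    using A[of n] l_abs[OF that, of n] risk_abs[of n] by linarith+
  have m: "(\<lambda>x. SUP n. A n + 2 * l n x) \<in> borel_measurable M"
    by (rule measurable_SUP_bounded[OF _ b1(1)]) measurable
  have m': "(\<lambda>x. SUP n. A n - 2 * l n x) \<in> borel_measurable M"
    by (rule measurable_SUP_bounded[OF _ b1(2)]) measurable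
  have m'': "(\<lambda>x. SUP n. A n + (risk n - l n x)) \<in> borel_measurable M"
    by (rule measurable_SUP_bounded[OF _ b1(3)]) measurable
  have i: "integrable M (\<lambda>x. SUP n. A n + 2 * l n x)"
      "integrable M (\<lambda>x. SUP n. A n - 2 * l n x)"
      "integrable M (\<lambda>x. SUP n. A n + (risk n - l n x))"
    by (rule integrable_bounded[OF m abs_SUP_le[OF b1(1)]]
        integrable_bounded[OF m' abs_SUP_le[OF b1(2)]]
        integrable_bounded[OF m'' abs_SUP_le[OF b1(3)]]; assumption)+
  let ?U = "\<integral>x. (SUP n. A n + 2 * l n x) \<partial>M"
  \<comment> \<open>The easy direction of exchanging supremum and mean; it removes the risk in
    favour of a loss at a point that is integrated out.\<close>
  have 1: "A n + 2 * risk n \<le> ?U" for n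
  proof -
    have "A n + 2 * risk n = (\<integral>x. A n + 2 * l n x \<partial>M)"
      using l_int by (simp add: risk_def prob_space)
    also have "\<dots> \<le> ?U"
    proof (rule integral_mono[OF _ i(1)])
      fix x assume x: "x \<in> space M"
      show "A n + 2 * l n x \<le> (SUP n. A n + 2 * l n x)"
        by (rule cSUP_upper[OF _ bdd_above_abs[OF b1(1)[OF x]]]) simp
    qed (use l_int in auto)
    finally show ?thesis .
  qed
  have "(\<integral>x. (SUP n. A n + (risk n - l n x)) \<partial>M) \<le> (\<integral>x. (?U + (SUP n. A n - 2 * l n x)) / 2 \<partial>M)"
  proof (rule integral_mono[OF i(3)])
    fix x assume x: "x \<in> space M"
    show "(SUP n. A n + (risk n - l n x)) \<le> (?U + (SUP n. A n - 2 * l n x)) / 2"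
    proof (rule cSUP_least)
      fix n
      have "A n - 2 * l n x \<le> (SUP n. A n - 2 * l n x)"
        by (rule cSUP_upper[OF _ bdd_above_abs[OF b1(2)[OF x]]]) simp
      with 1[of n] show "A n + (risk n - l n x) \<le> (?U + (SUP n. A n - 2 * l n x)) / 2"
        by (simp add: field_simps)
    qed simp
  qed (use i(2) in auto)
  also have "\<dots> = (?U + (\<integral>x. (SUP n. A n - 2 * l n x) \<partial>M)) / 2"
    using i(2) by (simp add: prob_space)
  finally show ?thesis .
qed

text \<open>Interpolates between the two sides of symmetrisation: u = 1, v = -1 gives the deviation
  and u = 0, v = 2 s the Rademacher sum. The offset \<open>A\<close> absorbs coordinates that are
  frozen.\<close>

definition mixed :: "(nat \<Rightarrow> real) \<Rightarrow> 'i set \<Rightarrow> ('i \<Rightarrow> real) \<Rightarrow> ('i \<Rightarrow> real) \<Rightarrow> ('i \<Rightarrow> 'a) \<Rightarrow> real" where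
  "mixed A J u v x = (SUP n. A n + (\<Sum>i\<in>J. u i * risk n + v i * l n (x i)))"

lemma mixed_cong:
  "(\<And>i. i \<in> J \<Longrightarrow> u i = u' i \<and> v i = v' i) \<Longrightarrow> mixed A J u v x = mixed A J u' v' x"
  unfolding mixed_def by (simp cong: sum.cong)

lemma mixed_insert:
  assumes "finite I" "j \<notin> I"
  shows "mixed A (insert j I) u v (x(j := y)) = mixed (\<lambda>n. A n + (u j * risk n + v j * l n y)) I u v x"
proof -
  have "(\<Sum>i\<in>I. u i * risk n + v i * l n ((x(j := y)) i)) = (\<Sum>i\<in>I. u i * risk n + v i * l n (x i))" for n
    by (rule sum.cong) (use assms in auto)
  then show ?thesis using assms by (simp add: mixed_def add.assoc)
qed

context
  fixes A :: "nat \<Rightarrow> real" and K :: real and J :: "'i set" and u v :: "'i \<Rightarrow> real"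
  assumes A: "\<And>n. \<bar>A n\<bar> \<le> K" and uv: "\<And>i. i \<in> J \<Longrightarrow> \<bar>u i\<bar> \<le> 2 \<and> \<bar>v i\<bar> \<le> 2"
begin

lemma mixed_term_bound:
  assumes x: "x \<in> space (iid J)"
  shows "\<bar>A n + (\<Sum>i\<in>J. u i * risk n + v i * l n (x i))\<bar> \<le> K + real (card J) * (4 * \<gamma>)"
proof -
  have "\<bar>\<Sum>i\<in>J. u i * risk n + v i * l n (x i)\<bar> \<le> (\<Sum>i\<in>J. \<bar>u i * risk n + v i * l n (x i)\<bar>)"
    by (rule sum_abs)
  also have "\<dots> \<le> real (card J) * (4 * \<gamma>)"
  proof (rule sum_bounded_above)
    fix i assume i: "i \<in> J"
    then have "x i \<in> space M" using x by (auto simp: space_PiM)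
    then have "\<bar>u i\<bar> * \<bar>risk n\<bar> \<le> 2 * \<gamma>" "\<bar>v i\<bar> * \<bar>l n (x i)\<bar> \<le> 2 * \<gamma>"
      using uv[OF i] risk_abs[of n] l_abs by (auto intro!: mult_mono)
    then show "\<bar>u i * risk n + v i * l n (x i)\<bar> \<le> 4 * \<gamma>"
      using abs_triangle_ineq[of "u i * risk n" "v i * l n (x i)"] unfolding abs_mult by linarith
  qed
  finally show ?thesis using A[of n] by linarith
qed

lemma mixed_bound: "x \<in> space (iid J) \<Longrightarrow> \<bar>mixed A J u v x\<bar> \<le> K + real (card J) * (4 * \<gamma>)"
  unfolding mixed_def by (rule abs_SUP_le) (rule mixed_term_bound)

lemma mixed_measurable: "mixed A J u v \<in> borel_measurable (iid J)"
proof -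
  have [measurable]: "(\<lambda>x. l n (x i)) \<in> borel_measurable (iid J)" if "i \<in> J" for n i
    using that by measurable
  have "(\<lambda>x. SUP n. A n + (\<Sum>i\<in>J. u i * risk n + v i * l n (x i))) \<in> borel_measurable (iid J)"
    by (rule measurable_SUP_bounded[OF _ mixed_term_bound]) measurable
  then show ?thesis by (simp add: mixed_def[abs_def])
qed

end

text \<open>One coordinate at a time: \<open>j\<close> is symmetrised with the rest of the sample
  frozen, then the rest is treated by the induction hypothesis with the term of \<open>j\<close>
  frozen. Frozen terms go into the offset, which is why \<open>A\<close> is arbitrary in the
  induction.\<close>

lemma symmetrize:
  fixes I :: "'i set"
  assumes "finite I" and A: "\<And>n. \<bar>A n\<bar> \<le> K"
  shows "(\<integral>x. mixed A I (\<lambda>_. 1) (\<lambda>_. -1) x \<partial>iid I)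
    \<le> savg I (\<lambda>s. \<integral>x. mixed A I (\<lambda>_. 0) (\<lambda>i. 2 * s i) x \<partial>iid I)"
  using assms
proof (induction I arbitrary: A K rule: finite_induct)
  case empty
  show ?case by (simp add: savg_empty mixed_def)
next
  case (insert j I)
  note A = insert.prems and I = insert.hyps
  let ?J = "insert j I"
  let ?B = "K + real (card ?J) * (4 * \<gamma>)"
  \<comment> \<open>The hybrid: coordinate \<open>j\<close> already carries the sign
    \<open>a\<close>, the others are not yet symmetrised.\<close>
  define h where "h a = mixed A ?J ((\<lambda>_. 1)(j := 0)) ((\<lambda>_. -1)(j := 2 * a))" for a
  define G where "G = mixed A ?J (\<lambda>_. 1) (\<lambda>_. -1)"
  define F where "F s = mixed A ?J (\<lambda>_. 0) (\<lambda>i. 2 * s i)" for s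
  have h: "h a \<in> borel_measurable (iid ?J)" "\<And>x. x \<in> space (iid ?J) \<Longrightarrow> \<bar>h a x\<bar> \<le> ?B" if "\<bar>a\<bar> = 1" for a
    unfolding h_def by (rule mixed_measurable[OF A] mixed_bound[OF A]; use that in auto)+
  have G: "G \<in> borel_measurable (iid ?J)" "\<And>x. x \<in> space (iid ?J) \<Longrightarrow> \<bar>G x\<bar> \<le> ?B"
    unfolding G_def by (rule mixed_measurable[OF A] mixed_bound[OF A]; simp)+
  have F: "F s \<in> borel_measurable (iid ?J)" "\<And>x. x \<in> space (iid ?J) \<Longrightarrow> \<bar>F s x\<bar> \<le> ?B"
    if "\<And>i. i \<in> ?J \<Longrightarrow> \<bar>s i\<bar> = 1" for s
    unfolding F_def by (rule mixed_measurable[OF A] mixed_bound[OF A]; simp add: that abs_mult)+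
  have half: "(\<integral>x. h a x \<partial>iid ?J) \<le> savg I (\<lambda>s. \<integral>x. F (s(j := a)) x \<partial>iid ?J)" if a: "\<bar>a\<bar> = 1" for a
  proof -
    have s1: "\<bar>(s(j := a)) i\<bar> = 1" if "s \<in> signs I" "i \<in> ?J" for s i
      using that a signs_abs[OF that(1), of i] by auto
    have Fs: "F (s(j := a)) \<in> borel_measurable (iid ?J)" "\<And>x. x \<in> space (iid ?J) \<Longrightarrow> \<bar>F (s(j := a)) x\<bar> \<le> ?B"
      if "s \<in> signs I" for s
      using F[of "s(j := a)"] s1[OF that] by blast+
    have Fint: "integrable M (\<lambda>y. \<integral>x. F (s(j := a)) (x(j := y)) \<partial>iid I)" if "s \<in> signs I" for s
      by (rule integrable_PiM_insert(2)[OF Fs[OF that]])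
    have "(\<integral>x. h a x \<partial>iid ?J) = (\<integral>y. (\<integral>x. h a (x(j := y)) \<partial>iid I) \<partial>M)"
      by (rule integral_PiM_insert(2)[OF I h[OF a]])
    also have "\<dots> \<le> (\<integral>y. savg I (\<lambda>s. \<integral>x. F (s(j := a)) (x(j := y)) \<partial>iid I) \<partial>M)"
    proof (rule integral_mono[OF integrable_PiM_insert(2)[OF h[OF a]]])
      show "integrable M (\<lambda>y. savg I (\<lambda>s. \<integral>x. F (s(j := a)) (x(j := y)) \<partial>iid I))"
        unfolding savg_def
        by (intro Bochner_Integration.integrable_divide Bochner_Integration.integrable_sum Fint)
      fix y assume y: "y \<in> space M"
      let ?A = "\<lambda>n. A n + 2 * a * l n y"
      have "h a (x(j := y)) = mixed ?A I (\<lambda>_. 1) (\<lambda>_. -1) x" for x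
        unfolding h_def mixed_insert[OF I] fun_upd_same mult_zero_left add_0_left
        by (rule mixed_cong) (use I in auto)
      moreover have "F (s(j := a)) (x(j := y)) = mixed ?A I (\<lambda>_. 0) (\<lambda>i. 2 * s i) x" for s x
        unfolding F_def mixed_insert[OF I] fun_upd_same mult_zero_left add_0_left
        by (rule mixed_cong) (use I in auto)
      moreover have "\<bar>?A n\<bar> \<le> K + 2 * \<gamma>" for n
      proof -
        have "\<bar>2 * a * l n y\<bar> \<le> 2 * \<gamma>" using l_abs[OF y, of n] a by (simp add: abs_mult)
        then show ?thesis using A[of n] by linarith
      qed
      ultimately show "(\<integral>x. h a (x(j := y)) \<partial>iid I) \<le> savg I (\<lambda>s. \<integral>x. F (s(j := a)) (x(j := y)) \<partial>iid I)"
        using insert.IH[of ?A "K + 2 * \<gamma>"] by simp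
    qed
    also have "\<dots> = savg I (\<lambda>s. \<integral>y. \<integral>x. F (s(j := a)) (x(j := y)) \<partial>iid I \<partial>M)"
      unfolding savg_def
      by (subst integral_divide_zero, subst Bochner_Integration.integral_sum) (auto intro!: Fint)
    also have "\<dots> = savg I (\<lambda>s. \<integral>x. F (s(j := a)) x \<partial>iid ?J)"
      unfolding savg_def
      by (intro arg_cong2[where f = "(/)"] sum.cong refl integral_PiM_insert(2)[symmetric, OF I Fs])
    finally show ?thesis .
  qed
  have "(\<integral>x. G x \<partial>iid ?J) = (\<integral>x. (\<integral>y. G (x(j := y)) \<partial>M) \<partial>iid I)"
    by (rule integral_PiM_insert(1)[OF I G])
  also have "\<dots> \<le> (\<integral>x. ((\<integral>y. h 1 (x(j := y)) \<partial>M) + (\<integral>y. h (-1) (x(j := y)) \<partial>M)) / 2 \<partial>iid I)"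
  proof (rule integral_mono[OF integrable_PiM_insert(1)[OF G]])
    show "integrable (iid I) (\<lambda>x. ((\<integral>y. h 1 (x(j := y)) \<partial>M) + (\<integral>y. h (-1) (x(j := y)) \<partial>M)) / 2)"
      by (intro Bochner_Integration.integrable_divide Bochner_Integration.integrable_add
          integrable_PiM_insert(1)[OF h]) auto
    fix x assume x: "x \<in> space (iid I)"
    \<comment> \<open>Now the other coordinates are frozen and form the offset of
      \<open>symmetrize_one\<close>.\<close>
    define A' where "A' n = A n + (\<Sum>i\<in>I. 1 * risk n + -1 * l n (x i))" for n
    have "\<bar>A' n\<bar> \<le> K + real (card I) * (4 * \<gamma>)" for n
      unfolding A'_def by (rule mixed_term_bound[OF A _ x]) simp
    note symmetrize_one[OF this]
    moreover have "G (x(j := y)) = (SUP n. A' n + (risk n - l n y))" for y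
      unfolding G_def mixed_insert[OF I] by (simp add: mixed_def A'_def algebra_simps)
    moreover have "h a (x(j := y)) = (SUP n. A' n + 2 * a * l n y)" for a y
    proof -
      have "h a (x(j := y)) = mixed (\<lambda>n. A n + 2 * a * l n y) I (\<lambda>_. 1) (\<lambda>_. -1) x"
        unfolding h_def mixed_insert[OF I] fun_upd_same mult_zero_left add_0_left
        by (rule mixed_cong) (use I in auto)
      then show ?thesis by (simp add: mixed_def A'_def algebra_simps)
    qed
    ultimately show "(\<integral>y. G (x(j := y)) \<partial>M) \<le> ((\<integral>y. h 1 (x(j := y)) \<partial>M) + (\<integral>y. h (-1) (x(j := y)) \<partial>M)) / 2"
      by simp
  qed
  also have "\<dots> = ((\<integral>x. (\<integral>y. h 1 (x(j := y)) \<partial>M) \<partial>iid I) + (\<integral>x. (\<integral>y. h (-1) (x(j := y)) \<partial>M) \<partial>iid I)) / 2"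
    by (subst integral_divide_zero, subst Bochner_Integration.integral_add)
      (auto intro!: integrable_PiM_insert(1)[OF h])
  also have "\<dots> = ((\<integral>x. h 1 x \<partial>iid ?J) + (\<integral>x. h (-1) x \<partial>iid ?J)) / 2"
    using integral_PiM_insert(1)[OF I h[of 1]] integral_PiM_insert(1)[OF I h[of "-1"]] by simp
  also have "\<dots> \<le> savg ?J (\<lambda>s. \<integral>x. F s x \<partial>iid ?J)"
    unfolding savg_insert[OF I] using half[of 1] half[of "-1"] by simp
  finally show ?case unfolding G_def F_def .
qed

text \<open>Stated without dividing by the sample size. The Rademacher term is that of the drawn
  sample \<open>S\<close> itself, which allows a later bound by quantities that depend on
  \<open>S\<close>.\<close>

theorem uniform_deviation:
  fixes I :: "'i set"
  assumes I: "finite I" "I \<noteq> {}" and \<delta>: "0 < \<delta>" "\<delta> < 1" and \<gamma>: "\<gamma> > 0"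
  shows "\<exists>E \<in> sets (iid I). measure (iid I) E \<ge> 1 - \<delta> \<and>
    (\<forall>S\<in>E. \<forall>n. real (card I) * risk n \<le> (\<Sum>i\<in>I. l n (S i))
       + savg I (\<lambda>s. SUP n. \<Sum>i\<in>I. 2 * s i * l n (S i))
       + 3 * \<gamma> * sqrt (real (card I) * ln (1 / \<delta>) / 2))"
proof -
  interpret Q: prob_space "iid I" by (rule prob_space_PiM) unfold_locales
  define G where "G = mixed (\<lambda>_. 0) I (\<lambda>_. 1) (\<lambda>_. -1)"
  define R where "R s = mixed (\<lambda>_. 0) I (\<lambda>_. 0) (\<lambda>i. 2 * s i)" for s
  define h where "h x = G x - savg I (\<lambda>s. R s x)" for x
  define B where "B = real (card I) * (4 * \<gamma>)"
  have comp: "x i \<in> space M" if "x \<in> space (iid I)" "i \<in> I" for x i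
    using that by (auto simp: space_PiM)
  have s2: "\<bar>2 * s i\<bar> \<le> 2" if "s \<in> signs I" "i \<in> I" for s i
    using signs_abs[OF that] by (simp add: abs_mult)
  have b1: "\<bar>\<Sum>i\<in>I. risk n - l n (x i)\<bar> \<le> B" if "x \<in> space (iid I)" for n x
    using mixed_term_bound[of "\<lambda>_. 0" 0 I "\<lambda>_. 1" "\<lambda>_. -1", OF _ _ that] by (simp add: B_def)
  have b2: "\<bar>\<Sum>i\<in>I. 2 * s i * l n (x i)\<bar> \<le> B" if "x \<in> space (iid I)" "s \<in> signs I" for n x s
    using mixed_term_bound[of "\<lambda>_. 0" 0 I "\<lambda>_. 0" "\<lambda>i. 2 * s i", OF _ _ that(1)] s2[OF that(2)]
    by (simp add: B_def)
  have G_eq: "G x = (SUP n. \<Sum>i\<in>I. risk n - l n (x i))" for x by (simp add: G_def mixed_def)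
  have R_eq: "R s x = (SUP n. \<Sum>i\<in>I. 2 * s i * l n (x i))" for s x by (simp add: R_def mixed_def)
  have Gm: "G \<in> borel_measurable (iid I)"
    unfolding G_def by (rule mixed_measurable[where K = 0]) auto
  have Rm: "R s \<in> borel_measurable (iid I)" if "s \<in> signs I" for s
    unfolding R_def by (rule mixed_measurable[where K = 0]) (use s2[OF that] in auto)
  have GB: "\<bar>G x\<bar> \<le> B" if "x \<in> space (iid I)" for x
    unfolding G_eq by (rule abs_SUP_le) (rule b1[OF that])
  have RB: "\<bar>R s x\<bar> \<le> B" if "x \<in> space (iid I)" "s \<in> signs I" for s x
    unfolding R_eq by (rule abs_SUP_le) (rule b2[OF that])
  have SRm: "(\<lambda>x. savg I (\<lambda>s. R s x)) \<in> borel_measurable (iid I)"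
    unfolding savg_def by (intro borel_measurable_divide borel_measurable_sum Rm borel_measurable_const)
  have hm: "h \<in> borel_measurable (iid I)"
    unfolding h_def by (intro borel_measurable_diff Gm SRm)
  have SRB: "\<bar>savg I (\<lambda>s. R s x)\<bar> \<le> B" if "x \<in> space (iid I)" for x
    by (rule abs_savg_le) (use RB[OF that] I in auto)
  have hB: "\<bar>h x\<bar> \<le> 2 * B" if "x \<in> space (iid I)" for x
    unfolding h_def using GB[OF that] SRB[OF that] by linarith
  have Rint: "integrable (iid I) (R s)" if s: "s \<in> signs I" for s
    by (rule Q.integrable_bounded[where B = B]) (use Rm RB s in auto)
  have mean: "(\<integral>x. h x \<partial>iid I) \<le> 0"
  proof -
    have "(\<integral>x. G x \<partial>iid I) \<le> savg I (\<lambda>s. \<integral>x. R s x \<partial>iid I)"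
      using symmetrize[OF I(1), of "\<lambda>_. 0" 0] unfolding G_def R_def by simp
    also have "\<dots> = (\<integral>x. savg I (\<lambda>s. R s x) \<partial>iid I)"
      unfolding savg_def
      by (subst integral_divide_zero, subst Bochner_Integration.integral_sum) (auto intro!: Rint)
    finally show ?thesis
      unfolding h_def
      by (subst Bochner_Integration.integral_diff)
         (auto intro!: Q.integrable_bounded[where B = B] Gm GB SRm SRB)
  qed
  have hd: "\<bar>h (x(i := y)) - h x\<bar> \<le> 3 * \<gamma>"
    if x: "x \<in> space (iid I)" and i: "i \<in> I" and y: "y \<in> space M" for x i y
  proof -
    have x': "x(i := y) \<in> space (iid I)"
      using upd_in_space[OF x y, of i] i by (simp add: insert_absorb)
    have ld: "\<bar>l n y - l n (x i)\<bar> \<le> \<gamma>" for n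
      using l_bound[OF y, of n] l_bound[OF comp[OF x i], of n] by linarith
    have sd: "(\<Sum>k\<in>I. \<phi> k ((x(i := y)) k)) - (\<Sum>k\<in>I. \<phi> k (x k)) = \<phi> i y - \<phi> i (x i)"
      for \<phi> :: "'i \<Rightarrow> 'a \<Rightarrow> real"
    proof -
      have "(\<Sum>k\<in>I - {i}. \<phi> k ((x(i := y)) k)) = (\<Sum>k\<in>I - {i}. \<phi> k (x k))"
        by (rule sum.cong) auto
      then show ?thesis
        using sum.remove[OF I(1) i, of "\<lambda>k. \<phi> k ((x(i := y)) k)"] sum.remove[OF I(1) i, of "\<lambda>k. \<phi> k (x k)"]
        by simp
    qed
    have "\<bar>G (x(i := y)) - G x\<bar> \<le> \<gamma>"
      unfolding G_eq
    proof (rule abs_SUP_diff_le[OF b1[OF x'] b1[OF x]])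
      show "\<bar>(\<Sum>k\<in>I. risk n - l n ((x(i := y)) k)) - (\<Sum>k\<in>I. risk n - l n (x k))\<bar> \<le> \<gamma>" for n
        unfolding sd[of "\<lambda>k z. risk n - l n z"] using ld[of n] by linarith
    qed
    moreover have "\<bar>savg I (\<lambda>s. R s (x(i := y))) - savg I (\<lambda>s. R s x)\<bar> \<le> 2 * \<gamma>"
      unfolding savg_diff[symmetric]
    proof (rule abs_savg_le[OF I(1)])
      fix s assume s: "s \<in> signs I"
      show "\<bar>R s (x(i := y)) - R s x\<bar> \<le> 2 * \<gamma>"
        unfolding R_eq
      proof (rule abs_SUP_diff_le[OF b2[OF x' s] b2[OF x s]])
        fix n
        have 1: "\<bar>2 * s i * l n y - 2 * s i * l n (x i)\<bar> = 2 * \<bar>l n y - l n (x i)\<bar>"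
          unfolding right_diff_distrib[symmetric] using signs_abs[OF s i] by (simp add: abs_mult)
        have 2: "2 * \<bar>l n y - l n (x i)\<bar> \<le> 2 * \<gamma>"
          using ld[of n] by simp
        show "\<bar>(\<Sum>k\<in>I. 2 * s k * l n ((x(i := y)) k)) - (\<Sum>k\<in>I. 2 * s k * l n (x k))\<bar> \<le> 2 * \<gamma>"
          unfolding sd[of "\<lambda>k z. 2 * s k * l n z"] by (rule ord_eq_le_trans[OF 1 2])
      qed
    qed
    ultimately show ?thesis unfolding h_def by linarith
  qed
  \<comment> \<open>Chosen so that the exponent 2 t^2 / (card I * (3 \<gamma>)^2) of McDiarmid's
    inequality equals ln (1 / \<delta>).\<close>
  define t where "t = 3 * \<gamma> * sqrt (real (card I) * ln (1 / \<delta>) / 2)"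
  have cI: "real (card I) > 0" using I by (simp add: card_gt_0_iff)
  have ld: "ln (1 / \<delta>) > 0" using \<delta> by simp
  have t: "t > 0" using cI ld \<gamma> by (simp add: t_def)
  let ?bad = "{x \<in> space (iid I). h x - (\<integral>x. h x \<partial>iid I) \<ge> t}"
  have "measure (iid I) ?bad \<le> exp (- 2 * t\<^sup>2 / (real (card I) * (3 * \<gamma>)\<^sup>2))"
    by (rule McDiarmid[OF I hm hB hd]) (use \<gamma> t in auto)
  also have "- 2 * t\<^sup>2 / (real (card I) * (3 * \<gamma>)\<^sup>2) = - ln (1 / \<delta>)"
    using \<gamma> cI ld by (simp add: t_def power_mult_distrib field_simps)
  also have "exp (- ln (1 / \<delta>)) = \<delta>" using \<delta> by (simp add: ln_div)
  finally have bad: "measure (iid I) ?bad \<le> \<delta>" .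
  have badm: "?bad \<in> sets (iid I)" using hm by measurable
  show ?thesis
  proof (intro bexI[of _ "space (iid I) - ?bad"] conjI ballI allI)
    show "measure (iid I) (space (iid I) - ?bad) \<ge> 1 - \<delta>"
      using bad Q.prob_compl[OF badm] by simp
    show "space (iid I) - ?bad \<in> sets (iid I)" using badm by (rule sets.compl_sets)
    fix S n assume "S \<in> space (iid I) - ?bad"
    then have S: "S \<in> space (iid I)" and "h S < (\<integral>x. h x \<partial>iid I) + t" by auto
    with mean have 1: "G S < savg I (\<lambda>s. R s S) + t" unfolding h_def by linarith
    have "(\<Sum>i\<in>I. risk n - l n (S i)) \<le> G S"
      unfolding G_eq by (rule cSUP_upper[OF _ bdd_above_abs[OF b1[OF S]]]) simp
    then have "real (card I) * risk n - (\<Sum>i\<in>I. l n (S i)) \<le> G S"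
      by (simp add: sum_subtractf)
    with 1 show "real (card I) * risk n \<le> (\<Sum>i\<in>I. l n (S i))
       + savg I (\<lambda>s. SUP n. \<Sum>i\<in>I. 2 * s i * l n (S i))
       + 3 * \<gamma> * sqrt (real (card I) * ln (1 / \<delta>) / 2)"
      unfolding R_eq t_def by linarith
  qed
qed

end

section \<open>Massart and Dudley\<close>

text \<open>After taking logarithms this is the auxiliary inequality of Hoeffding's lemma at p = 1/2
  and h = 2 x. Evenness covers negative x.\<close>

lemma cosh_le_exp_square:
  fixes x :: real
  shows "(exp x + exp (- x)) / 2 \<le> exp (x\<^sup>2 / 2)"
proof -
  have *: "(exp x + exp (- x)) / 2 \<le> exp (x\<^sup>2 / 2)" if "x \<ge> 0" for x :: real
  proof -
    have "- (2 * x) * (1 / 2) + ln (1 + 1 / 2 * (exp (2 * x) - 1)) \<le> (2 * x)\<^sup>2 / 8"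
      by (rule Hoeffdings_lemma_aux) (use that in auto)
    then have "- x + ln ((1 + exp (2 * x)) / 2) \<le> x\<^sup>2 / 2"
      by (simp add: field_simps)
    then have "exp (- x + ln ((1 + exp (2 * x)) / 2)) \<le> exp (x\<^sup>2 / 2)"
      by (subst exp_le_cancel_iff)
    moreover have "exp (ln ((1 + exp (2 * x)) / 2)) = (1 + exp (2 * x)) / 2"
      by (subst exp_ln) (simp_all add: add_pos_pos)
    ultimately have "exp (- x) * ((1 + exp (2 * x)) / 2) \<le> exp (x\<^sup>2 / 2)"
      by (simp only: exp_add)
    moreover have "exp (- x) * ((1 + exp (2 * x)) / 2) = (exp x + exp (- x)) / 2"
      by (simp add: field_simps exp_add[symmetric] mult_2)
    ultimately show ?thesis by simp
  qed
  show ?thesis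
    using *[of x] *[of "- x"] by (cases "x \<ge> 0") (auto simp: add.commute)
qed

text \<open>Independence of the signs appears as the exchange of product and sum over
  \<open>PiE\<close>; every factor is then a hyperbolic cosine.\<close>

lemma savg_exp_le:
  assumes "finite I"
  shows "savg I (\<lambda>s. exp (c * (\<Sum>i\<in>I. s i * a i))) \<le> exp (c\<^sup>2 * (L2_set a I)\<^sup>2 / 2)"
proof -
  have "(\<Sum>s\<in>signs I. exp (c * (\<Sum>i\<in>I. s i * a i)))
      = (\<Sum>s\<in>signs I. \<Prod>i\<in>I. exp (c * (s i * a i)))"
    using assms by (simp add: exp_sum sum_distrib_left)
  also have "\<dots> = (\<Prod>i\<in>I. \<Sum>y\<in>{-1, 1}. exp (c * (y * a i)))"
    by (rule prod_sum_PiE[symmetric]) (use assms in auto)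
  also have "\<dots> / 2 ^ card I = (\<Prod>i\<in>I. (exp (c * a i) + exp (- (c * a i))) / 2)"
    using prod_dividef[of "\<lambda>i. exp (c * a i) + exp (- (c * a i))" "\<lambda>_. 2" I] by (simp add: add.commute)
  also have "\<dots> \<le> (\<Prod>i\<in>I. exp ((c * a i)\<^sup>2 / 2))"
    by (intro prod_mono conjI cosh_le_exp_square) (auto intro!: add_nonneg_nonneg)
  also have "\<dots> = exp (c\<^sup>2 * (L2_set a I)\<^sup>2 / 2)"
    using assms by (simp add: exp_sum[symmetric] L2_set_def sum_nonneg power_mult_distrib
        sum_distrib_left sum_divide_distrib)
  finally show ?thesis unfolding savg_def .
qed

lemma Massart:
  fixes A :: "('i \<Rightarrow> real) set"
  assumes I: "finite I" and A: "finite A" "A \<noteq> {}" and card: "real (card A) \<le> exp q"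
    and r: "\<And>a. a \<in> A \<Longrightarrow> L2_set a I \<le> r" and r0: "r > 0"
  shows "savg I (\<lambda>s. Max ((\<lambda>a. \<Sum>i\<in>I. s i * a i) ` A)) \<le> r * sqrt (2 * q)"
proof -
  let ?m = "\<lambda>s. Max ((\<lambda>a. \<Sum>i\<in>I. s i * a i) ` A)"
  have main: "c * savg I ?m \<le> q + c\<^sup>2 * r\<^sup>2 / 2" if c: "c > 0" for c
  proof -
    \<comment> \<open>Chosen so that exp (- K) cancels the bound exp q * exp (c^2 r^2 / 2) on the
      exponential moment, which makes the average of c * ?m s - K nonpositive.\<close>
    define K where "K = q + c\<^sup>2 * r\<^sup>2 / 2"
    have "savg I (\<lambda>s. c * ?m s - K) \<le> savg I (\<lambda>s. exp (- K) * (\<Sum>a\<in>A. exp (c * (\<Sum>i\<in>I. s i * a i))) - 1)"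
    proof (rule savg_mono)
      fix s :: "'i \<Rightarrow> real"
      have "?m s \<in> (\<lambda>a. \<Sum>i\<in>I. s i * a i) ` A" using A by (intro Max_in) auto
      then obtain a where a: "a \<in> A" "?m s = (\<Sum>i\<in>I. s i * a i)" by auto
      \<comment> \<open>the tangent of \<open>exp\<close> at 0 takes the place of Jensen's inequality\<close>
      have "1 + (c * ?m s - K) \<le> exp (c * ?m s - K)" by (rule exp_ge_add_one_self)
      also have "\<dots> = exp (- K) * exp (c * (\<Sum>i\<in>I. s i * a i))"
        unfolding a(2) by (simp add: exp_add[symmetric])
      also have "\<dots> \<le> exp (- K) * (\<Sum>a\<in>A. exp (c * (\<Sum>i\<in>I. s i * a i)))"
        by (intro mult_left_mono member_le_sum[OF a(1)]) (use A in auto)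
      finally show "c * ?m s - K \<le> exp (- K) * (\<Sum>a\<in>A. exp (c * (\<Sum>i\<in>I. s i * a i))) - 1"
        by simp
    qed
    also have "\<dots> = exp (- K) * (\<Sum>a\<in>A. savg I (\<lambda>s. exp (c * (\<Sum>i\<in>I. s i * a i)))) - 1"
      by (simp add: savg_diff savg_const[OF I] savg_cmult savg_sum)
    also have "\<dots> \<le> exp (- K) * (\<Sum>a\<in>A. exp (c\<^sup>2 * r\<^sup>2 / 2)) - 1"
    proof (intro diff_right_mono mult_left_mono sum_mono)
      fix a assume "a \<in> A"
      then have "(L2_set a I)\<^sup>2 \<le> r\<^sup>2" by (intro power_mono r) auto
      then have "c\<^sup>2 * (L2_set a I)\<^sup>2 / 2 \<le> c\<^sup>2 * r\<^sup>2 / 2"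
        by (intro divide_right_mono mult_left_mono) auto
      then show "savg I (\<lambda>s. exp (c * (\<Sum>i\<in>I. s i * a i))) \<le> exp (c\<^sup>2 * r\<^sup>2 / 2)"
        by (intro order_trans[OF savg_exp_le[OF I]]) simp
    qed simp
    also have "\<dots> = exp (- K) * (real (card A) * exp (c\<^sup>2 * r\<^sup>2 / 2)) - 1" by simp
    also have "\<dots> \<le> exp (- K) * (exp q * exp (c\<^sup>2 * r\<^sup>2 / 2)) - 1"
      by (intro diff_right_mono mult_left_mono mult_right_mono card) auto
    also have "\<dots> = 0" by (simp add: K_def exp_add[symmetric])
    finally show ?thesis by (simp add: savg_diff savg_const[OF I] savg_cmult K_def)
  qed
  have "1 \<le> real (card A)" using A by (simp add: Suc_le_eq card_gt_0_iff)
  with card have "exp 0 \<le> exp q" unfolding exp_zero by linarith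
  then have q: "q \<ge> 0" by (subst (asm) exp_le_cancel_iff)
  show ?thesis
  proof (cases "savg I ?m \<le> 0")
    case True
    then show ?thesis using q r0 by (intro order_trans[OF True]) simp
  next
    case False
    define X where "X = savg I ?m"
    have X: "X > 0" using False by (simp add: X_def)
    \<comment> \<open>The choice c = X / r^2 is the one that makes \<open>main\<close> tightest. It
      is admissible only for a positive average, hence the case distinction.\<close>
    then have "X / r\<^sup>2 > 0" using r0 by simp
    from main[OF this, folded X_def] have "X\<^sup>2 \<le> r\<^sup>2 * (2 * q)"
      using r0 by (simp add: field_simps power2_eq_square)
    then have "sqrt (X\<^sup>2) \<le> sqrt (r\<^sup>2 * (2 * q))" by (rule real_sqrt_le_mono)
    then show ?thesis using X r0 unfolding X_def[symmetric] by (simp add: real_sqrt_mult)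
  qed
qed

lemma L2_set_minus_commute: "L2_set (\<lambda>i. f i - g i) I = L2_set (\<lambda>i. g i - f i) I"
  unfolding L2_set_def by (simp add: power2_commute)

lemma L2_set_triangle_diff:
  "L2_set (\<lambda>i. f i - h i) I \<le> L2_set (\<lambda>i. f i - g i) I + L2_set (\<lambda>i. g i - h i) I"
  using L2_set_triangle_ineq[of "\<lambda>i. f i - g i" "\<lambda>i. g i - h i" I] by simp

text \<open>The conclusion offers a majorant for each sign vector instead of a supremum, so
  \<open>T\<close> may be infinite. From one dyadic scale to the next the radius halves while the
  root of the log-covering bound doubles, so all scales cost the same; about log 2 N of them are
  used, which is the origin of the logarithm.\<close>

lemma Dudley:
  fixes v :: "'t \<Rightarrow> nat \<Rightarrow> real" and N :: nat
  assumes N: "N \<ge> 1" and \<gamma>: "\<gamma> > 0"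
    and v: "\<And>t i. t \<in> T \<Longrightarrow> i < N \<Longrightarrow> \<bar>v t i\<bar> \<le> \<gamma>"
    and R: "R \<ge> 0"
    and ent: "\<And>\<epsilon>. \<epsilon> > 0 \<Longrightarrow> \<exists>C. finite C \<and> real (card C) \<le> exp (2 * R / \<epsilon>\<^sup>2) \<and>
                (\<forall>t\<in>T. \<exists>y\<in>C. L2_set (\<lambda>i. v t i - y i) {..<N} \<le> \<epsilon>)"
    and T: "T \<noteq> {}"
  shows "\<exists>m. (\<forall>s\<in>signs {..<N}. \<forall>t\<in>T. (\<Sum>i<N. s i * v t i) \<le> m s) \<and>
      savg {..<N} m \<le> 4 * \<gamma> + 12 * sqrt R * ln (real N)"
proof -
  \<comment> \<open>The first radius is the largest possible norm of a vector with \<open>N\<close>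
    entries bounded by \<gamma>, so that zero alone is a cover.\<close>
  define e where "e j = \<gamma> * sqrt (real N) / 2 ^ j" for j :: nat
  have e0: "e j > 0" for j using \<gamma> N by (simp add: e_def)
  have eS: "e j = 2 * e (Suc j)" for j by (simp add: e_def)
  have vn: "L2_set (\<lambda>i. v t i - 0) {..<N} \<le> e 0" if "t \<in> T" for t
  proof -
    have "L2_set (\<lambda>i. v t i - 0) {..<N} = L2_set (\<lambda>i. \<bar>v t i\<bar>) {..<N}" by (simp add: L2_set_def)
    also have "\<dots> \<le> L2_set (\<lambda>_. \<gamma>) {..<N}" by (rule L2_set_mono) (use v[OF that] in auto)
    also have "\<dots> = e 0" using \<gamma> by (simp add: L2_set_constant e_def)
    finally show ?thesis .
  qed
  \<comment> \<open>Level 0 is forced to consist of the zero vector, so that the telescoping sum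
    starts from 0.\<close>
  let ?cover = "\<lambda>j C. (j = 0 \<longrightarrow> C = {\<lambda>_. 0}) \<and> finite C \<and> real (card C) \<le> exp (2 * R / (e j)\<^sup>2) \<and>
                (\<forall>t\<in>T. \<exists>y\<in>C. L2_set (\<lambda>i. v t i - y i) {..<N} \<le> e j)"
  have "\<exists>C. ?cover j C" for j
  proof (cases "j = 0")
    case True
    then show ?thesis using vn R by (intro exI[of _ "{\<lambda>_. 0}"]) simp
  next
    case False
    then show ?thesis using ent[OF e0[of j]] by simp
  qed
  then have "\<forall>j. \<exists>C. ?cover j C" ..
  from choice[OF this] obtain C where C: "\<forall>j. ?cover j (C j)" ..
  define \<pi> where "\<pi> j t = (SOME y. y \<in> C j \<and> L2_set (\<lambda>i. v t i - y i) {..<N} \<le> e j)" for j t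
  have \<pi>: "\<pi> j t \<in> C j" "L2_set (\<lambda>i. v t i - \<pi> j t i) {..<N} \<le> e j" if "t \<in> T" for j t
  proof -
    have "\<exists>y. y \<in> C j \<and> L2_set (\<lambda>i. v t i - y i) {..<N} \<le> e j" using C that by blast
    from someI_ex[OF this] show "\<pi> j t \<in> C j" "L2_set (\<lambda>i. v t i - \<pi> j t i) {..<N} \<le> e j"
      unfolding \<pi>_def by auto
  qed
  define A where "A j = (\<lambda>t i. \<pi> (Suc j) t i - \<pi> j t i) ` T" for j
  have Asub: "A j \<subseteq> (\<lambda>(y, z) i. z i - y i) ` (C j \<times> C (Suc j))" for j
    unfolding A_def using \<pi>(1) by force
  have fin: "finite (A j)" for j
    by (rule finite_subset[OF Asub]) (use C in auto)
  have ne: "A j \<noteq> {}" for j using T by (simp add: A_def)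
  \<comment> \<open>Since e j = 2 * e (Suc j), the coarser cover contributes a quarter of the
    exponent of the finer one: 1/2 + 2 = 5/2.\<close>
  have cardA: "real (card (A j)) \<le> exp (5 / 2 * R / (e (Suc j))\<^sup>2)" for j
  proof -
    have "card (A j) \<le> card (C j \<times> C (Suc j))"
      by (rule order_trans[OF card_mono[OF _ Asub] card_image_le]) (use C in auto)
    then have "real (card (A j)) \<le> real (card (C j)) * real (card (C (Suc j)))"
      by (simp add: card_cartesian_product flip: of_nat_mult)
    also have "\<dots> \<le> exp (2 * R / (e j)\<^sup>2) * exp (2 * R / (e (Suc j))\<^sup>2)"
      by (intro mult_mono) (use C in auto)
    also have "\<dots> = exp (5 / 2 * R / (e (Suc j))\<^sup>2)"
      unfolding exp_add[symmetric] eS[of j] using e0[of "Suc j"]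
      by (simp add: field_simps power2_eq_square)
    finally show ?thesis .
  qed
  have rad: "L2_set a {..<N} \<le> 3 * e (Suc j)" if "a \<in> A j" for a j
  proof -
    from that obtain t where t: "t \<in> T" "a = (\<lambda>i. \<pi> (Suc j) t i - \<pi> j t i)" by (auto simp: A_def)
    have "L2_set a {..<N} \<le> L2_set (\<lambda>i. \<pi> (Suc j) t i - v t i) {..<N} + L2_set (\<lambda>i. v t i - \<pi> j t i) {..<N}"
      unfolding t(2) by (rule L2_set_triangle_diff)
    also have "\<dots> \<le> e (Suc j) + e j"
      using \<pi>(2)[OF t(1)] by (intro add_mono) (auto simp: L2_set_minus_commute)
    finally show ?thesis using eS[of j] by simp
  qed
  define mj where "mj j s = Max ((\<lambda>a. \<Sum>i<N. s i * a i) ` A j)" for j and s :: "nat \<Rightarrow> real"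
  have sav: "savg {..<N} (mj j) \<le> 3 * sqrt 5 * sqrt R" for j
  proof -
    have "savg {..<N} (mj j) \<le> (3 * e (Suc j)) * sqrt (2 * (5 / 2 * R / (e (Suc j))\<^sup>2))"
      unfolding mj_def by (rule Massart[OF _ fin ne cardA rad]) (use e0 in auto)
    also have "sqrt (2 * (5 / 2 * R / (e (Suc j))\<^sup>2)) = sqrt 5 * sqrt R / e (Suc j)"
      using e0[of "Suc j"] R by (simp add: real_sqrt_divide real_sqrt_mult)
    finally show ?thesis using e0[of "Suc j"] by simp
  qed
  \<comment> \<open>Chaining stops at a radius of order \<gamma> / sqrt N: from N <= 2 * 2^k the
    remainder sqrt N * e k is at most 2 \<gamma>, within the 4 \<gamma> allowed.\<close>
  define k where "k = nat \<lfloor>log 2 (real N)\<rfloor>"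
  have log0: "log 2 (real N) \<ge> 0" using N by simp
  have k1: "real k \<le> log 2 (real N)" "log 2 (real N) < real k + 1"
    unfolding k_def using log0 by linarith+
  have k2: "real N \<le> 2 * 2 ^ k"
  proof -
    have "real N = 2 powr (log 2 (real N))" using N by simp
    also have "\<dots> \<le> 2 powr (real k + 1)" using k1(2) by (intro powr_mono) auto
    also have "\<dots> = 2 * 2 ^ k" by (simp add: powr_add powr_realpow)
    finally show ?thesis .
  qed
  define m where "m s = (\<Sum>j<k. mj j s) + sqrt (real N) * e k" for s
  show ?thesis
  proof (intro exI[of _ m] conjI ballI)
    fix s t assume s: "s \<in> signs {..<N}" and t: "t \<in> T"
    have tele: "v t i = (v t i - \<pi> k t i) + (\<Sum>j<k. \<pi> (Suc j) t i - \<pi> j t i)" for i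
    proof -
      have "\<pi> 0 t = (\<lambda>_. 0)" using \<pi>(1)[OF t, of 0] C by auto
      then show ?thesis using sum_lessThan_telescope[of "\<lambda>j. \<pi> j t i" k] by simp
    qed
    have "(\<Sum>i<N. s i * v t i) = (\<Sum>i<N. s i * (v t i - \<pi> k t i)) + (\<Sum>i<N. s i * (\<Sum>j<k. \<pi> (Suc j) t i - \<pi> j t i))"
      by (subst tele) (simp only: distrib_left sum.distrib)
    also have "(\<Sum>i<N. s i * (\<Sum>j<k. \<pi> (Suc j) t i - \<pi> j t i)) = (\<Sum>j<k. \<Sum>i<N. s i * (\<pi> (Suc j) t i - \<pi> j t i))"
      unfolding sum_distrib_left by (rule sum.swap)
    also have "(\<Sum>j<k. \<Sum>i<N. s i * (\<pi> (Suc j) t i - \<pi> j t i)) \<le> (\<Sum>j<k. mj j s)"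
    proof (rule sum_mono)
      fix j
      have "(\<lambda>i. \<pi> (Suc j) t i - \<pi> j t i) \<in> A j" using t by (auto simp: A_def)
      then show "(\<Sum>i<N. s i * (\<pi> (Suc j) t i - \<pi> j t i)) \<le> mj j s"
        unfolding mj_def using fin by (intro Max_ge) auto
    qed
    also have "(\<Sum>i<N. s i * (v t i - \<pi> k t i)) \<le> (\<Sum>i<N. \<bar>s i\<bar> * \<bar>v t i - \<pi> k t i\<bar>)"
      by (rule sum_mono) (simp flip: abs_mult)
    also have "\<dots> \<le> L2_set s {..<N} * L2_set (\<lambda>i. v t i - \<pi> k t i) {..<N}"
      by (rule L2_set_mult_ineq)
    also have "L2_set s {..<N} = sqrt (real N)"
    proof -
      have "(s i)\<^sup>2 = 1" if "i < N" for i
        using signs_abs[OF s, of i] that by (simp add: power2_eq_1_iff abs_if split: if_splits) 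
      then show ?thesis by (simp add: L2_set_def)
    qed
    also have "sqrt (real N) * L2_set (\<lambda>i. v t i - \<pi> k t i) {..<N} \<le> sqrt (real N) * e k"
      by (intro mult_left_mono \<pi>(2)[OF t]) auto
    finally show "(\<Sum>i<N. s i * v t i) \<le> m s" unfolding m_def by simp
  next
    have "savg {..<N} m = (\<Sum>j<k. savg {..<N} (mj j)) + sqrt (real N) * e k"
      unfolding m_def by (simp add: savg_add savg_sum savg_const)
    also have "(\<Sum>j<k. savg {..<N} (mj j)) \<le> (\<Sum>j<k. 3 * sqrt 5 * sqrt R)"
      by (rule sum_mono) (rule sav)
    also have "\<dots> = real k * (3 * sqrt 5) * sqrt R" by simp
    \<comment> \<open>From ln 2 >= 2/3 follows k <= (3/2) ln N, and 3 sqrt 5 <= 27/4, so the factor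
      is at most 81/8 < 12.\<close>
    also have "\<dots> \<le> 12 * ln (real N) * sqrt R"
    proof (rule mult_right_mono)
      have s5: "sqrt 5 \<le> 9 / (4::real)" by (rule real_le_lsqrt) (auto simp: power2_eq_square)
      have "real k * ln 2 \<le> ln (real N)" using k1(1) by (simp add: log_def field_simps)
      moreover have "real k * (2 / 3) \<le> real k * ln 2"
        by (intro mult_left_mono ln2_ge_two_thirds) auto
      ultimately have "real k * (2 / 3) \<le> ln (real N)" by linarith
      moreover have "real k * (3 * sqrt 5) \<le> real k * (27 / 4)"
        using s5 by (intro mult_left_mono) auto
      moreover have "0 \<le> ln (real N)" using N by simp
      ultimately show "real k * (3 * sqrt 5) \<le> 12 * ln (real N)" by linarith
    qed (use R in auto)
    also have "sqrt (real N) * e k = \<gamma> * (real N / 2 ^ k)" by (simp add: e_def)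
    also have "\<dots> \<le> \<gamma> * 4" using k2 \<gamma> by (intro mult_left_mono) (auto simp: field_simps)
    finally show "savg {..<N} m \<le> 4 * \<gamma> + 12 * sqrt R * ln (real N)" by (simp add: ac_simps)
  qed
qed

section \<open>Covering numbers of linear layers\<close>

lemma L2_set_square: "(L2_set f A)\<^sup>2 = (\<Sum>x\<in>A. (f x)\<^sup>2)"
  by (simp add: L2_set_def sum_nonneg)

lemma L2_set_zero [simp]: "L2_set (\<lambda>_. 0) A = 0"
  by (simp add: L2_set_def)

lemma sum_mult_le_L2_set: "(\<Sum>x\<in>A. f x * g x) \<le> L2_set f A * L2_set g A"
  by (rule order_trans[OF sum_mono L2_set_mult_ineq]) (simp flip: abs_mult)

lemma L2_set_leI: "0 \<le> c \<Longrightarrow> (\<Sum>x\<in>A. (f x)\<^sup>2) \<le> c\<^sup>2 \<Longrightarrow> L2_set f A \<le> c"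
  unfolding L2_set_square[symmetric] by (rule power2_le_imp_le)

section \<open>Projection onto balls and Maurey's method\<close>

definition clip :: "'a set \<Rightarrow> real \<Rightarrow> ('a \<Rightarrow> real) \<Rightarrow> 'a \<Rightarrow> real" where
  "clip A r Z = (if L2_set Z A \<le> r then Z else (\<lambda>x. r / L2_set Z A * Z x))"

lemma clip_norm: "0 \<le> r \<Longrightarrow> L2_set (clip A r Z) A \<le> r"
  unfolding clip_def using L2_set_right_distrib[of "r / L2_set Z A" Z A]
  by (auto simp: divide_nonneg_nonneg)

text \<open>Expanding both squares and removing the factor 1 - c reduces the claim to 2 p <= z^2 + r
  z for the inner product p. This holds because p <= r z by Cauchy-Schwarz and r <= z outside the
  ball.\<close>

lemma clip_closer:
  assumes f: "L2_set f A \<le> r"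
  shows "L2_set (\<lambda>x. f x - clip A r Z x) A \<le> L2_set (\<lambda>x. f x - Z x) A"
proof (cases "L2_set Z A \<le> r")
  case False
  define z where "z = L2_set Z A"
  have r0: "0 \<le> r" using f L2_set_nonneg order_trans by blast
  have z: "z > r" "z > 0" using False r0 by (auto simp: z_def)
  define c where "c = r / z"
  have c: "0 \<le> c" "c < 1" "c * z = r" using z r0 by (auto simp: c_def)
  define p where "p = (\<Sum>x\<in>A. f x * Z x)"
  have p: "p \<le> r * z" unfolding p_def z_def
    by (rule order_trans[OF sum_mult_le_L2_set mult_right_mono[OF f]]) simp
  have ex: "(\<Sum>x\<in>A. (f x - a * Z x)\<^sup>2) = (\<Sum>x\<in>A. (f x)\<^sup>2) - 2 * a * p + a\<^sup>2 * z\<^sup>2" for a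
    unfolding p_def z_def L2_set_square
    by (simp add: power2_diff sum.distrib sum_subtractf sum_distrib_left power_mult_distrib mult_ac)
  have "(1 - c) * (2 * p) \<le> (1 - c) * (z\<^sup>2 + r * z)"
  proof (rule mult_left_mono)
    have "r * z \<le> z * z" using z by (intro mult_right_mono) auto
    then show "2 * p \<le> z\<^sup>2 + r * z" using p by (simp add: power2_eq_square)
  qed (use c in simp)
  also have "(1 - c) * (z\<^sup>2 + r * z) = z\<^sup>2 - c\<^sup>2 * z\<^sup>2"
    unfolding c(3)[symmetric] by (simp add: algebra_simps power2_eq_square)
  finally have "(\<Sum>x\<in>A. (f x - c * Z x)\<^sup>2) \<le> (\<Sum>x\<in>A. (f x - Z x)\<^sup>2)"
    using ex[of c] ex[of 1] by (simp add: algebra_simps)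
  then have "L2_set (\<lambda>x. f x - c * Z x) A \<le> L2_set (\<lambda>x. f x - Z x) A"
    unfolding L2_set_def by simp
  then show ?thesis using False by (simp add: clip_def c_def z_def)
qed (simp add: clip_def)

text \<open>A deterministic form of Maurey's argument. \<open>H\<close> is the dual description of
  \<open>f\<close> as a convex combination of atoms. In place of random sampling, the next atom is
  chosen against the current error, so that the cross terms are nonpositive together; the squared
  error then grows by at most \<beta>^2 per atom, as the variance of independent samples
  would.\<close>

lemma greedy_approximation:
  fixes f :: "'a \<Rightarrow> real"
  assumes V: "\<And>v. v \<in> V \<Longrightarrow> L2_set v A \<le> \<beta>"
    and H: "\<And>g. \<exists>v\<in>V. (\<Sum>x\<in>A. g x * v x) \<le> (\<Sum>x\<in>A. g x * f x)"
  shows "\<exists>vs. length vs = k \<and> set vs \<subseteq> V \<and>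
     (L2_set (\<lambda>x. (\<Sum>v\<leftarrow>vs. v x) - real k * f x) A)\<^sup>2 \<le> real k * \<beta>\<^sup>2"
proof (induction k)
  case (Suc k)
  then obtain vs where vs: "length vs = k" "set vs \<subseteq> V"
    "(L2_set (\<lambda>x. (\<Sum>v\<leftarrow>vs. v x) - real k * f x) A)\<^sup>2 \<le> real k * \<beta>\<^sup>2" by blast
  define S where "S x = (\<Sum>v\<leftarrow>vs. v x) - real k * f x" for x
  obtain v where v: "v \<in> V" "(\<Sum>x\<in>A. (S x - f x) * v x) \<le> (\<Sum>x\<in>A. (S x - f x) * f x)"
    using H[of "\<lambda>x. S x - f x"] by blast
  have "(\<Sum>x\<in>A. (S x + v x - f x)\<^sup>2)
      = (\<Sum>x\<in>A. (S x)\<^sup>2 + (v x)\<^sup>2 - (f x)\<^sup>2 + 2 * ((S x - f x) * v x) - 2 * ((S x - f x) * f x))"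
    by (rule sum.cong) (auto simp: power2_eq_square algebra_simps)
  also have "\<dots> = (\<Sum>x\<in>A. (S x)\<^sup>2) + (\<Sum>x\<in>A. (v x)\<^sup>2) - (\<Sum>x\<in>A. (f x)\<^sup>2)
      + 2 * (\<Sum>x\<in>A. (S x - f x) * v x) - 2 * (\<Sum>x\<in>A. (S x - f x) * f x)"
    by (simp add: sum.distrib sum_subtractf sum_distrib_left)
  also have "\<dots> \<le> (\<Sum>x\<in>A. (S x)\<^sup>2) + (\<Sum>x\<in>A. (v x)\<^sup>2)"
    using v(2) sum_nonneg[of A "\<lambda>x. (f x)\<^sup>2"] by simp
  also have "\<dots> \<le> real k * \<beta>\<^sup>2 + \<beta>\<^sup>2"
  proof (rule add_mono)
    show "(\<Sum>x\<in>A. (S x)\<^sup>2) \<le> real k * \<beta>\<^sup>2" using vs(3) unfolding L2_set_square S_def .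
    show "(\<Sum>x\<in>A. (v x)\<^sup>2) \<le> \<beta>\<^sup>2"
      unfolding L2_set_square[symmetric] by (intro power_mono V v) auto
  qed
  finally have 1: "(\<Sum>x\<in>A. (S x + v x - f x)\<^sup>2) \<le> real (Suc k) * \<beta>\<^sup>2" by (simp add: algebra_simps)
  have 2: "(\<Sum>u\<leftarrow>v # vs. u x) - real (Suc k) * f x = S x + v x - f x" for x
    by (simp add: S_def algebra_simps)
  show ?case
    by (rule exI[of _ "v # vs"], unfold 2 L2_set_square) (use vs v 1 in auto)
qed simp

text \<open>The averages of all lists of \<open>k\<close> atoms form a cover that does not depend on
  the target, and repetitions are allowed, hence the size \<open>card V ^ k\<close>.\<close>

lemma Maurey_cover:
  fixes f :: "'t \<Rightarrow> 'a \<Rightarrow> real"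
  assumes fin: "finite V" and V: "\<And>v. v \<in> V \<Longrightarrow> L2_set v A \<le> \<beta>" and \<beta>: "0 \<le> \<beta>" and k: "k \<ge> 1"
    and H: "\<And>t g. t \<in> T \<Longrightarrow> \<exists>v\<in>V. (\<Sum>x\<in>A. g x * v x) \<le> (\<Sum>x\<in>A. g x * f t x)"
  shows "\<exists>C. finite C \<and> card C \<le> card V ^ k \<and>
     (\<forall>t\<in>T. \<exists>y\<in>C. L2_set (\<lambda>x. f t x - y x) A \<le> \<beta> / sqrt (real k))"
proof -
  let ?L = "{vs. set vs \<subseteq> V \<and> length vs = k}"
  let ?C = "(\<lambda>vs x. (\<Sum>v\<leftarrow>vs. v x) / real k) ` ?L"
  have finL: "finite ?L" using fin by (rule finite_lists_length_eq)
  show ?thesis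
  proof (intro exI[of _ ?C] conjI ballI)
    show "finite ?C" using finL by simp
    show "card ?C \<le> card V ^ k"
      using card_image_le[OF finL] card_lists_length_eq[OF fin, of k] by metis
    fix t assume t: "t \<in> T"
    obtain vs where vs: "length vs = k" "set vs \<subseteq> V"
      "(L2_set (\<lambda>x. (\<Sum>v\<leftarrow>vs. v x) - real k * f t x) A)\<^sup>2 \<le> real k * \<beta>\<^sup>2"
      using greedy_approximation[OF V H[OF t]] by blast
    have "L2_set (\<lambda>x. f t x - (\<Sum>v\<leftarrow>vs. v x) / real k) A
        = L2_set (\<lambda>x. 1 / real k * ((\<Sum>v\<leftarrow>vs. v x) - real k * f t x)) A"
      using k by (subst L2_set_minus_commute) (simp add: field_simps)
    also have "\<dots> = 1 / real k * L2_set (\<lambda>x. (\<Sum>v\<leftarrow>vs. v x) - real k * f t x) A"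
      by (rule L2_set_right_distrib[symmetric]) simp
    also have "\<dots> \<le> 1 / real k * (sqrt (real k) * \<beta>)"
    proof (rule mult_left_mono)
      show "L2_set (\<lambda>x. (\<Sum>v\<leftarrow>vs. v x) - real k * f t x) A \<le> sqrt (real k) * \<beta>"
        by (rule power2_le_imp_le) (use vs(3) \<beta> in \<open>auto simp: power_mult_distrib\<close>)
    qed simp
    also have "\<dots> = \<beta> / sqrt (real k)"
      using k by (simp add: field_simps real_div_sqrt)
    finally show "\<exists>y\<in>?C. L2_set (\<lambda>x. f t x - y x) A \<le> \<beta> / sqrt (real k)"
      using vs(1,2) by (intro bexI[of _ "\<lambda>x. (\<Sum>v\<leftarrow>vs. v x) / real k"]) auto
  qed
qed

text \<open>The matrix product with rows indexed by an arbitrary type, so that the rows of all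
  graphs can be treated as one family.\<close>

definition mul :: "nat \<Rightarrow> ('p \<times> nat \<Rightarrow> real) \<Rightarrow> (nat \<Rightarrow> nat \<Rightarrow> real) \<Rightarrow> 'p \<times> nat \<Rightarrow> real" where
  "mul d Y w = (\<lambda>(p, j). \<Sum>a<d. Y (p, a) * w a j)"

definition col_norms :: "nat \<Rightarrow> nat \<Rightarrow> (nat \<Rightarrow> nat \<Rightarrow> real) \<Rightarrow> real" where
  "col_norms d m w = (\<Sum>j<m. L2_set (\<lambda>a. w a j) {..<d})"

lemma mul_diff: "mul d (\<lambda>x. Y x - Z x) w x = mul d Y w x - mul d Z w x"
  by (simp add: mul_def split_beta sum_subtractf left_diff_distrib)

lemma L2_set_prod_square:
  "finite P \<Longrightarrow> (L2_set Y (P \<times> {..<d}))\<^sup>2 = (\<Sum>p\<in>P. (L2_set (\<lambda>a. Y (p, a)) {..<d})\<^sup>2)"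
  unfolding L2_set_square by (simp add: sum.cartesian_product split_beta)

lemma L2_set_prod_square':
  "finite P \<Longrightarrow> (L2_set Y (P \<times> {..<d}))\<^sup>2 = (\<Sum>a<d. (L2_set (\<lambda>p. Y (p, a)) P)\<^sup>2)"
  by (simp only: L2_set_prod_square, simp only: L2_set_square, rule sum.swap)

text \<open>Bounds the total coefficient when Y W is written in normalised columns of
  \<open>Y\<close> placed into single output columns. Cauchy-Schwarz is applied per column of
  \<open>w\<close>, which is exactly why the (2,1)-norm is the right constraint.\<close>

lemma weighted_columns_le:
  assumes P: "finite P" and w: "col_norms d d' w \<le> b"
    and Y: "L2_set Y (P \<times> {..<d}) \<le> B"
  shows "(\<Sum>j<d'. \<Sum>a<d. \<bar>w a j\<bar> * L2_set (\<lambda>p. Y (p, a)) P) \<le> B * b"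
proof -
  define n where "n a = L2_set (\<lambda>p. Y (p, a)) P" for a
  have n: "L2_set n {..<d} = L2_set Y (P \<times> {..<d})"
    by (rule power2_eq_imp_eq) (use L2_set_prod_square'[OF P, of Y d] in \<open>auto simp: n_def L2_set_square\<close>)
  have n0: "\<bar>n a\<bar> = n a" for a by (simp add: n_def)
  have B: "0 \<le> B" using Y L2_set_nonneg order_trans by blast
  have "(\<Sum>j<d'. \<Sum>a<d. \<bar>w a j\<bar> * n a) \<le> (\<Sum>j<d'. L2_set (\<lambda>a. w a j) {..<d} * B)"
  proof (rule sum_mono)
    fix j
    have "(\<Sum>a<d. \<bar>w a j\<bar> * n a) \<le> L2_set (\<lambda>a. w a j) {..<d} * L2_set n {..<d}"
      using L2_set_mult_ineq[of "\<lambda>a. w a j" n "{..<d}"] by (simp add: n0)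
    also have "\<dots> \<le> L2_set (\<lambda>a. w a j) {..<d} * B"
      unfolding n by (intro mult_left_mono Y) auto
    finally show "(\<Sum>a<d. \<bar>w a j\<bar> * n a) \<le> L2_set (\<lambda>a. w a j) {..<d} * B" .
  qed
  also have "\<dots> = B * col_norms d d' w" by (simp add: col_norms_def sum_distrib_left mult.commute)
  also have "\<dots> \<le> B * b" by (intro mult_left_mono w B)
  finally show ?thesis unfolding n_def .
qed

text \<open>Cauchy-Schwarz in every output column, then the l2 norm over the columns is at most the
  l1 norm. As an operator bound it lets \<open>b\<close> replace a larger \<kappa>, and it covers a
  layer by the zero matrix when \<open>b\<close> is small.\<close>

lemma L2_set_mul_le:
  assumes P: "finite P" and w: "col_norms d d' w \<le> b"
  shows "L2_set (mul d Y w) (P \<times> {..<d'}) \<le> b * L2_set Y (P \<times> {..<d})"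
proof -
  have col: "L2_set (\<lambda>p. mul d Y w (p, j)) P \<le> L2_set (\<lambda>a. w a j) {..<d} * L2_set Y (P \<times> {..<d})" for j
  proof (rule L2_set_leI)
    have "(\<Sum>p\<in>P. (mul d Y w (p, j))\<^sup>2) \<le> (\<Sum>p\<in>P. (L2_set (\<lambda>a. Y (p, a)) {..<d} * L2_set (\<lambda>a. w a j) {..<d})\<^sup>2)"
    proof (rule sum_mono)
      fix p
      have "\<bar>mul d Y w (p, j)\<bar> \<le> (\<Sum>a<d. \<bar>Y (p, a)\<bar> * \<bar>w a j\<bar>)"
        unfolding mul_def by (simp flip: abs_mult)
      also have "\<dots> \<le> L2_set (\<lambda>a. Y (p, a)) {..<d} * L2_set (\<lambda>a. w a j) {..<d}" by (rule L2_set_mult_ineq)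
      finally show "(mul d Y w (p, j))\<^sup>2 \<le> (L2_set (\<lambda>a. Y (p, a)) {..<d} * L2_set (\<lambda>a. w a j) {..<d})\<^sup>2"
        by (rule power2_mono[of "mul d Y w (p, j)" "L2_set (\<lambda>a. Y (p, a)) {..<d} * L2_set (\<lambda>a. w a j) {..<d}", simplified abs_mult, simplified])
    qed
    also have "\<dots> = (L2_set (\<lambda>a. w a j) {..<d} * L2_set Y (P \<times> {..<d}))\<^sup>2"
      by (simp add: power_mult_distrib L2_set_prod_square[OF P] sum_distrib_left mult.commute)
    finally show "(\<Sum>p\<in>P. (mul d Y w (p, j))\<^sup>2) \<le> (L2_set (\<lambda>a. w a j) {..<d} * L2_set Y (P \<times> {..<d}))\<^sup>2" .
  qed simp
  have "L2_set (mul d Y w) (P \<times> {..<d'}) = L2_set (\<lambda>j. L2_set (\<lambda>p. mul d Y w (p, j)) P) {..<d'}"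
    by (rule power2_eq_imp_eq) (auto simp: L2_set_prod_square'[OF P] L2_set_square[of _ "{..<d'}"])
  also have "\<dots> \<le> (\<Sum>j<d'. L2_set (\<lambda>p. mul d Y w (p, j)) P)" by (rule L2_set_le_sum) simp
  also have "\<dots> \<le> (\<Sum>j<d'. L2_set (\<lambda>a. w a j) {..<d} * L2_set Y (P \<times> {..<d}))" by (rule sum_mono) (rule col)
  also have "\<dots> = col_norms d d' w * L2_set Y (P \<times> {..<d})" by (simp add: col_norms_def sum_distrib_right)
  also have "\<dots> \<le> b * L2_set Y (P \<times> {..<d})" by (intro mult_right_mono w) auto
  finally show ?thesis .
qed

text \<open>By \<open>weighted_columns_le\<close>, Y W lies in the convex hull of the signed
  normalised columns of \<open>Y\<close>, placed into single output columns and scaled by B * b.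
  There are at most 2 * d * d' such atoms, and Maurey's method applies.\<close>

lemma mul_cover:
  fixes Y :: "'p \<times> nat \<Rightarrow> real"
  assumes P: "finite P" and k: "k \<ge> 1" and b: "0 \<le> b" and D: "d * d' \<le> D" "D \<ge> 1"
    and Y: "L2_set Y (P \<times> {..<d}) \<le> B"
  shows "\<exists>C. finite C \<and> card C \<le> (2 * D) ^ k \<and>
    (\<forall>w. col_norms d d' w \<le> b \<longrightarrow>
       (\<exists>y\<in>C. L2_set (\<lambda>x. mul d Y w x - y x) (P \<times> {..<d'}) \<le> B * b / sqrt (real k)))"
proof (cases "d = 0 \<or> d' = 0")
  \<comment> \<open>Without rows or columns in the weight matrix there are no atoms to choose from,
    but the output has norm 0.\<close>
  case True
  have B: "0 \<le> B" using Y L2_set_nonneg order_trans by blast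
  have "L2_set (mul d Y w) (P \<times> {..<d'}) = 0" for w
    using True by (auto simp: mul_def L2_set_def split_beta)
  moreover have "(1::nat) \<le> (2 * D) ^ k" using D by (intro one_le_power) auto
  ultimately show ?thesis using B b by (intro exI[of _ "{\<lambda>_. 0}"]) auto
next
  case False
  then have dd: "d > 0" "d' > 0" by auto
  have B: "0 \<le> B" using Y L2_set_nonneg order_trans by blast
  define n where "n a = L2_set (\<lambda>p. Y (p, a)) P" for a
  \<comment> \<open>For a vanishing column the quotient Y (p, a) / n a is 0, so its atom is zero and
    represents the column correctly.\<close>
  define u :: "nat \<Rightarrow> nat \<Rightarrow> real \<Rightarrow> 'p \<times> nat \<Rightarrow> real"
    where "u a j s = (\<lambda>(p, j'). if j' = j then s * (B * b) * (Y (p, a) / n a) else 0)" for a j s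
  define V where "V = (\<lambda>(a, j, s). u a j s) ` ({..<d} \<times> {..<d'} \<times> {-1, 1})"
  have uV: "u a j s \<in> V" if "a < d" "j < d'" "s \<in> {-1, 1}" for a j s
    unfolding V_def using that by (intro image_eqI[of _ _ "(a, j, s)"]) auto
  have finV: "finite V" by (simp add: V_def)
  have "card V \<le> card ({..<d} \<times> {..<d'} \<times> {-1, 1::real})" unfolding V_def by (rule card_image_le) simp
  also have "\<dots> = 2 * (d * d')" by (simp add: card_cartesian_product)
  also have "\<dots> \<le> 2 * D" using D by simp
  finally have cV: "card V ^ k \<le> (2 * D) ^ k" by (rule power_mono) simp
  have ip: "(\<Sum>x\<in>P \<times> {..<d'}. g x * u a j s x) = s * (B * b) * (\<Sum>p\<in>P. g (p, j) * (Y (p, a) / n a))"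
    if "j < d'" for g a j s
  proof -
    have "(\<Sum>x\<in>P \<times> {..<d'}. g x * u a j s x) = (\<Sum>p\<in>P. \<Sum>j'<d'. g (p, j') * u a j s (p, j'))"
      by (simp add: sum.cartesian_product)
    also have "\<dots> = (\<Sum>p\<in>P. g (p, j) * (s * (B * b) * (Y (p, a) / n a)))"
    proof (rule sum.cong[OF refl])
      fix p
      have "(\<Sum>j'<d'. g (p, j') * u a j s (p, j')) = (\<Sum>j'<d'. if j' = j then g (p, j) * (s * (B * b) * (Y (p, a) / n a)) else 0)"
        by (rule sum.cong) (auto simp: u_def)
      then show "(\<Sum>j'<d'. g (p, j') * u a j s (p, j')) = g (p, j) * (s * (B * b) * (Y (p, a) / n a))"
        using that by simp
    qed
    finally show ?thesis by (simp add: sum_distrib_left mult_ac)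
  qed
  have normV: "L2_set v (P \<times> {..<d'}) \<le> B * b" if v: "v \<in> V" for v
  proof (rule L2_set_leI)
    obtain a j s where ajs: "a < d" "j < d'" "s = -1 \<or> s = 1" "v = u a j s" using v by (auto simp: V_def)
    have n1: "(\<Sum>p\<in>P. (Y (p, a))\<^sup>2) = (n a)\<^sup>2" by (simp add: n_def L2_set_square)
    have s2: "s * s = 1" using ajs(3) by auto
    have "(\<Sum>x\<in>P \<times> {..<d'}. (v x)\<^sup>2) = s * (B * b) * (\<Sum>p\<in>P. u a j s (p, j) * (Y (p, a) / n a))"
      using ip[OF ajs(2), of "u a j s" a s] by (simp add: ajs(4) power2_eq_square)
    also have "\<dots> = (s * s) * (B * b)\<^sup>2 * (\<Sum>p\<in>P. (Y (p, a))\<^sup>2 / (n a)\<^sup>2)"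
      by (simp add: u_def sum_distrib_left power2_eq_square mult_ac)
    also have "\<dots> = (B * b)\<^sup>2 * ((n a)\<^sup>2 / (n a)\<^sup>2)" by (simp only: s2 sum_divide_distrib[symmetric] n1 mult_1)
    also have "\<dots> \<le> (B * b)\<^sup>2" by simp
    finally show "(\<Sum>x\<in>P \<times> {..<d'}. (v x)\<^sup>2) \<le> (B * b)\<^sup>2" .
  qed (use B b in simp)
  have H: "\<exists>v\<in>V. (\<Sum>x\<in>P \<times> {..<d'}. g x * v x) \<le> (\<Sum>x\<in>P \<times> {..<d'}. g x * mul d Y w x)"
    if w: "w \<in> {w. col_norms d d' w \<le> b}" for w g
  proof -
    define q where "q a j = (\<Sum>p\<in>P. g (p, j) * (Y (p, a) / n a))" for a j
    have Yq: "(\<Sum>p\<in>P. g (p, j) * Y (p, a)) = n a * q a j" for a j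
    proof (cases "n a = 0")
      case True
      then have "\<forall>p\<in>P. Y (p, a) = 0" using P by (simp add: n_def L2_set_eq_0_iff)
      then show ?thesis using True by simp
    next
      case False
      then show ?thesis unfolding q_def sum_distrib_left by (intro sum.cong) auto
    qed
    \<comment> \<open>A linear functional is smallest on the atoms at the entry with the largest |q
      a j|, taken with the sign opposite to q.\<close>
    let ?S = "(\<lambda>(a, j). \<bar>q a j\<bar>) ` ({..<d} \<times> {..<d'})"
    have S: "finite ?S" "?S \<noteq> {}" using dd by auto
    obtain a0 j0 where m: "a0 < d" "j0 < d'" "Max ?S = \<bar>q a0 j0\<bar>"
      using Max_in[OF S] by auto
    have le: "\<bar>q a j\<bar> \<le> \<bar>q a0 j0\<bar>" if "a < d" "j < d'" for a j
      unfolding m(3)[symmetric] using that by (intro Max_ge S) auto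
    define s where "s = (if q a0 j0 \<ge> 0 then -1 else (1::real))"
    have s: "s * q a0 j0 = - \<bar>q a0 j0\<bar>" "s \<in> {-1, 1}" by (auto simp: s_def)
    have "(\<Sum>x\<in>P \<times> {..<d'}. g x * mul d Y w x) = (\<Sum>p\<in>P. \<Sum>j<d'. g (p, j) * mul d Y w (p, j))"
      by (simp add: sum.cartesian_product)
    also have "\<dots> = (\<Sum>p\<in>P. \<Sum>j<d'. \<Sum>a<d. g (p, j) * (Y (p, a) * w a j))"
      by (simp add: mul_def sum_distrib_left)
    also have "\<dots> = (\<Sum>j<d'. \<Sum>a<d. \<Sum>p\<in>P. g (p, j) * (Y (p, a) * w a j))"
      by (subst sum.swap, rule sum.cong[OF refl], rule sum.swap)
    also have "\<dots> = (\<Sum>j<d'. \<Sum>a<d. w a j * n a * q a j)"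
    proof -
      have "(\<Sum>p\<in>P. g (p, j) * (Y (p, a) * w a j)) = w a j * (\<Sum>p\<in>P. g (p, j) * Y (p, a))" for a j
        by (simp add: sum_distrib_left mult_ac)
      then show ?thesis unfolding Yq by (simp add: mult_ac)
    qed
    finally have e: "(\<Sum>x\<in>P \<times> {..<d'}. g x * mul d Y w x) = (\<Sum>j<d'. \<Sum>a<d. w a j * n a * q a j)" .
    have "- (\<Sum>j<d'. \<Sum>a<d. w a j * n a * q a j) \<le> (\<Sum>j<d'. \<Sum>a<d. \<bar>w a j\<bar> * n a * \<bar>q a0 j0\<bar>)"
      unfolding sum_negf[symmetric]
    proof (intro sum_mono)
      fix j a assume "j \<in> {..<d'}" "a \<in> {..<d}"
      have "- (w a j * n a * q a j) \<le> \<bar>w a j * n a * q a j\<bar>" by simp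
      also have "\<dots> = \<bar>w a j\<bar> * n a * \<bar>q a j\<bar>" by (simp add: abs_mult n_def)
      also have "\<dots> \<le> \<bar>w a j\<bar> * n a * \<bar>q a0 j0\<bar>"
        using le[of a j] \<open>j \<in> _\<close> \<open>a \<in> _\<close> by (intro mult_left_mono) (auto simp: n_def)
      finally show "- (w a j * n a * q a j) \<le> \<bar>w a j\<bar> * n a * \<bar>q a0 j0\<bar>" .
    qed
    also have "\<dots> = (\<Sum>j<d'. \<Sum>a<d. \<bar>w a j\<bar> * n a) * \<bar>q a0 j0\<bar>" by (simp add: sum_distrib_right)
    also have "\<dots> \<le> (B * b) * \<bar>q a0 j0\<bar>"
      using weighted_columns_le[OF P _ Y, where w = w and d' = d' and b = b] w by (intro mult_right_mono) (auto simp: n_def)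
    finally have "(\<Sum>x\<in>P \<times> {..<d'}. g x * u a0 j0 s x) \<le> (\<Sum>x\<in>P \<times> {..<d'}. g x * mul d Y w x)"
      unfolding e ip[OF m(2)] q_def[symmetric] using s(1) by (simp add: mult.assoc mult.left_commute)
    with uV[OF m(1,2) s(2)] show ?thesis by blast
  qed
  have "\<exists>C. finite C \<and> card C \<le> card V ^ k \<and>
    (\<forall>w\<in>{w. col_norms d d' w \<le> b}.
        \<exists>y\<in>C. L2_set (\<lambda>x. mul d Y w x - y x) (P \<times> {..<d'}) \<le> B * b / sqrt (real k))"
    by (rule Maurey_cover[OF finV normV _ k H]) (use B b in simp_all)
  then obtain C where "finite C" "card C \<le> card V ^ k"
    "\<forall>w\<in>{w. col_norms d d' w \<le> b}.
        \<exists>y\<in>C. L2_set (\<lambda>x. mul d Y w x - y x) (P \<times> {..<d'}) \<le> B * b / sqrt (real k)"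
    by blast
  then show ?thesis using cV by (intro exI[of _ C]) auto
qed

section \<open>Carrying covers through Lipschitz maps and linear layers\<close>

text \<open>
  The cover points must satisfy the norm bound \<open>B\<close>, and \<open>\<tau>\<close> is the radius relative to \<open>B\<close>:
  in this form a Lipschitz map changes only \<open>B\<close>, and a linear layer adds its own share to \<open>\<tau>\<close>.
\<close>
definition covered :: "'t set \<Rightarrow> ('t \<Rightarrow> 'a \<Rightarrow> real) \<Rightarrow> 'a set \<Rightarrow> real \<Rightarrow> real \<Rightarrow> real \<Rightarrow> bool" where
  "covered \<Theta> F A B \<tau> M \<longleftrightarrow> (\<forall>\<theta>\<in>\<Theta>. L2_set (F \<theta>) A \<le> B) \<and>
     (\<exists>C. finite C \<and> real (card C) \<le> M \<and> (\<forall>Y\<in>C. L2_set Y A \<le> B) \<and>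
        (\<forall>\<theta>\<in>\<Theta>. \<exists>Y\<in>C. L2_set (\<lambda>x. F \<theta> x - Y x) A \<le> B * \<tau>))"

lemma covered_const:
  assumes "L2_set X A \<le> B" "\<And>\<theta> x. \<theta> \<in> \<Theta> \<Longrightarrow> x \<in> A \<Longrightarrow> F \<theta> x = X x"
  shows "covered \<Theta> F A B 0 1"
proof -
  have "L2_set (F \<theta>) A = L2_set X A" "L2_set (\<lambda>x. F \<theta> x - X x) A = 0" if "\<theta> \<in> \<Theta>" for \<theta>
    using assms(2)[OF that] by (auto intro!: L2_set_cong L2_set_0')
  then show ?thesis unfolding covered_def using assms(1) by (intro conjI exI[of _ "{X}"]) auto
qed

text \<open>Since \<Phi> fixes 0, the Lipschitz estimate also bounds norms, so the images of the
  cover points satisfy the norm bound that \<open>covered\<close> demands.\<close>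

lemma covered_lipschitz:
  assumes cov: "covered \<Theta> F A B \<tau> M" and c: "0 \<le> c"
    and \<Phi>: "\<And>X Y. L2_set (\<lambda>x. \<Phi> X x - \<Phi> Y x) A' \<le> c * L2_set (\<lambda>x. X x - Y x) A"
    and \<Phi>0: "\<And>x. x \<in> A' \<Longrightarrow> \<Phi> (\<lambda>_. 0) x = 0"
    and G: "\<And>\<theta> x. \<theta> \<in> \<Theta> \<Longrightarrow> x \<in> A' \<Longrightarrow> G \<theta> x = \<Phi> (F \<theta>) x"
  shows "covered \<Theta> G A' (c * B) \<tau> M"
proof -
  obtain C where C: "finite C" "real (card C) \<le> M" "\<forall>Y\<in>C. L2_set Y A \<le> B"
     "\<forall>\<theta>\<in>\<Theta>. \<exists>Y\<in>C. L2_set (\<lambda>x. F \<theta> x - Y x) A \<le> B * \<tau>" and FB: "\<forall>\<theta>\<in>\<Theta>. L2_set (F \<theta>) A \<le> B"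
    using cov unfolding covered_def by blast
  have n: "L2_set (\<Phi> X) A' \<le> c * L2_set X A" for X
  proof -
    have "L2_set (\<Phi> X) A' = L2_set (\<lambda>x. \<Phi> X x - \<Phi> (\<lambda>_. 0) x) A'"
      using \<Phi>0 by (intro L2_set_cong) auto
    with \<Phi>[of X "\<lambda>_. 0"] show ?thesis by simp
  qed
  show ?thesis
    unfolding covered_def
  proof (intro conjI ballI exI[of _ "\<Phi> ` C"])
    fix \<theta> assume \<theta>: "\<theta> \<in> \<Theta>"
    have "L2_set (G \<theta>) A' = L2_set (\<Phi> (F \<theta>)) A'" using G[OF \<theta>] by (intro L2_set_cong) auto
    also have "\<dots> \<le> c * L2_set (F \<theta>) A" by (rule n)
    also have "\<dots> \<le> c * B" using FB \<theta> c by (intro mult_left_mono) auto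
    finally show "L2_set (G \<theta>) A' \<le> c * B" .
    obtain Y where Y: "Y \<in> C" "L2_set (\<lambda>x. F \<theta> x - Y x) A \<le> B * \<tau>" using C(4) \<theta> by blast
    have "L2_set (\<lambda>x. G \<theta> x - \<Phi> Y x) A' = L2_set (\<lambda>x. \<Phi> (F \<theta>) x - \<Phi> Y x) A'"
      using G[OF \<theta>] by (intro L2_set_cong) auto
    also have "\<dots> \<le> c * L2_set (\<lambda>x. F \<theta> x - Y x) A" by (rule \<Phi>)
    also have "\<dots> \<le> c * (B * \<tau>)" using Y c by (intro mult_left_mono) auto
    finally show "\<exists>Y\<in>\<Phi> ` C. L2_set (\<lambda>x. G \<theta> x - Y x) A' \<le> c * B * \<tau>"
      using Y(1) by (auto simp: mult.assoc)
  next
    fix Y assume "Y \<in> \<Phi> ` C"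
    then obtain X where "X \<in> C" "Y = \<Phi> X" by auto
    then show "L2_set Y A' \<le> c * B" using n[of X] C(3) c by (auto intro: order_trans mult_left_mono)
  next
    show "real (card (\<Phi> ` C)) \<le> M" using card_image_le[OF C(1), of \<Phi>] C(2) by linarith
  qed (use C in auto)
qed

text \<open>The error is split at the product of a cover point \<open>Y\<close> with the true
  weights: the operator bound carries the old radius B * \<tau> over, and because \<open>Y\<close>
  has norm at most \<open>B\<close>, the new error is at most \<kappa> * B * \<tau>'. The second
  cover depends on \<open>Y\<close>, so the sizes multiply.\<close>

lemma covered_linear:
  fixes F :: "'t \<Rightarrow> 'p \<times> nat \<Rightarrow> real"
  assumes cov: "covered \<Theta> F (P \<times> {..<d}) B \<tau> M" and P: "finite P" and B: "0 \<le> B"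
    and \<kappa>: "0 \<le> \<kappa>" and b: "0 \<le> b" and D: "d * d' \<le> D" "D \<ge> 1" and \<tau>': "0 \<le> \<tau>'"
    and S: "\<And>\<theta> Y. \<theta> \<in> \<Theta> \<Longrightarrow> L2_set (mul d Y (W \<theta>)) (P \<times> {..<d'}) \<le> \<kappa> * L2_set Y (P \<times> {..<d})"
    and N: "\<And>\<theta>. \<theta> \<in> \<Theta> \<Longrightarrow> col_norms d d' (W \<theta>) \<le> b"
    and k: "k = 0 \<and> b \<le> \<kappa> * \<tau>' \<or> k \<ge> 1 \<and> b\<^sup>2 \<le> real k * (\<kappa> * \<tau>')\<^sup>2"
    and G: "\<And>\<theta> x. \<theta> \<in> \<Theta> \<Longrightarrow> x \<in> P \<times> {..<d'} \<Longrightarrow> G \<theta> x = mul d (F \<theta>) (W \<theta>) x"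
  shows "covered \<Theta> G (P \<times> {..<d'}) (\<kappa> * B) (\<tau> + \<tau>') (M * (2 * real D) ^ k)"
proof -
  obtain C where C: "finite C" "real (card C) \<le> M" "\<forall>Y\<in>C. L2_set Y (P \<times> {..<d}) \<le> B"
     "\<forall>\<theta>\<in>\<Theta>. \<exists>Y\<in>C. L2_set (\<lambda>x. F \<theta> x - Y x) (P \<times> {..<d}) \<le> B * \<tau>"
     and FB: "\<forall>\<theta>\<in>\<Theta>. L2_set (F \<theta>) (P \<times> {..<d}) \<le> B"
    using cov unfolding covered_def by blast
  let ?A = "P \<times> {..<d'}"
  have "\<exists>CY. finite CY \<and> card CY \<le> (2 * D) ^ k \<and>
      (\<forall>w. col_norms d d' w \<le> b \<longrightarrow>
       (\<exists>y\<in>CY. L2_set (\<lambda>x. mul d Y w x - y x) ?A \<le> \<kappa> * B * \<tau>'))"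
    (is "\<exists>CY. ?cover Y CY") if Y: "Y \<in> C" for Y
  proof (cases "k = 0")
    case True
    then have b1: "b \<le> \<kappa> * \<tau>'" using k by auto
    have "L2_set (mul d Y w) ?A \<le> \<kappa> * B * \<tau>'" if "col_norms d d' w \<le> b" for w
    proof -
      have "L2_set (mul d Y w) ?A \<le> b * L2_set Y (P \<times> {..<d})" by (rule L2_set_mul_le[OF P that])
      also have "\<dots> \<le> (\<kappa> * \<tau>') * B" using C(3) Y b1 b \<kappa> \<tau>' by (intro mult_mono) auto
      finally show ?thesis by (simp add: mult_ac)
    qed
    then show ?thesis using True by (intro exI[of _ "{\<lambda>_. 0}"]) auto
  next
    case False
    then have k1: "k \<ge> 1" and "b\<^sup>2 \<le> real k * (\<kappa> * \<tau>')\<^sup>2" using k by auto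
    then have "b\<^sup>2 \<le> (sqrt (real k) * (\<kappa> * \<tau>'))\<^sup>2" by (simp add: power_mult_distrib)
    then have "b \<le> sqrt (real k) * (\<kappa> * \<tau>')"
      by (rule power2_le_imp_le) (use \<kappa> \<tau>' in simp)
    then have "b / sqrt (real k) \<le> \<kappa> * \<tau>'" using k1 by (simp add: divide_le_eq mult.commute)
    then have "B * (b / sqrt (real k)) \<le> B * (\<kappa> * \<tau>')" using B by (rule mult_left_mono)
    then have le: "B * b / sqrt (real k) \<le> \<kappa> * B * \<tau>'" by (simp add: mult_ac)
    obtain CY where CY: "finite CY" "card CY \<le> (2 * D) ^ k"
      "\<forall>w. col_norms d d' w \<le> b \<longrightarrow>
       (\<exists>y\<in>CY. L2_set (\<lambda>x. mul d Y w x - y x) ?A \<le> B * b / sqrt (real k))"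
      using mul_cover[OF P k1 b D, of Y B] C(3) Y by blast
    show ?thesis
      using CY(1,2) order_trans[OF _ le] CY(3) by (intro exI[of _ CY] conjI) blast+
  qed
  then have "\<forall>Y\<in>C. \<exists>CY. ?cover Y CY" by (intro ballI)
  from bchoice[OF this] obtain CY where "\<forall>Y\<in>C. ?cover Y (CY Y)" ..
  then have CY: "\<And>Y. Y \<in> C \<Longrightarrow> finite (CY Y)" "\<And>Y. Y \<in> C \<Longrightarrow> card (CY Y) \<le> (2 * D) ^ k"
    "\<And>Y w. Y \<in> C \<Longrightarrow> col_norms d d' w \<le> b \<Longrightarrow>
       (\<exists>y\<in>CY Y. L2_set (\<lambda>x. mul d Y w x - y x) ?A \<le> \<kappa> * B * \<tau>')"
    by blast+
  have \<kappa>B: "0 \<le> \<kappa> * B" using \<kappa> B by simp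
  define C' where "C' = (\<Union>Y\<in>C. clip ?A (\<kappa> * B) ` CY Y)"
  have "card C' \<le> (\<Sum>Y\<in>C. card (clip ?A (\<kappa> * B) ` CY Y))" unfolding C'_def by (rule card_UN_le[OF C(1)])
  also have "\<dots> \<le> (\<Sum>Y\<in>C. (2 * D) ^ k)"
    by (rule sum_mono, rule order_trans[OF card_image_le]) (use CY(1,2) in simp_all)
  finally have "real (card C') \<le> real (card C * (2 * D) ^ k)" by (simp only: of_nat_le_iff sum_constant mult.commute of_nat_id)
  also have "\<dots> = real (card C) * (2 * real D) ^ k" by simp
  also have "\<dots> \<le> M * (2 * real D) ^ k" by (intro mult_right_mono C) auto
  finally have card: "real (card C') \<le> M * (2 * real D) ^ k" .
  show ?thesis
    unfolding covered_def
  proof (intro conjI ballI exI[of _ C'])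
    show "finite C'" unfolding C'_def using C(1) CY(1) by auto
    show "real (card C') \<le> M * (2 * real D) ^ k" by (rule card)
    show "L2_set Y ?A \<le> \<kappa> * B" if "Y \<in> C'" for Y
      using that clip_norm[OF \<kappa>B] unfolding C'_def by auto
    fix \<theta> assume \<theta>: "\<theta> \<in> \<Theta>"
    have "L2_set (G \<theta>) ?A = L2_set (mul d (F \<theta>) (W \<theta>)) ?A" using G[OF \<theta>] by (intro L2_set_cong) auto
    also have "\<dots> \<le> \<kappa> * L2_set (F \<theta>) (P \<times> {..<d})" by (rule S[OF \<theta>])
    also have "\<dots> \<le> \<kappa> * B" using FB \<theta> \<kappa> by (intro mult_left_mono) auto
    finally show "L2_set (G \<theta>) ?A \<le> \<kappa> * B" .
    obtain Y where Y: "Y \<in> C" "L2_set (\<lambda>x. F \<theta> x - Y x) (P \<times> {..<d}) \<le> B * \<tau>" using C(4) \<theta> by blast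
    obtain y where y: "y \<in> CY Y" "L2_set (\<lambda>x. mul d Y (W \<theta>) x - y x) ?A \<le> \<kappa> * B * \<tau>'"
      using CY(3)[OF Y(1) N[OF \<theta>]] by blast
    have "L2_set (mul d Y (W \<theta>)) ?A \<le> \<kappa> * L2_set Y (P \<times> {..<d})" by (rule S[OF \<theta>])
    also have "\<dots> \<le> \<kappa> * B" using C(3) Y(1) \<kappa> by (intro mult_left_mono) auto
    finally have YB: "L2_set (mul d Y (W \<theta>)) ?A \<le> \<kappa> * B" .
    have "L2_set (\<lambda>x. G \<theta> x - clip ?A (\<kappa> * B) y x) ?A
        = L2_set (\<lambda>x. mul d (F \<theta>) (W \<theta>) x - clip ?A (\<kappa> * B) y x) ?A"
      using G[OF \<theta>] by (intro L2_set_cong) auto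
    also have "\<dots> \<le> L2_set (\<lambda>x. mul d (F \<theta>) (W \<theta>) x - mul d Y (W \<theta>) x) ?A
        + L2_set (\<lambda>x. mul d Y (W \<theta>) x - clip ?A (\<kappa> * B) y x) ?A"
      by (rule L2_set_triangle_diff)
    also have "\<dots> \<le> \<kappa> * (B * \<tau>) + \<kappa> * B * \<tau>'"
    proof (rule add_mono)
      have "L2_set (\<lambda>x. mul d (F \<theta>) (W \<theta>) x - mul d Y (W \<theta>) x) ?A
          = L2_set (mul d (\<lambda>x. F \<theta> x - Y x) (W \<theta>)) ?A"
        by (simp add: mul_diff cong: L2_set_cong)
      also have "\<dots> \<le> \<kappa> * L2_set (\<lambda>x. F \<theta> x - Y x) (P \<times> {..<d})" by (rule S[OF \<theta>])
      also have "\<dots> \<le> \<kappa> * (B * \<tau>)" using Y(2) \<kappa> by (rule mult_left_mono)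
      finally show "L2_set (\<lambda>x. mul d (F \<theta>) (W \<theta>) x - mul d Y (W \<theta>) x) ?A \<le> \<kappa> * (B * \<tau>)" .
      show "L2_set (\<lambda>x. mul d Y (W \<theta>) x - clip ?A (\<kappa> * B) y x) ?A \<le> \<kappa> * B * \<tau>'"
        by (rule order_trans[OF clip_closer[OF YB] y(2)])
    qed
    also have "\<dots> = \<kappa> * B * (\<tau> + \<tau>')" by (simp add: algebra_simps)
    finally have "L2_set (\<lambda>x. G \<theta> x - clip ?A (\<kappa> * B) y x) ?A \<le> \<kappa> * B * (\<tau> + \<tau>')" .
    then show "\<exists>Y\<in>C'. L2_set (\<lambda>x. G \<theta> x - Y x) ?A \<le> \<kappa> * B * (\<tau> + \<tau>')"
      using Y(1) y(1) unfolding C'_def by (intro bexI[of _ "clip ?A (\<kappa> * B) y"]) auto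
  qed
qed

section \<open>Balancing the layers\<close>

text \<open>With m the minimum, the product of squares is at most m^2 (w i)^2, which is at most (w
  i)^3 and also at most half of (w i)^3 + m^3. Using the first bound q - 1 times and the doubled
  second one once, then averaging over the q other indices, counts m^3 exactly once. A single number
  below 1 violates the claim, so two are required.\<close>

lemma sum_cubes_ge:
  fixes w :: "'j \<Rightarrow> real"
  assumes J: "finite J" "card J \<ge> 2" and w: "\<And>j. j \<in> J \<Longrightarrow> 0 < w j \<and> w j \<le> 1"
  shows "real (card J) * (\<Prod>j\<in>J. (w j)\<^sup>2) \<le> (\<Sum>j\<in>J. w j ^ 3)"
proof -
  have "J \<noteq> {}" using J(2) by auto
  with J(1) have ne: "w ` J \<noteq> {}" "finite (w ` J)" by auto
  obtain j0 where j0: "j0 \<in> J" "Min (w ` J) = w j0" using Min_in[OF ne(2,1)] by auto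
  have min: "w j0 \<le> w j" if "j \<in> J" for j unfolding j0(2)[symmetric] using that ne by (intro Min_le) auto
  define J' where "J' = J - {j0}"
  have J': "finite J'" "card J = Suc (card J')" unfolding J'_def using J(1) card_Suc_Diff1[OF J(1) j0(1)] by simp_all
  define q where "q = real (card J')"
  have q: "q \<ge> 1" using J(2) J'(2) by (simp add: q_def)
  define P where "P = (\<Prod>j\<in>J. (w j)\<^sup>2)"
  define m where "m = w j0"
  have m: "0 < m" "m \<le> 1" using w[OF j0(1)] by (auto simp: m_def)
  have key: "(q + 1) * P \<le> q * w i ^ 3 + m ^ 3" if i: "i \<in> J'" for i
  proof -
    have iJ: "i \<in> J" "i \<noteq> j0" using i by (auto simp: J'_def)
    have wi: "0 < w i" "w i \<le> 1" "m \<le> w i" using w[OF iJ(1)] min[OF iJ(1)] by (auto simp: m_def)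
    have "P = m\<^sup>2 * (\<Prod>j\<in>J'. (w j)\<^sup>2)"
      unfolding P_def J'_def m_def by (rule prod.remove[OF J(1) j0(1)])
    also have "(\<Prod>j\<in>J'. (w j)\<^sup>2) = (w i)\<^sup>2 * (\<Prod>j\<in>J' - {i}. (w j)\<^sup>2)"
      by (rule prod.remove[OF J'(1) i])
    also have "m\<^sup>2 * ((w i)\<^sup>2 * (\<Prod>j\<in>J' - {i}. (w j)\<^sup>2)) \<le> m\<^sup>2 * ((w i)\<^sup>2 * 1)"
    proof (intro mult_left_mono prod_le_1 conjI)
      fix j assume "j \<in> J' - {i}"
      then have "0 < w j \<and> w j \<le> 1" using w[of j] by (auto simp: J'_def)
      then show "(w j)\<^sup>2 \<le> 1" by (simp add: power_le_one)
    qed auto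
    finally have P: "P \<le> m\<^sup>2 * (w i)\<^sup>2" by simp
    have mm: "m * m \<le> m * 1" using m by (intro mult_left_mono) auto
    have e1: "m\<^sup>2 * (w i)\<^sup>2 \<le> w i ^ 3"
    proof -
      have "m\<^sup>2 \<le> w i" using mm wi(3) by (simp add: power2_eq_square)
      then have "m\<^sup>2 * (w i)\<^sup>2 \<le> w i * (w i)\<^sup>2" by (intro mult_right_mono) auto
      then show ?thesis by (simp add: power3_eq_cube power2_eq_square)
    qed
    have e2: "2 * (m\<^sup>2 * (w i)\<^sup>2) \<le> w i ^ 3 + m ^ 3"
    proof -
      have "0 \<le> ((w i)\<^sup>2 - m\<^sup>2)\<^sup>2" by simp
      then have "2 * (m\<^sup>2 * (w i)\<^sup>2) \<le> w i ^ 4 + m ^ 4" by (simp add: power2_diff mult.commute)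
      moreover have "w i ^ 4 \<le> w i ^ 3" "m ^ 4 \<le> m ^ 3" using wi m by (auto intro!: power_decreasing)
      ultimately show ?thesis by linarith
    qed
    have "(q + 1) * P \<le> (q + 1) * (m\<^sup>2 * (w i)\<^sup>2)" using P q by (intro mult_left_mono) auto
    also have "\<dots> = (q - 1) * (m\<^sup>2 * (w i)\<^sup>2) + 2 * (m\<^sup>2 * (w i)\<^sup>2)" by (simp add: algebra_simps)
    also have "\<dots> \<le> (q - 1) * w i ^ 3 + (w i ^ 3 + m ^ 3)"
      using q e1 e2 by (intro add_mono mult_left_mono) auto
    finally show ?thesis by (simp add: algebra_simps)
  qed
  have "q * ((q + 1) * P) = (\<Sum>i\<in>J'. (q + 1) * P)" by (simp add: q_def)
  also have "\<dots> \<le> (\<Sum>i\<in>J'. q * w i ^ 3 + m ^ 3)" by (rule sum_mono) (rule key)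
  also have "\<dots> = q * ((\<Sum>i\<in>J'. w i ^ 3) + m ^ 3)"
    by (simp add: sum.distrib q_def sum_distrib_left algebra_simps)
  finally have "(q + 1) * P \<le> (\<Sum>i\<in>J'. w i ^ 3) + m ^ 3" using q by (simp add: mult_le_cancel_left)
  also have "\<dots> = (\<Sum>j\<in>J. w j ^ 3)"
    using sum.remove[OF J(1) j0(1), of "\<lambda>j. w j ^ 3"] by (simp add: J'_def m_def)
  finally show ?thesis using J'(2) by (simp add: q_def P_def add.commute)
qed

text \<open>By \<open>sum_cubes_ge\<close> the terms w^3 - P with w = min 1 u have a nonnegative
  sum. The factor (max 1 u)^2 enlarges only terms with u >= 1, which are nonnegative. Finally (max 1
  u)^2 * w^3 is the smaller of u^2 and u^3, so either exponent is allowed on the right.\<close>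

lemma layer_balance_cube_roots:
  fixes u :: "'j \<Rightarrow> real"
  assumes J: "finite J1" "finite J2" "J1 \<noteq> {}" "J2 \<noteq> {}" "J1 \<inter> J2 = {}"
    and u: "\<And>j. j \<in> J1 \<union> J2 \<Longrightarrow> 0 < u j"
  shows "(\<Prod>j\<in>J1 \<union> J2. (min 1 (u j))\<^sup>2) * (\<Sum>j\<in>J1 \<union> J2. (max 1 (u j))\<^sup>2)
    \<le> (\<Sum>j\<in>J1. (u j)\<^sup>2) + (\<Sum>j\<in>J2. u j ^ 3)"
proof -
  let ?J = "J1 \<union> J2"
  define w where "w j = min 1 (u j)" for j
  define P where "P = (\<Prod>j\<in>?J. (w j)\<^sup>2)"
  have w: "0 < w j \<and> w j \<le> 1" if "j \<in> ?J" for j using u[OF that] by (auto simp: w_def)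
  have finJ: "finite ?J" using J by auto
  have "card ?J = card J1 + card J2" using J by (intro card_Un_disjoint)
  moreover have "card J1 \<ge> 1" "card J2 \<ge> 1" using J by (simp_all add: Suc_le_eq card_gt_0_iff)
  ultimately have "card ?J \<ge> 2" by linarith
  from sum_cubes_ge[OF finJ this w]
  have 1: "0 \<le> (\<Sum>j\<in>?J. w j ^ 3 - P)" by (simp add: sum_subtractf P_def)
  have P1: "P \<le> 1" unfolding P_def
    by (intro prod_le_1 conjI) (use w in \<open>auto intro!: power_le_one simp: less_imp_le\<close>)
  have "(\<Sum>j\<in>?J. w j ^ 3 - P) \<le> (\<Sum>j\<in>?J. (max 1 (u j))\<^sup>2 * (w j ^ 3 - P))"
  proof (rule sum_mono)
    fix j
    show "w j ^ 3 - P \<le> (max 1 (u j))\<^sup>2 * (w j ^ 3 - P)"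
    proof (cases "u j \<ge> 1")
      case True
      then have "1 * (1 - P) \<le> (u j)\<^sup>2 * (1 - P)" using P1 by (intro mult_right_mono) auto
      then show ?thesis using True by (simp add: w_def)
    qed (simp add: w_def)
  qed
  also have "\<dots> = (\<Sum>j\<in>?J. (max 1 (u j))\<^sup>2 * w j ^ 3) - P * (\<Sum>j\<in>?J. (max 1 (u j))\<^sup>2)"
    by (simp add: algebra_simps sum_subtractf sum_distrib_left)
  finally have "P * (\<Sum>j\<in>?J. (max 1 (u j))\<^sup>2) \<le> (\<Sum>j\<in>?J. (max 1 (u j))\<^sup>2 * w j ^ 3)" using 1 by linarith
  also have "\<dots> = (\<Sum>j\<in>J1. (max 1 (u j))\<^sup>2 * w j ^ 3) + (\<Sum>j\<in>J2. (max 1 (u j))\<^sup>2 * w j ^ 3)"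
    using J by (intro sum.union_disjoint) auto
  also have "\<dots> \<le> (\<Sum>j\<in>J1. (u j)\<^sup>2) + (\<Sum>j\<in>J2. u j ^ 3)"
  proof (intro add_mono sum_mono)
    fix j assume "j \<in> J1"
    then have "0 < u j" using u by auto
    then show "(max 1 (u j))\<^sup>2 * w j ^ 3 \<le> (u j)\<^sup>2"
      by (cases "u j \<ge> 1") (auto simp: w_def intro!: power_decreasing)
  next
    fix j assume "j \<in> J2"
    then have "0 < u j" using u by auto
    then show "(max 1 (u j))\<^sup>2 * w j ^ 3 \<le> u j ^ 3"
      by (cases "u j \<ge> 1") (auto simp: w_def intro!: power_increasing)
  qed
  finally show ?thesis by (simp add: P_def w_def)
qed

text \<open>For s = b / \<kappa>, min 1 s is the gain in the product of norms and max 1 s the ratio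
  that remains. The substitution s = u^3 makes all exponents integral, and both sides become
  cubes.\<close>

lemma layer_balance:
  fixes s :: "'j \<Rightarrow> real"
  assumes J: "finite J1" "finite J2" "J1 \<noteq> {}" "J2 \<noteq> {}" "J1 \<inter> J2 = {}"
    and s: "\<And>j. j \<in> J1 \<union> J2 \<Longrightarrow> 0 < s j"
  shows "(\<Prod>j\<in>J1 \<union> J2. min 1 (s j))\<^sup>2 * (\<Sum>j\<in>J1 \<union> J2. max 1 (s j) powr (2/3)) ^ 3
    \<le> ((\<Sum>j\<in>J1. s j powr (2/3)) + (\<Sum>j\<in>J2. s j)) ^ 3"
proof -
  let ?J = "J1 \<union> J2"
  define u where "u j = s j powr (1/3)" for j
  have u: "0 < u j" "s j = u j ^ 3" "s j powr (2/3) = (u j)\<^sup>2" if "j \<in> ?J" for j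
    using s[OF that] by (simp_all add: u_def powr_power)
  have mn: "min 1 (s j) = (min 1 (u j)) ^ 3" if "j \<in> ?J" for j
  proof (cases "1 \<le> u j")
    case True
    then have "1 \<le> s j" unfolding u(2)[OF that] by (rule one_le_power)
    then show ?thesis using True by (simp add: min_absorb1)
  next
    case False
    then have "s j \<le> 1" unfolding u(2)[OF that] using u(1)[OF that] by (intro power_le_one) auto
    then show ?thesis using False u(2)[OF that] by (simp add: min_absorb2)
  qed
  have mx: "max 1 (s j) powr (2/3) = (max 1 (u j))\<^sup>2" if "j \<in> ?J" for j
  proof (cases "1 \<le> u j")
    case True
    then have "1 \<le> s j" unfolding u(2)[OF that] by (rule one_le_power)
    then show ?thesis using True u(3)[OF that] by (simp add: max_absorb2)
  next
    case False
    then have "s j \<le> 1" unfolding u(2)[OF that] using u(1)[OF that] by (intro power_le_one) auto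
    then show ?thesis using False by (simp add: max_absorb1)
  qed
  have "(\<Prod>j\<in>?J. min 1 (s j))\<^sup>2 * (\<Sum>j\<in>?J. max 1 (s j) powr (2/3)) ^ 3
      = (\<Prod>j\<in>?J. (min 1 (u j)) ^ 3)\<^sup>2 * (\<Sum>j\<in>?J. (max 1 (u j))\<^sup>2) ^ 3"
    by (simp only: mn mx cong: sum.cong prod.cong)
  also have "\<dots> = ((\<Prod>j\<in>?J. (min 1 (u j))\<^sup>2) * (\<Sum>j\<in>?J. (max 1 (u j))\<^sup>2)) ^ 3"
    by (simp add: power_mult_distrib prod_power_distrib[symmetric] power_mult[symmetric] mult.commute)
  also have "\<dots> \<le> ((\<Sum>j\<in>J1. (u j)\<^sup>2) + (\<Sum>j\<in>J2. u j ^ 3)) ^ 3"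
    by (intro power_mono layer_balance_cube_roots[OF J u(1)]) (auto intro!: mult_nonneg_nonneg prod_nonneg sum_nonneg)
  also have "\<dots> = ((\<Sum>j\<in>J1. s j powr (2/3)) + (\<Sum>j\<in>J2. s j)) ^ 3"
    using u by simp
  finally show ?thesis .
qed

section \<open>Matrix norms\<close>

lemma vnorm_L2: "vnorm v = L2_set (\<lambda>i. v $ i) {..<dim_vec v}"
  by (simp add: vnorm_def L2_set_def)

lemma vnorm_nonneg [simp]: "0 \<le> vnorm v"
  by (simp add: vnorm_L2)

lemma vnorm_smult: "vnorm (a \<cdot>\<^sub>v v) = \<bar>a\<bar> * vnorm v"
proof -
  have "vnorm (a \<cdot>\<^sub>v v) = L2_set (\<lambda>i. \<bar>a\<bar> * v $ i) {..<dim_vec v}"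
    by (auto simp: vnorm_L2 L2_set_def power_mult_distrib intro!: sum.cong)
  then show ?thesis by (simp add: vnorm_L2 L2_set_right_distrib)
qed

text \<open>A supremum of reals is informative only for a bounded set; the sum of the absolute
  entries is a crude but sufficient bound.\<close>

lemma spec_norm_bdd:
  "bdd_above ((\<lambda>v. vnorm (M *\<^sub>v v)) ` {v. dim_vec v = dim_col M \<and> vnorm v \<le> 1})"
proof (rule bdd_aboveI2)
  fix v assume v: "v \<in> {v. dim_vec v = dim_col M \<and> vnorm v \<le> 1}"
  have "vnorm (M *\<^sub>v v) \<le> (\<Sum>i<dim_row M. \<bar>(M *\<^sub>v v) $ i\<bar>)"
    unfolding vnorm_L2 dim_mult_mat_vec by (rule L2_set_le_sum_abs)
  also have "\<dots> \<le> (\<Sum>i<dim_row M. \<Sum>j<dim_col M. \<bar>M $$ (i, j)\<bar>)"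
  proof (rule sum_mono)
    fix i assume i: "i \<in> {..<dim_row M}"
    have "\<bar>v $ j\<bar> \<le> 1" if "j < dim_col M" for j
    proof -
      have "\<bar>v $ j\<bar> \<le> L2_set (\<lambda>j. \<bar>v $ j\<bar>) {..<dim_vec v}"
        by (rule member_le_L2_set) (use v that in auto)
      also have "\<dots> = vnorm v" by (simp add: vnorm_L2 L2_set_def)
      finally show ?thesis using v by simp
    qed
    then have "\<bar>M $$ (i, j)\<bar> * \<bar>v $ j\<bar> \<le> \<bar>M $$ (i, j)\<bar>" if "j < dim_col M" for j
      using that by (intro mult_left_le) auto
    moreover have "(M *\<^sub>v v) $ i = (\<Sum>j<dim_col M. M $$ (i, j) * v $ j)"
      using v i by (simp add: scalar_prod_def lessThan_atLeast0)
    ultimately show "\<bar>(M *\<^sub>v v) $ i\<bar> \<le> (\<Sum>j<dim_col M. \<bar>M $$ (i, j)\<bar>)"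
      by (auto simp: abs_mult intro!: order_trans[OF sum_abs] sum_mono)
  qed
  finally show "vnorm (M *\<^sub>v v) \<le> (\<Sum>i<dim_row M. \<Sum>j<dim_col M. \<bar>M $$ (i, j)\<bar>)" .
qed

lemma spec_norm_upper:
  assumes "dim_vec v = dim_col M" "vnorm v \<le> 1"
  shows "vnorm (M *\<^sub>v v) \<le> spec_norm M"
  unfolding spec_norm_def by (rule cSUP_upper[OF _ spec_norm_bdd]) (use assms in auto)

lemma vnorm_zero [simp]: "vnorm (0\<^sub>v n) = 0"
  by (simp add: vnorm_def)

lemma spec_norm_nonneg: "0 \<le> spec_norm M"
  by (rule order_trans[OF vnorm_nonneg spec_norm_upper[of "0\<^sub>v (dim_col M)"]]) auto

lemma spec_norm_mult_vec:
  assumes v: "dim_vec v = dim_col M"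
  shows "vnorm (M *\<^sub>v v) \<le> spec_norm M * vnorm v"
proof (cases "vnorm v = 0")
  case True
  then have "v = 0\<^sub>v (dim_col M)"
    using v by (intro eq_vecI) (auto simp: vnorm_L2 L2_set_eq_0_iff)
  then have "M *\<^sub>v v = 0\<^sub>v (dim_row M)" by (intro eq_vecI) auto
  then show ?thesis using True by simp
next
  case False
  then have n: "vnorm v > 0" using vnorm_nonneg[of v] by linarith
  have "vnorm (M *\<^sub>v ((1 / vnorm v) \<cdot>\<^sub>v v)) \<le> spec_norm M"
    by (rule spec_norm_upper) (use v n in \<open>auto simp: vnorm_smult\<close>)
  moreover have "M *\<^sub>v ((1 / vnorm v) \<cdot>\<^sub>v v) = (1 / vnorm v) \<cdot>\<^sub>v (M *\<^sub>v v)"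
    by (rule mult_mat_vec[of _ "dim_row M" "dim_col M"]) (use v in \<open>auto intro!: carrier_vecI\<close>)
  ultimately show ?thesis using n by (simp add: vnorm_smult field_simps)
qed

lemma spec_norm_L2:
  assumes M: "M \<in> carrier_mat m d"
  shows "L2_set (\<lambda>i. \<Sum>a<d. M $$ (i, a) * x a) {..<m} \<le> spec_norm M * L2_set x {..<d}"
proof -
  have "vnorm (M *\<^sub>v vec d x) = L2_set (\<lambda>i. \<Sum>a<d. M $$ (i, a) * x a) {..<m}"
    using M by (auto simp: vnorm_L2 scalar_prod_def lessThan_atLeast0 intro!: L2_set_cong sum.cong)
  moreover have "vnorm (vec d x) = L2_set x {..<d}"
    by (auto simp: vnorm_L2 intro!: L2_set_cong)
  ultimately show ?thesis using spec_norm_mult_vec[of "vec d x" M] M by simp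
qed

text \<open>Weights act on rows from the right, which involves the transpose. Duality handles it:
  for z = y M the squared norm of z is the inner product of y with M z, and one factor of the norm
  of z cancels.\<close>

lemma spec_norm_L2_row:
  assumes M: "M \<in> carrier_mat d m"
  shows "L2_set (\<lambda>j. \<Sum>a<d. y a * M $$ (a, j)) {..<m} \<le> spec_norm M * L2_set y {..<d}"
proof -
  define z where "z = (\<lambda>j. \<Sum>a<d. y a * M $$ (a, j))"
  have "(L2_set z {..<m})\<^sup>2 = (\<Sum>j<m. \<Sum>a<d. z j * (y a * M $$ (a, j)))"
    unfolding L2_set_square by (simp add: power2_eq_square z_def sum_distrib_left)
  also have "\<dots> = (\<Sum>a<d. y a * (\<Sum>j<m. M $$ (a, j) * z j))"
    by (subst sum.swap) (simp add: sum_distrib_left mult_ac)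
  also have "\<dots> \<le> L2_set y {..<d} * L2_set (\<lambda>a. \<Sum>j<m. M $$ (a, j) * z j) {..<d}"
    by (rule sum_mult_le_L2_set)
  also have "\<dots> \<le> L2_set y {..<d} * (spec_norm M * L2_set z {..<m})"
    by (intro mult_left_mono spec_norm_L2[OF M]) auto
  finally have 1: "L2_set z {..<m} * L2_set z {..<m} \<le> (spec_norm M * L2_set y {..<d}) * L2_set z {..<m}"
    by (simp add: power2_eq_square mult_ac)
  have "L2_set z {..<m} \<le> spec_norm M * L2_set y {..<d}"
  proof (cases "L2_set z {..<m} = 0")
    case True
    then show ?thesis using spec_norm_nonneg[of M] by simp
  next
    case False
    then have "L2_set z {..<m} > 0" using L2_set_nonneg[of z "{..<m}"] by linarith
    then show ?thesis using 1 by (simp add: mult_le_cancel_right)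
  qed
  then show ?thesis by (simp add: z_def)
qed

lemma mul_spec_norm_le:
  assumes P: "finite P" and M: "M \<in> carrier_mat d m"
  shows "L2_set (mul d Y (\<lambda>a j. M $$ (a, j))) (P \<times> {..<m}) \<le> spec_norm M * L2_set Y (P \<times> {..<d})"
proof (rule L2_set_leI)
  have "(\<Sum>x\<in>P \<times> {..<m}. (mul d Y (\<lambda>a j. M $$ (a, j)) x)\<^sup>2)
      = (\<Sum>p\<in>P. (L2_set (\<lambda>j. \<Sum>a<d. Y (p, a) * M $$ (a, j)) {..<m})\<^sup>2)"
    unfolding L2_set_square[symmetric] L2_set_prod_square[OF P] by (simp add: mul_def)
  also have "\<dots> \<le> (\<Sum>p\<in>P. (spec_norm M * L2_set (\<lambda>a. Y (p, a)) {..<d})\<^sup>2)"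
    by (intro sum_mono power_mono spec_norm_L2_row[OF M]) auto
  also have "\<dots> = (spec_norm M * L2_set Y (P \<times> {..<d}))\<^sup>2"
    by (simp add: power_mult_distrib L2_set_prod_square[OF P] sum_distrib_left)
  finally show "(\<Sum>x\<in>P \<times> {..<m}. (mul d Y (\<lambda>a j. M $$ (a, j)) x)\<^sup>2) \<le> (spec_norm M * L2_set Y (P \<times> {..<d}))\<^sup>2" .
qed (simp add: spec_norm_nonneg)

lemma norm21_L2:
  assumes "M \<in> carrier_mat d m"
  shows "norm21 M = col_norms d m (\<lambda>a j. M $$ (a, j))"
  using assms unfolding norm21_def col_norms_def by (auto simp: vnorm_L2 intro!: sum.cong L2_set_cong)

lemma mul_min_norm_le:
  assumes P: "finite P" and M: "M \<in> carrier_mat d m" and \<kappa>: "spec_norm M \<le> \<kappa>" and b: "norm21 M \<le> b"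
  shows "L2_set (mul d Y (\<lambda>a j. M $$ (a, j))) (P \<times> {..<m}) \<le> min \<kappa> b * L2_set Y (P \<times> {..<d})"
proof -
  have "L2_set (mul d Y (\<lambda>a j. M $$ (a, j))) (P \<times> {..<m}) \<le> \<kappa> * L2_set Y (P \<times> {..<d})"
    by (rule order_trans[OF mul_spec_norm_le[OF P M]]) (intro mult_right_mono \<kappa>, simp)
  moreover have "L2_set (mul d Y (\<lambda>a j. M $$ (a, j))) (P \<times> {..<m}) \<le> b * L2_set Y (P \<times> {..<d})"
    using b by (intro L2_set_mul_le[OF P]) (simp add: norm21_L2[OF M])
  ultimately show ?thesis by (simp add: min_def)
qed

text \<open>Padding a vector with zeros preserves its norm, so each block is tested within the unit
  ball of the whole matrix.\<close>

lemma spec_norm_block_diag: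
  assumes M: "M \<in> carrier_mat n n" and B: "B \<in> carrier_mat k k"
  shows "spec_norm M \<le> spec_norm (four_block_mat M (0\<^sub>m n k) (0\<^sub>m k n) B)"
    and "spec_norm B \<le> spec_norm (four_block_mat M (0\<^sub>m n k) (0\<^sub>m k n) B)"
proof -
  let ?F = "four_block_mat M (0\<^sub>m n k) (0\<^sub>m k n) B"
  have F: "?F \<in> carrier_mat (n + k) (n + k)" using M B by (rule four_block_carrier_mat)
  have nappend: "(vnorm (u @\<^sub>v w))\<^sup>2 = (vnorm u)\<^sup>2 + (vnorm w)\<^sup>2" for u w
  proof -
    let ?f = "\<lambda>i. ((u @\<^sub>v w) $ i)\<^sup>2"
    have "sum ?f {0..<dim_vec u + dim_vec w}
        = sum ?f {0..<dim_vec u} + sum ?f {dim_vec u..<dim_vec u + dim_vec w}"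
      by (rule sum.atLeastLessThan_concat[symmetric]) auto
    also have "sum ?f {dim_vec u..<dim_vec u + dim_vec w} = (\<Sum>i = 0..<dim_vec w. ?f (i + dim_vec u))"
      using sum.shift_bounds_nat_ivl[of ?f 0 "dim_vec u" "dim_vec w"] by (simp add: add.commute)
    also have "\<dots> = (\<Sum>i = 0..<dim_vec w. (w $ i)\<^sup>2)"
      by (rule sum.cong) auto
    also have "sum ?f {0..<dim_vec u} = (\<Sum>i = 0..<dim_vec u. (u $ i)\<^sup>2)"
      by (rule sum.cong) auto
    finally show ?thesis
      by (simp add: vnorm_L2 L2_set_square lessThan_atLeast0)
  qed
  have mult: "?F *\<^sub>v (u @\<^sub>v w) = (M *\<^sub>v u) @\<^sub>v (B *\<^sub>v w)"
    if "u \<in> carrier_vec n" "w \<in> carrier_vec k" for u w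
  proof -
    have z: "0\<^sub>m n k *\<^sub>v w = 0\<^sub>v n" "0\<^sub>m k n *\<^sub>v u = 0\<^sub>v k"
      using that by (auto intro!: eq_vecI simp: scalar_prod_def)
    have "M *\<^sub>v u \<in> carrier_vec n" "B *\<^sub>v w \<in> carrier_vec k"
      using M B that by auto
    then show ?thesis
      using four_block_mat_mult_vec[OF M zero_carrier_mat zero_carrier_mat B that] by (simp add: z)
  qed
  have embed: "spec_norm A \<le> spec_norm ?F"
    if A: "A \<in> carrier_mat q q" and e: "\<And>v. v \<in> carrier_vec q \<Longrightarrow> dim_vec (e v) = n + k \<and> vnorm (e v) = vnorm v"
      and mono: "\<And>v. v \<in> carrier_vec q \<Longrightarrow> vnorm (A *\<^sub>v v) \<le> vnorm (?F *\<^sub>v e v)" for A q e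
    unfolding spec_norm_def[of A]
  proof (rule cSUP_least)
    show "{v. dim_vec v = dim_col A \<and> vnorm v \<le> 1} \<noteq> {}" by (auto intro!: exI[of _ "0\<^sub>v (dim_col A)"])
    fix v assume v: "v \<in> {v. dim_vec v = dim_col A \<and> vnorm v \<le> 1}"
    then have vc: "v \<in> carrier_vec q" using A by (auto intro!: carrier_vecI)
    have "vnorm (?F *\<^sub>v e v) \<le> spec_norm ?F"
      by (rule spec_norm_upper) (use e[OF vc] v M B in auto)
    with mono[OF vc] show "vnorm (A *\<^sub>v v) \<le> spec_norm ?F" by linarith
  qed
  have norm_eq: "vnorm u = vnorm w" if "(vnorm u)\<^sup>2 = (vnorm w)\<^sup>2" for u w
    by (rule power2_eq_imp_eq[OF that]) simp_all
  show "spec_norm M \<le> spec_norm ?F"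
  proof (rule embed[OF M, where e = "\<lambda>v. v @\<^sub>v 0\<^sub>v k"])
    fix v :: "real vec" assume v: "v \<in> carrier_vec n"
    show "vnorm (M *\<^sub>v v) \<le> vnorm (?F *\<^sub>v (v @\<^sub>v 0\<^sub>v k))"
      by (rule power2_le_imp_le) (simp_all add: mult[OF v] nappend)
  qed (auto intro!: norm_eq simp: nappend)
  show "spec_norm B \<le> spec_norm ?F"
  proof (rule embed[OF B, where e = "\<lambda>v. 0\<^sub>v n @\<^sub>v v"])
    fix v :: "real vec" assume v: "v \<in> carrier_vec k"
    show "vnorm (B *\<^sub>v v) \<le> vnorm (?F *\<^sub>v (0\<^sub>v n @\<^sub>v v))"
      by (rule power2_le_imp_le) (simp_all add: mult[OF _ v] nappend)
  qed (auto intro!: norm_eq simp: nappend)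
qed

lemma blockdiag_square:
  assumes "\<And>M. M \<in> set Ms \<Longrightarrow> dim_row M = dim_col M"
  shows "dim_row (blockdiag Ms) = dim_col (blockdiag Ms)"
  using assms by (induction Ms) (auto simp: Let_def)

text \<open>Transfers the constant of the sample to its graphs: the identity added to the block
  matrix splits into identities added to the blocks.\<close>

lemma spec_norm_blockdiag:
  assumes "\<And>M. M \<in> set Ms \<Longrightarrow> dim_row M = dim_col M" and "M \<in> set Ms"
  shows "spec_norm (M + 1\<^sub>m (dim_row M)) \<le> spec_norm (blockdiag Ms + 1\<^sub>m (dim_row (blockdiag Ms)))"
  using assms
proof (induction Ms)
  case (Cons A Ms)
  define n where "n = dim_row A"
  define B where "B = blockdiag Ms"
  define k where "k = dim_row B"
  have A: "A \<in> carrier_mat n n" using Cons.prems(1)[of A] by (auto simp: n_def intro!: carrier_matI)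
  have "dim_row B = dim_col B" unfolding B_def by (rule blockdiag_square) (use Cons.prems in auto)
  then have B: "B \<in> carrier_mat k k" by (auto simp: k_def intro!: carrier_matI)
  have bd: "blockdiag (A # Ms) = four_block_mat A (0\<^sub>m n k) (0\<^sub>m k n) B"
    using A B by (simp add: Let_def B_def[symmetric])
  have eq: "blockdiag (A # Ms) + 1\<^sub>m (dim_row (blockdiag (A # Ms)))
      = four_block_mat (A + 1\<^sub>m n) (0\<^sub>m n k) (0\<^sub>m k n) (B + 1\<^sub>m k)"
    unfolding bd by (rule eq_matI) (use A B in auto)
  note sb = spec_norm_block_diag[of "A + 1\<^sub>m n" n "B + 1\<^sub>m k" k]
  show ?case
  proof (cases "M = A")
    case True
    have "A + 1\<^sub>m n \<in> carrier_mat n n" "B + 1\<^sub>m k \<in> carrier_mat k k" using A B by auto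
    from sb(1)[OF this] show ?thesis unfolding eq True n_def .
  next
    case False
    then have "M \<in> set Ms" using Cons.prems(2) by simp
    then have "spec_norm (M + 1\<^sub>m (dim_row M)) \<le> spec_norm (B + 1\<^sub>m k)"
      unfolding B_def k_def by (intro Cons.IH Cons.prems(1)) simp_all
    also have "\<dots> \<le> spec_norm (blockdiag (A # Ms) + 1\<^sub>m (dim_row (blockdiag (A # Ms))))"
    proof -
      have "A + 1\<^sub>m n \<in> carrier_mat n n" "B + 1\<^sub>m k \<in> carrier_mat k k" using A B by auto
      from sb(2)[OF this] show ?thesis unfolding eq .
    qed
    finally show ?thesis .
  qed
qed simp

lemma frob_norm_vstack:
  assumes "\<And>M. M \<in> set Ms \<Longrightarrow> dim_col M = d"
  shows "(frob_norm (vstack d Ms))\<^sup>2 = (\<Sum>M\<leftarrow>Ms. \<Sum>i<dim_row M. \<Sum>j<d. (M $$ (i, j))\<^sup>2)"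
proof -
  have rl: "(\<Sum>v\<leftarrow>rows M. \<Sum>j<d. (v $ j)\<^sup>2) = (\<Sum>i<dim_row M. \<Sum>j<d. (M $$ (i, j))\<^sup>2)"
    if "dim_col M = d" for M :: "real mat"
    using that by (simp add: rows_def comp_def sum_list_distinct_conv_sum_set lessThan_atLeast0 interv_sum_list_conv_sum_set_nat)
  define vs where "vs = concat (map rows Ms)"
  have "(frob_norm (vstack d Ms))\<^sup>2 = (\<Sum>i<length vs. \<Sum>j<d. ((vs ! i) $ j)\<^sup>2)"
    unfolding vstack_def vs_def[symmetric]
    by (simp add: frob_norm_def sum_nonneg mat_of_rows_def)
  also have "\<dots> = (\<Sum>v\<leftarrow>vs. \<Sum>j<d. (v $ j)\<^sup>2)"
    by (simp add: sum_list_sum_nth lessThan_atLeast0)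
  also have "\<dots> = (\<Sum>M\<leftarrow>Ms. \<Sum>i<dim_row M. \<Sum>j<d. (M $$ (i, j))\<^sup>2)"
    unfolding vs_def using assms by (induction Ms) (auto simp: rl)
  finally show ?thesis .
qed

section \<open>Distribution of the radius over the layers\<close>

text \<open>
  For \<open>k = 0\<close> the layer is covered by the zero matrix alone, otherwise by averages of \<open>k\<close> Maurey atoms.
  The case distinction avoids rounding up a sample number below 1.
\<close>
definition radius_ok :: "real \<Rightarrow> real \<Rightarrow> real \<Rightarrow> nat \<Rightarrow> bool" where
  "radius_ok p b \<tau> k \<longleftrightarrow> 0 \<le> \<tau> \<and> (k = 0 \<and> b \<le> p * \<tau> \<or> 1 \<le> k \<and> b\<^sup>2 \<le> real k * (p * \<tau>)\<^sup>2)"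

text \<open>Minimising the cost, the sum of (t j / \<tau> j)^2, for a fixed total radius \<epsilon>
  / T gives \<tau> j proportional to t j powr (2/3) and the cost S^3 T^2 / \<epsilon>^2. Here t j =
  b j / p j = max 1 (b j / \<kappa> j), and \<open>layer_balance\<close> returns to the original
  ratios.\<close>

lemma allocate_radii:
  fixes \<kappa> b :: "'j \<Rightarrow> real" and D :: nat
  assumes J: "finite J1" "finite J2" "J1 \<noteq> {}" "J2 \<noteq> {}" "J1 \<inter> J2 = {}"
    and \<kappa>: "\<And>j. j \<in> J1 \<union> J2 \<Longrightarrow> 0 < \<kappa> j" and b: "\<And>j. j \<in> J1 \<union> J2 \<Longrightarrow> 0 \<le> b j"
    and T0: "0 \<le> T0" and D: "1 \<le> D" and \<epsilon>: "0 < \<epsilon>"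
  shows "\<exists>\<tau> k. (\<forall>j\<in>J1 \<union> J2. radius_ok (min (\<kappa> j) (b j)) (b j) (\<tau> j) (k j)) \<and>
      T0 * (\<Prod>j\<in>J1 \<union> J2. min (\<kappa> j) (b j)) * (\<Sum>j\<in>J1 \<union> J2. \<tau> j) \<le> \<epsilon> \<and>
      (2 * real D) ^ (\<Sum>j\<in>J1 \<union> J2. k j)
        \<le> exp (2 * (T0\<^sup>2 * (\<Prod>j\<in>J1 \<union> J2. \<kappa> j)\<^sup>2 * ln (2 * real D) *
              ((\<Sum>j\<in>J1. (b j / \<kappa> j) powr (2/3)) + (\<Sum>j\<in>J2. b j / \<kappa> j)) ^ 3) / \<epsilon>\<^sup>2)"
proof -
  let ?J = "J1 \<union> J2"
  define p where "p j = min (\<kappa> j) (b j)" for j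
  define T where "T = T0 * (\<Prod>j\<in>?J. p j)"
  define Q where "Q = (\<Sum>j\<in>J1. (b j / \<kappa> j) powr (2/3)) + (\<Sum>j\<in>J2. b j / \<kappa> j)"
  have ln0: "0 \<le> ln (2 * real D)" using D by simp
  have finJ: "finite ?J" using J by simp
  have p0: "0 \<le> p j" if "j \<in> ?J" for j using \<kappa>[OF that] b[OF that] by (simp add: p_def)
  have Q0: "0 \<le> Q" unfolding Q_def
    by (intro add_nonneg_nonneg sum_nonneg) (use \<kappa> b in \<open>auto intro!: divide_nonneg_pos\<close>)
  have T_nonneg: "0 \<le> T" unfolding T_def by (intro mult_nonneg_nonneg T0 prod_nonneg) (use p0 in auto)
  show ?thesis
  proof (cases "T = 0")
    \<comment> \<open>The absolute radius vanishes whatever the relative radii are, so every layer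
      can afford \<tau> j = b j / p j and needs no atoms.\<close>
    case True
    define \<tau> where "\<tau> j = (if b j = 0 then 0 else b j / p j)" for j
    have "radius_ok (p j) (b j) (\<tau> j) 0" if j: "j \<in> ?J" for j
    proof (cases "b j = 0")
      case False
      then have "p j > 0" using \<kappa>[OF j] b[OF j] by (simp add: p_def)
      then show ?thesis using b[OF j] by (simp add: \<tau>_def radius_ok_def)
    qed (simp add: \<tau>_def radius_ok_def)
    moreover have "(1::real) \<le> exp (2 * (T0\<^sup>2 * (\<Prod>j\<in>?J. \<kappa> j)\<^sup>2 * ln (2 * real D) * Q ^ 3) / \<epsilon>\<^sup>2)"
      using ln0 Q0 by simp
    moreover have "T * (\<Sum>j\<in>?J. \<tau> j) \<le> \<epsilon>" using True \<epsilon> by simp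
    ultimately show ?thesis
      unfolding Q_def p_def T_def by (intro exI[of _ \<tau>] exI[of _ "\<lambda>_. 0"]) simp
  next
    case False
    then have T: "T > 0" using T_nonneg by simp
    have pp: "p j > 0" if "j \<in> ?J" for j
    proof -
      have "p j \<noteq> 0" using False finJ that by (auto simp: T_def)
      then show ?thesis using p0[OF that] by simp
    qed
    have bp: "b j > 0" if "j \<in> ?J" for j using pp[OF that] by (simp add: p_def)
    define s where "s j = b j / \<kappa> j" for j
    have s: "s j > 0" if "j \<in> ?J" for j using bp[OF that] \<kappa>[OF that] by (simp add: s_def)
    define t where "t j = max 1 (s j)" for j
    have ps: "p j = \<kappa> j * min 1 (s j)" if "j \<in> ?J" for j
      using \<kappa>[OF that] by (auto simp: p_def s_def min_def field_simps)
    have bt: "b j = p j * t j" if "j \<in> ?J" for j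
      using \<kappa>[OF that] by (auto simp: p_def s_def t_def min_def max_def field_simps)
    have t1: "1 \<le> t j" for j by (simp add: t_def)
    define S where "S = (\<Sum>j\<in>?J. t j powr (2/3))"
    have S: "S > 0" unfolding S_def
    proof (rule sum_pos[OF finJ])
      fix j show "0 < t j powr (2/3)" using t1[of j] by simp
    qed (use J in auto)
    define \<tau> where "\<tau> j = t j powr (2/3) / S * (\<epsilon> / T)" for j
    have \<tau>: "\<tau> j > 0" for j unfolding \<tau>_def using t1[of j] S T \<epsilon> by (intro mult_pos_pos divide_pos_pos) auto
    have ratio: "(t j / \<tau> j)\<^sup>2 = t j powr (2/3) * (S\<^sup>2 * T\<^sup>2 / \<epsilon>\<^sup>2)" for j
    proof -
      define u where "u = t j powr (1/3)"
      have u: "u > 0" using t1[of j] by (simp add: u_def)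
      have "t j = u ^ 3" "t j powr (2/3) = u\<^sup>2" using t1[of j] by (simp_all add: u_def powr_power)
      then show ?thesis unfolding \<tau>_def using u S T \<epsilon>
        by (simp add: field_simps power2_eq_square power3_eq_cube)
    qed
    define k where "k j = (if t j \<le> \<tau> j then 0 else nat \<lceil>(t j / \<tau> j)\<^sup>2\<rceil>)" for j
    \<comment> \<open>Atoms are used only when (t j / \<tau> j)^2 > 1, so rounding up at most
      doubles the number; this is the factor 2 in the exponent.\<close>
    have kb: "real (k j) \<le> 2 * (t j / \<tau> j)\<^sup>2"
      and kc: "k j = 0 \<and> t j \<le> \<tau> j \<or> 1 \<le> k j \<and> (t j)\<^sup>2 \<le> real (k j) * (\<tau> j)\<^sup>2" for j
    proof -
      have "real (k j) \<le> 2 * (t j / \<tau> j)\<^sup>2 \<and> (k j = 0 \<and> t j \<le> \<tau> j \<or> 1 \<le> k j \<and> (t j)\<^sup>2 \<le> real (k j) * (\<tau> j)\<^sup>2)"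
      proof (cases "t j \<le> \<tau> j")
        case True
        then show ?thesis by (simp add: k_def)
      next
        case False
        then have "1 < t j / \<tau> j" using \<tau>[of j] by simp
        then have x: "1 < (t j / \<tau> j)\<^sup>2" by (rule one_less_power) simp
        define x where "x = (t j / \<tau> j)\<^sup>2"
        have k: "k j = nat \<lceil>x\<rceil>" using False by (simp add: k_def x_def)
        have "x > 1" using x by (simp add: x_def)
        then have c: "real (k j) = of_int \<lceil>x\<rceil>" unfolding k by simp
        have "real (k j) < x + 1" "x \<le> real (k j)" unfolding c by linarith+
        then have "real (k j) \<le> 2 * x" "x \<le> real (k j)" "1 \<le> k j" using \<open>x > 1\<close> by linarith+
        moreover have "(t j)\<^sup>2 = x * (\<tau> j)\<^sup>2" using \<tau>[of j] by (simp add: x_def power_divide)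
        ultimately show ?thesis by (auto simp: x_def intro!: mult_right_mono)
      qed
      then show "real (k j) \<le> 2 * (t j / \<tau> j)\<^sup>2" "k j = 0 \<and> t j \<le> \<tau> j \<or> 1 \<le> k j \<and> (t j)\<^sup>2 \<le> real (k j) * (\<tau> j)\<^sup>2"
        by auto
    qed
    have cond: "radius_ok (p j) (b j) (\<tau> j) (k j)"
      if j: "j \<in> ?J" for j
    proof -
      have "p j * t j \<le> p j * \<tau> j" if "t j \<le> \<tau> j" using pp[OF j] that by simp
      moreover have "(p j * t j)\<^sup>2 \<le> real (k j) * (p j * \<tau> j)\<^sup>2" if "(t j)\<^sup>2 \<le> real (k j) * (\<tau> j)\<^sup>2"
        using mult_left_mono[OF that, of "(p j)\<^sup>2"] by (simp add: power_mult_distrib mult_ac)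
      ultimately show ?thesis unfolding radius_ok_def bt[OF j] using kc[of j] \<tau>[of j] by auto
    qed
    have rad: "T * (\<Sum>j\<in>?J. \<tau> j) \<le> \<epsilon>"
    proof -
      have "(\<Sum>j\<in>?J. \<tau> j) = S / S * (\<epsilon> / T)"
        unfolding \<tau>_def S_def by (simp add: sum_distrib_right[symmetric] sum_divide_distrib[symmetric])
      then show ?thesis using S T by simp
    qed
    have "real (\<Sum>j\<in>?J. k j) \<le> (\<Sum>j\<in>?J. 2 * (t j / \<tau> j)\<^sup>2)"
      unfolding of_nat_sum by (rule sum_mono) (rule kb)
    also have "\<dots> = 2 * (S * (S\<^sup>2 * T\<^sup>2 / \<epsilon>\<^sup>2))"
      unfolding ratio sum_distrib_left[symmetric] sum_distrib_right[symmetric] S_def ..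
    also have "\<dots> = 2 * (S ^ 3 * T\<^sup>2) / \<epsilon>\<^sup>2"
      by (simp add: power3_eq_cube power2_eq_square)
    also have "S ^ 3 * T\<^sup>2 \<le> T0\<^sup>2 * (\<Prod>j\<in>?J. \<kappa> j)\<^sup>2 * Q ^ 3"
    proof -
      have "T = T0 * ((\<Prod>j\<in>?J. \<kappa> j) * (\<Prod>j\<in>?J. min 1 (s j)))"
        unfolding T_def prod.distrib[symmetric] by (intro arg_cong2[where f = "(*)"] refl prod.cong ps)
      then have "S ^ 3 * T\<^sup>2 = T0\<^sup>2 * (\<Prod>j\<in>?J. \<kappa> j)\<^sup>2 * ((\<Prod>j\<in>?J. min 1 (s j))\<^sup>2 * S ^ 3)"
        by (simp add: power_mult_distrib mult_ac)
      also have "\<dots> \<le> T0\<^sup>2 * (\<Prod>j\<in>?J. \<kappa> j)\<^sup>2 * Q ^ 3"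
        using layer_balance[OF J, of s] s unfolding S_def t_def Q_def s_def by (intro mult_left_mono) auto
      finally show ?thesis .
    qed
    finally have kk: "real (\<Sum>j\<in>?J. k j) \<le> 2 * (T0\<^sup>2 * (\<Prod>j\<in>?J. \<kappa> j)\<^sup>2 * Q ^ 3) / \<epsilon>\<^sup>2"
      by (simp add: divide_right_mono mult.assoc)
    have "(2 * real D) ^ (\<Sum>j\<in>?J. k j) = exp (real (\<Sum>j\<in>?J. k j) * ln (2 * real D))"
      using D by (subst exp_of_nat_mult, subst exp_ln) auto
    also have "\<dots> \<le> exp (2 * (T0\<^sup>2 * (\<Prod>j\<in>?J. \<kappa> j)\<^sup>2 * Q ^ 3) / \<epsilon>\<^sup>2 * ln (2 * real D))"
      using mult_right_mono[OF kk ln0] by simp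
    also have "\<dots> = exp (2 * (T0\<^sup>2 * (\<Prod>j\<in>?J. \<kappa> j)\<^sup>2 * ln (2 * real D) * Q ^ 3) / \<epsilon>\<^sup>2)"
      by (simp add: mult_ac)
    finally show ?thesis
      using cond rad unfolding T_def p_def Q_def by blast
  qed
qed

section \<open>Covering the network\<close>

text \<open>Rows are pairs of a graph and one of its nodes. The index set replaces vertical
  concatenation, and each graph keeps its own matrices.\<close>

definition stack_rows :: "nat \<Rightarrow> (nat \<Rightarrow> nat) \<Rightarrow> (nat \<times> nat) set" where
  "stack_rows N n = (SIGMA i:{..<N}. {..<n i})"

definition entries :: "(nat \<Rightarrow> real mat) \<Rightarrow> (nat \<times> nat) \<times> nat \<Rightarrow> real" where
  "entries X = (\<lambda>((i, v), j). X i $$ (v, j))"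

lemma finite_stack_rows [simp]: "finite (stack_rows N n)"
  by (simp add: stack_rows_def)

lemma L2_set_stack_square:
  "(L2_set Y (stack_rows N n \<times> {..<d}))\<^sup>2 = (\<Sum>i<N. \<Sum>j<d. (L2_set (\<lambda>v. Y ((i, v), j)) {..<n i})\<^sup>2)"
proof -
  have "(L2_set Y (stack_rows N n \<times> {..<d}))\<^sup>2 = (\<Sum>p\<in>stack_rows N n. \<Sum>j<d. (Y (p, j))\<^sup>2)"
    unfolding L2_set_square by (simp add: sum.cartesian_product)
  also have "\<dots> = (\<Sum>i<N. \<Sum>v<n i. \<Sum>j<d. (Y ((i, v), j))\<^sup>2)"
    unfolding stack_rows_def by (subst sum.Sigma) (auto intro!: sum.cong)
  also have "\<dots> = (\<Sum>i<N. \<Sum>j<d. \<Sum>v<n i. (Y ((i, v), j))\<^sup>2)"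
    by (rule sum.cong[OF refl], rule sum.swap)
  finally show ?thesis by (simp add: L2_set_square)
qed

text \<open>Propagation and readout act on each graph and each feature column separately, so an
  estimate for these pieces suffices. The number of rows per graph may change, as it does in the
  readout.\<close>

lemma L2_set_block_le:
  assumes "0 \<le> c"
    and "\<And>i j. i < N \<Longrightarrow> j < d \<Longrightarrow> L2_set (\<lambda>v. Z ((i, v), j)) {..<m i} \<le> c * L2_set (\<lambda>v. Y ((i, v), j)) {..<n i}"
  shows "L2_set Z (stack_rows N m \<times> {..<d}) \<le> c * L2_set Y (stack_rows N n \<times> {..<d})"
proof (rule power2_le_imp_le)
  have "(L2_set Z (stack_rows N m \<times> {..<d}))\<^sup>2
      \<le> (\<Sum>i<N. \<Sum>j<d. (c * L2_set (\<lambda>v. Y ((i, v), j)) {..<n i})\<^sup>2)"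
    unfolding L2_set_stack_square by (intro sum_mono power_mono assms(2)) auto
  also have "\<dots> = (c * L2_set Y (stack_rows N n \<times> {..<d}))\<^sup>2"
    by (simp add: power_mult_distrib L2_set_stack_square sum_distrib_left)
  finally show "(L2_set Z (stack_rows N m \<times> {..<d}))\<^sup>2 \<le> (c * L2_set Y (stack_rows N n \<times> {..<d}))\<^sup>2" .
qed (use assms(1) in simp)

lemma L2_set_mono_abs:
  assumes "\<And>x. x \<in> A \<Longrightarrow> \<bar>f x\<bar> \<le> \<bar>g x\<bar>"
  shows "L2_set f A \<le> L2_set g A"
  unfolding L2_set_def by (intro real_sqrt_le_mono sum_mono) (use assms in \<open>simp add: abs_le_square_iff\<close>)

text \<open>The first weight of a chain meets its input without activation; the case distinction
  makes all steps uniform.\<close>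

lemma chain_Suc:
  "chain \<sigma> M W (Suc k) = (if k = 0 then M else map_mat \<sigma> (chain \<sigma> M W k)) * W (Suc k)"
  by (cases k) auto

lemma chain_carrier:
  assumes "M \<in> carrier_mat n (d 0)" "\<And>k. k \<in> {1..q} \<Longrightarrow> W k \<in> carrier_mat (d (k - 1)) (d k)" "m \<le> q"
  shows "chain \<sigma> M W m \<in> carrier_mat n (d m)"
  using assms(3)
proof (induction m)
  case (Suc m)
  have "W (Suc m) \<in> carrier_mat (d m) (d (Suc m))" using assms(2)[of "Suc m"] Suc.prems by simp
  moreover have "chain \<sigma> M W m \<in> carrier_mat n (d m)" using Suc by simp
  ultimately show ?case unfolding chain_Suc by auto
qed (use assms(1) in simp)

lemma index_mult_carrier:
  assumes "A \<in> carrier_mat n k" "B \<in> carrier_mat k m" "i < n" "j < m"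
  shows "(A * B) $$ (i, j) = (\<Sum>a<k. A $$ (i, a) * B $$ (a, j))"
  using assms by (simp add: scalar_prod_def lessThan_atLeast0)

text \<open>Alternates the activation, a Lipschitz map with constant 1, with linear layers whose
  \<kappa> is lowered to min \<kappa> b. All rows share the weights, so the size of the cover does
  not involve the number of graphs or nodes.\<close>

lemma chain_covered:
  fixes M :: "'t \<Rightarrow> nat \<Rightarrow> real mat" and W :: "'t \<Rightarrow> nat \<Rightarrow> real mat"
  assumes cov: "covered \<Theta> (\<lambda>\<theta>. entries (M \<theta>)) (stack_rows N n \<times> {..<d 0}) B \<tau>0 M0"
    and M: "\<And>\<theta> i. \<theta> \<in> \<Theta> \<Longrightarrow> i < N \<Longrightarrow> M \<theta> i \<in> carrier_mat (n i) (d 0)"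
    and W: "\<And>\<theta> k. \<theta> \<in> \<Theta> \<Longrightarrow> k \<in> {1..q} \<Longrightarrow> W \<theta> k \<in> carrier_mat (d (k - 1)) (d k)
        \<and> spec_norm (W \<theta> k) \<le> \<kappa> k \<and> norm21 (W \<theta> k) \<le> b k"
    and B: "0 \<le> B" and \<kappa>: "\<And>k. k \<in> {1..q} \<Longrightarrow> 0 \<le> \<kappa> k" and b: "\<And>k. k \<in> {1..q} \<Longrightarrow> 0 \<le> b k"
    and D: "\<And>k. k \<in> {1..q} \<Longrightarrow> d (k - 1) * d k \<le> D" "1 \<le> D"
    and k: "\<And>k. k \<in> {1..q} \<Longrightarrow> radius_ok (min (\<kappa> k) (b k)) (b k) (\<tau> k) (K k)"
    and \<sigma>: "\<And>x y. \<bar>\<sigma> x - \<sigma> y\<bar> \<le> \<bar>x - y\<bar>" "\<sigma> 0 = 0"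
    and m: "m \<le> q"
  shows "covered \<Theta> (\<lambda>\<theta>. entries (\<lambda>i. chain \<sigma> (M \<theta> i) (W \<theta>) m)) (stack_rows N n \<times> {..<d m})
     ((\<Prod>k=1..m. min (\<kappa> k) (b k)) * B) (\<tau>0 + (\<Sum>k=1..m. \<tau> k)) (M0 * (2 * real D) ^ (\<Sum>k=1..m. K k))"
  using m
proof (induction m)
  case 0
  then show ?case using cov by simp
next
  case (Suc m)
  let ?R = "stack_rows N n"
  let ?B = "(\<Prod>k=1..m. min (\<kappa> k) (b k)) * B"
  let ?\<tau> = "\<tau>0 + (\<Sum>k=1..m. \<tau> k)"
  let ?M = "M0 * (2 * real D) ^ (\<Sum>k=1..m. K k)"
  have Sm: "Suc m \<in> {1..q}" using Suc.prems by simp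
  have IH: "covered \<Theta> (\<lambda>\<theta>. entries (\<lambda>i. chain \<sigma> (M \<theta> i) (W \<theta>) m)) (?R \<times> {..<d m}) ?B ?\<tau> ?M"
    using Suc by simp
  have ch: "chain \<sigma> (M \<theta> i) (W \<theta>) m \<in> carrier_mat (n i) (d m)" if "\<theta> \<in> \<Theta>" "i < N" for \<theta> i
    by (rule chain_carrier[where q = q]) (use M W that Suc.prems in auto)
  define Z where "Z \<theta> i = (if m = 0 then M \<theta> i else map_mat \<sigma> (chain \<sigma> (M \<theta> i) (W \<theta>) m))" for \<theta> i
  have Zc: "Z \<theta> i \<in> carrier_mat (n i) (d m)" if "\<theta> \<in> \<Theta>" "i < N" for \<theta> i
    using ch[OF that] M[OF that] by (auto simp: Z_def)
  have B0: "0 \<le> ?B"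
  proof -
    have "0 \<le> min (\<kappa> k) (b k)" if "k \<in> {1..m}" for k
      using \<kappa>[of k] b[of k] that Suc.prems by auto
    then show ?thesis by (intro mult_nonneg_nonneg prod_nonneg B) auto
  qed
  have covZ: "covered \<Theta> (\<lambda>\<theta>. entries (Z \<theta>)) (?R \<times> {..<d m}) ?B ?\<tau> ?M"
  proof (cases "m = 0")
    case True
    then have "Z = M" by (intro ext) (simp add: Z_def)
    then show ?thesis using cov True by simp
  next
    case False
    have "covered \<Theta> (\<lambda>\<theta>. entries (Z \<theta>)) (?R \<times> {..<d m}) (1 * ?B) ?\<tau> ?M"
    proof (rule covered_lipschitz[OF IH, where \<Phi> = "\<lambda>X x. \<sigma> (X x)"])
      show "L2_set (\<lambda>x. \<sigma> (X x) - \<sigma> (Y x)) (?R \<times> {..<d m}) \<le> 1 * L2_set (\<lambda>x. X x - Y x) (?R \<times> {..<d m})"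
        for X Y :: "(nat \<times> nat) \<times> nat \<Rightarrow> real"
        using L2_set_mono_abs[of "?R \<times> {..<d m}" "\<lambda>x. \<sigma> (X x) - \<sigma> (Y x)" "\<lambda>x. X x - Y x"] \<sigma>(1) by simp
      fix \<theta> x assume \<theta>: "\<theta> \<in> \<Theta>" and x: "x \<in> ?R \<times> {..<d m}"
      obtain i v j where "x = ((i, v), j)" "i < N" "v < n i" "j < d m"
        using x by (auto simp: stack_rows_def)
      then show "entries (Z \<theta>) x = \<sigma> (entries (\<lambda>i. chain \<sigma> (M \<theta> i) (W \<theta>) m) x)"
        using ch[OF \<theta>, of i] False by (simp add: entries_def Z_def)
    qed (use \<sigma> in auto)
    then show ?thesis by simp
  qed
  have "covered \<Theta> (\<lambda>\<theta>. entries (\<lambda>i. chain \<sigma> (M \<theta> i) (W \<theta>) (Suc m))) (?R \<times> {..<d (Suc m)})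
     (min (\<kappa> (Suc m)) (b (Suc m)) * ?B) (?\<tau> + \<tau> (Suc m)) (?M * (2 * real D) ^ K (Suc m))"
  proof (rule covered_linear[OF covZ, where b = "b (Suc m)" and W = "\<lambda>\<theta> a j. W \<theta> (Suc m) $$ (a, j)"])
    show "L2_set (mul (d m) Y (\<lambda>a j. W \<theta> (Suc m) $$ (a, j))) (?R \<times> {..<d (Suc m)})
        \<le> min (\<kappa> (Suc m)) (b (Suc m)) * L2_set Y (?R \<times> {..<d m})" if "\<theta> \<in> \<Theta>" for \<theta> Y
      by (rule mul_min_norm_le) (use W[OF that Sm] in auto)
    show "col_norms (d m) (d (Suc m)) (\<lambda>a j. W \<theta> (Suc m) $$ (a, j)) \<le> b (Suc m)" if "\<theta> \<in> \<Theta>" for \<theta>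
    proof -
      have "W \<theta> (Suc m) \<in> carrier_mat (d m) (d (Suc m))" "norm21 (W \<theta> (Suc m)) \<le> b (Suc m)"
        using W[OF that Sm] by auto
      then show ?thesis by (simp add: norm21_L2)
    qed
    note radius = k[OF Sm, unfolded radius_ok_def]
    show "K (Suc m) = 0 \<and> b (Suc m) \<le> min (\<kappa> (Suc m)) (b (Suc m)) * \<tau> (Suc m) \<or>
      1 \<le> K (Suc m) \<and> (b (Suc m))\<^sup>2 \<le> real (K (Suc m)) * (min (\<kappa> (Suc m)) (b (Suc m)) * \<tau> (Suc m))\<^sup>2"
      by (rule conjunct2[OF radius])
    show "0 \<le> min (\<kappa> (Suc m)) (b (Suc m))" "0 \<le> b (Suc m)" using \<kappa>[OF Sm] b[OF Sm] by auto
    show "0 \<le> \<tau> (Suc m)" by (rule conjunct1[OF radius])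
    show "d m * d (Suc m) \<le> D" using D(1)[OF Sm] by simp
    fix \<theta> x assume \<theta>: "\<theta> \<in> \<Theta>" and x: "x \<in> ?R \<times> {..<d (Suc m)}"
    obtain i v j where x': "x = ((i, v), j)" "i < N" "v < n i" "j < d (Suc m)"
      using x by (auto simp: stack_rows_def)
    have "W \<theta> (Suc m) \<in> carrier_mat (d m) (d (Suc m))" using W[OF \<theta> Sm] by simp
    from index_mult_carrier[OF Zc[OF \<theta> x'(2)] this x'(3,4)]
    show "entries (\<lambda>i. chain \<sigma> (M \<theta> i) (W \<theta>) (Suc m)) x
        = mul (d m) (entries (Z \<theta>)) (\<lambda>a j. W \<theta> (Suc m) $$ (a, j)) x"
      by (simp add: entries_def mul_def x'(1) chain_Suc Z_def)
  qed (use D B0 in auto)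
  then show ?case by (simp add: power_add mult_ac add_ac)
qed

text \<open>The witness \<open>W0\<close> makes the class nonempty; from it come the nonnegativity
  of \<open>b\<close> and the nonemptiness of the dense set of weights. Of \<open>dbar\<close> only
  the domination of all widths matters for counting atoms.\<close>

locale gin_weights =
  fixes \<sigma> :: "real \<Rightarrow> real" and L r r' d0 K :: nat and dw :: "nat \<Rightarrow> nat \<Rightarrow> nat"
    and \<kappa> b :: "nat \<Rightarrow> nat \<Rightarrow> real" and W0 :: "nat \<Rightarrow> nat \<Rightarrow> real mat" and dbar :: nat
  assumes LrR: "L \<ge> 1" "r \<ge> 1" "r' \<ge> 1"
    and widths: "dw 1 0 = d0" "\<forall>l\<in>{2..L}. dw l 0 = dw (l-1) r"
                "dw (L+1) 0 = dw L r" "dw (L+1) r' = K"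
    and kappa_pos: "\<forall>l\<in>{1..L+1}. \<forall>i\<in>{1..(if l = L+1 then r' else r)}. \<kappa> l i > 0"
    and sigma: "\<forall>x y. \<bar>\<sigma> x - \<sigma> y\<bar> \<le> \<bar>x - y\<bar>" "\<sigma> 0 = 0"
    and W0: "admissible_weights L r r' dw \<kappa> b W0"
    and dbar: "1 \<le> dbar" "\<And>l i. l \<in> {1..L} \<Longrightarrow> i \<in> {0..r} \<Longrightarrow> dw l i \<le> dbar"
      "\<And>i. i \<in> {0..r'} \<Longrightarrow> dw (L+1) i \<le> dbar"
begin

abbreviation weights :: "(nat \<Rightarrow> nat \<Rightarrow> real mat) set" where
  "weights \<equiv> {W. admissible_weights L r r' dw \<kappa> b W}"

abbreviation p :: "nat \<Rightarrow> nat \<Rightarrow> real" where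
  "p l i \<equiv> min (\<kappa> l i) (b l i)"

abbreviation net :: "(nat \<Rightarrow> nat \<Rightarrow> real mat) \<Rightarrow> graph \<Rightarrow> real vec" where
  "net \<equiv> gin_mean \<sigma> L r r'"

lemma weights_gnn:
  assumes "W \<in> weights" "l \<in> {1..L}" "i \<in> {1..r}"
  shows "W l i \<in> carrier_mat (dw l (i-1)) (dw l i) \<and> spec_norm (W l i) \<le> \<kappa> l i \<and> norm21 (W l i) \<le> b l i"
  using assms unfolding admissible_weights_def by auto

lemma weights_mlp:
  assumes "W \<in> weights" "i \<in> {1..r'}"
  shows "W (L+1) i \<in> carrier_mat (dw (L+1) (i-1)) (dw (L+1) i) \<and> spec_norm (W (L+1) i) \<le> \<kappa> (L+1) i
    \<and> norm21 (W (L+1) i) \<le> b (L+1) i"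
  using assms unfolding admissible_weights_def by auto

lemma kappa_gnn: "l \<in> {1..L} \<Longrightarrow> i \<in> {1..r} \<Longrightarrow> 0 < \<kappa> l i"
  and kappa_mlp: "i \<in> {1..r'} \<Longrightarrow> 0 < \<kappa> (L+1) i"
  using kappa_pos by auto

lemma norm21_nonneg: "0 \<le> norm21 M"
  unfolding norm21_def by (intro sum_nonneg) simp

lemma b_gnn: "l \<in> {1..L} \<Longrightarrow> i \<in> {1..r} \<Longrightarrow> 0 \<le> b l i"
  using weights_gnn[of W0 l i] W0 norm21_nonneg[of "W0 l i"] by auto

lemma b_mlp: "i \<in> {1..r'} \<Longrightarrow> 0 \<le> b (L+1) i"
  using weights_mlp[of W0 i] W0 norm21_nonneg[of "W0 (L+1) i"] by auto

text \<open>Covers the transition to the readout as well, so that \<open>dw (Suc l) 0\<close> is the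
  width of \<open>gin_H\<close> at every depth l <= L.\<close>

lemma width_step: "l < L \<Longrightarrow> dw (Suc (Suc l)) 0 = dw (Suc l) r"
proof (cases "Suc l = L")
  case True
  then show ?thesis using widths(3) by auto
next
  case False
  assume "l < L"
  with False have "Suc (Suc l) \<in> {2..L}" by auto
  then show ?thesis using widths(2) by fastforce
qed

lemma self_loops_carrier:
  assumes "valid_graph d0 G"
  shows "fst G + 1\<^sub>m (nnodes G) \<in> carrier_mat (nnodes G) (nnodes G)"
  using assms by (auto simp: valid_graph_def nnodes_def Let_def)

lemma gin_H_carrier:
  assumes G: "valid_graph d0 G" and W: "W \<in> weights" and l: "l \<le> L"
  shows "gin_H \<sigma> r W G l \<in> carrier_mat (nnodes G) (dw (Suc l) 0)"
  using l
proof (induction l)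
  case 0
  then show ?case using G widths(1) by (simp add: valid_graph_def nnodes_def Let_def)
next
  case (Suc l)
  have "(fst G + 1\<^sub>m (nnodes G)) * gin_H \<sigma> r W G l \<in> carrier_mat (nnodes G) (dw (Suc l) 0)"
    using self_loops_carrier[OF G] Suc by (intro mult_carrier_mat) auto
  then have "chain \<sigma> ((fst G + 1\<^sub>m (nnodes G)) * gin_H \<sigma> r W G l) (W (Suc l)) r \<in> carrier_mat (nnodes G) (dw (Suc l) r)"
    by (rule chain_carrier[where d = "dw (Suc l)" and q = r]) (use weights_gnn[OF W, of "Suc l"] Suc.prems in auto)
  then show ?case using width_step[of l] Suc.prems by simp
qed

definition readout :: "(nat \<Rightarrow> nat \<Rightarrow> real mat) \<Rightarrow> graph \<Rightarrow> real mat" where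
  "readout W G = (1 / real (nnodes G)) \<cdot>\<^sub>m (mat 1 (nnodes G) (\<lambda>_. 1) * gin_H \<sigma> r W G L)"

lemma gin_mean_eq: "net W G = row (chain \<sigma> (readout W G) (W (L+1)) r') 0"
  by (simp add: gin_mean_def readout_def Let_def)

lemma readout_carrier:
  assumes "valid_graph d0 G" "W \<in> weights"
  shows "readout W G \<in> carrier_mat 1 (dw (L+1) 0)"
  unfolding readout_def using gin_H_carrier[OF assms order_refl]
  by (intro smult_carrier_mat mult_carrier_mat) auto

lemma mlp_carrier:
  assumes "valid_graph d0 G" "W \<in> weights" "m \<le> r'"
  shows "chain \<sigma> (readout W G) (W (L+1)) m \<in> carrier_mat 1 (dw (L+1) m)"
  by (rule chain_carrier[where d = "dw (L+1)" and q = r'])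
    (use readout_carrier[OF assms(1,2)] weights_mlp[OF assms(2)] assms(3) in auto)

lemma gin_mean_dim:
  assumes "valid_graph d0 G" "W \<in> weights"
  shows "dim_vec (net W G) = K"
  using mlp_carrier[OF assms order_refl] widths(4) by (auto simp: gin_mean_eq)

context
  fixes N :: nat and G :: "nat \<Rightarrow> graph" and c x :: real and \<tau> :: "nat \<Rightarrow> nat \<Rightarrow> real" and k :: "nat \<Rightarrow> nat \<Rightarrow> nat"
  assumes G: "\<And>i. i < N \<Longrightarrow> valid_graph d0 (G i)"
    and c: "\<And>i. i < N \<Longrightarrow> spec_norm (fst (G i) + 1\<^sub>m (nnodes (G i))) \<le> c" "0 \<le> c"
    and x: "L2_set (entries (\<lambda>i. snd (G i))) (stack_rows N (\<lambda>i. nnodes (G i)) \<times> {..<d0}) \<le> x"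
    and k_gnn: "\<And>l i. l \<in> {1..L} \<Longrightarrow> i \<in> {1..r} \<Longrightarrow> radius_ok (p l i) (b l i) (\<tau> l i) (k l i)"
    and k_mlp: "\<And>i. i \<in> {1..r'} \<Longrightarrow> radius_ok (p (L+1) i) (b (L+1) i) (\<tau> (L+1) i) (k (L+1) i)"
begin

lemma x_nonneg: "0 \<le> x"
  using x L2_set_nonneg order_trans by blast

lemma p_gnn: "l \<in> {1..L} \<Longrightarrow> i \<in> {1..r} \<Longrightarrow> 0 \<le> p l i"
  using kappa_gnn[of l i] b_gnn[of l i] by auto

lemma width_prod: "a \<le> dbar \<Longrightarrow> a' \<le> dbar \<Longrightarrow> a * a' \<le> dbar\<^sup>2"
  by (simp add: power2_eq_square mult_le_mono)

text \<open>Before each block of weights, \<Phi> multiplies by the adjacency matrix with self-loops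
  of every graph. Its spectral norm is at most \<open>c\<close>, so each layer contributes one
  factor \<open>c\<close> to the norm bound and leaves the cover size unchanged.\<close>

lemma gin_covered:
  assumes "l \<le> L"
  shows "covered weights (\<lambda>W. entries (\<lambda>i. gin_H \<sigma> r W (G i) l)) (stack_rows N (\<lambda>i. nnodes (G i)) \<times> {..<dw (Suc l) 0})
    (c ^ l * (\<Prod>l=1..l. \<Prod>i=1..r. p l i) * x) (\<Sum>l=1..l. \<Sum>i=1..r. \<tau> l i)
    ((2 * real (dbar\<^sup>2)) ^ (\<Sum>l=1..l. \<Sum>i=1..r. k l i))"
  using assms
proof (induction l)
  case 0
  \<comment> \<open>The features do not depend on the weights: one cover point and radius 0.\<close>
  show ?case using covered_const[OF x, of weights "\<lambda>_. entries (\<lambda>i. snd (G i))"] widths(1) by simp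
next
  case (Suc l)
  let ?R = "stack_rows N (\<lambda>i. nnodes (G i))"
  let ?d = "dw (Suc l) 0"
  have l: "Suc l \<in> {1..L}" using Suc.prems by simp
  let ?P = "\<Prod>l=1..l. \<Prod>i=1..r. p l i"
  define At where "At i = fst (G i) + 1\<^sub>m (nnodes (G i))" for i
  have At: "At i \<in> carrier_mat (nnodes (G i)) (nnodes (G i))" if "i < N" for i
    unfolding At_def by (rule self_loops_carrier[OF G[OF that]])
  have H: "gin_H \<sigma> r W (G i) l \<in> carrier_mat (nnodes (G i)) ?d" if "i < N" "W \<in> weights" for i W
    by (rule gin_H_carrier[OF G[OF that(1)] that(2)]) (use Suc.prems in simp)
  define \<Phi> where "\<Phi> Y = (\<lambda>((i, v), j). \<Sum>w<nnodes (G i). At i $$ (v, w) * Y ((i, w), j))"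
    for Y :: "(nat \<times> nat) \<times> nat \<Rightarrow> real"
  have "covered weights (\<lambda>W. entries (\<lambda>i. At i * gin_H \<sigma> r W (G i) l)) (?R \<times> {..<?d})
    (c * (c ^ l * ?P * x)) (\<Sum>l=1..l. \<Sum>i=1..r. \<tau> l i) ((2 * real (dbar\<^sup>2)) ^ (\<Sum>l=1..l. \<Sum>i=1..r. k l i))"
  proof (rule covered_lipschitz[OF Suc.IH c(2), where \<Phi> = \<Phi>])
    show "L2_set (\<lambda>x. \<Phi> X x - \<Phi> Y x) (?R \<times> {..<?d}) \<le> c * L2_set (\<lambda>x. X x - Y x) (?R \<times> {..<?d})" for X Y
    proof (rule L2_set_block_le[OF c(2)])
      fix i j assume i: "i < N"
      let ?x = "\<lambda>w. X ((i, w), j) - Y ((i, w), j)"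
      have "L2_set (\<lambda>v. \<Phi> X ((i, v), j) - \<Phi> Y ((i, v), j)) {..<nnodes (G i)}
          = L2_set (\<lambda>v. \<Sum>w<nnodes (G i). At i $$ (v, w) * ?x w) {..<nnodes (G i)}"
        by (simp add: \<Phi>_def sum_subtractf right_diff_distrib)
      also have "\<dots> \<le> spec_norm (At i) * L2_set ?x {..<nnodes (G i)}"
        by (rule spec_norm_L2[OF At[OF i]])
      also have "\<dots> \<le> c * L2_set ?x {..<nnodes (G i)}"
        using c(1)[OF i] unfolding At_def by (intro mult_right_mono) auto
      finally show "L2_set (\<lambda>v. \<Phi> X ((i, v), j) - \<Phi> Y ((i, v), j)) {..<nnodes (G i)}
          \<le> c * L2_set ?x {..<nnodes (G i)}" .
    qed
    show "\<Phi> (\<lambda>_. 0) x = 0" for x by (simp add: \<Phi>_def split_beta)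
    fix W y assume W: "W \<in> weights" and y: "y \<in> ?R \<times> {..<?d}"
    obtain i v j where y': "y = ((i, v), j)" "i < N" "v < nnodes (G i)" "j < ?d"
      using y by (auto simp: stack_rows_def)
    show "entries (\<lambda>i. At i * gin_H \<sigma> r W (G i) l) y = \<Phi> (entries (\<lambda>i. gin_H \<sigma> r W (G i) l)) y"
      using index_mult_carrier[OF At[OF y'(2)] H[OF y'(2) W] y'(3,4)]
      by (simp add: entries_def \<Phi>_def y'(1))
  qed (use Suc.prems in simp)
  then have "covered weights (\<lambda>W. entries (\<lambda>i. chain \<sigma> (At i * gin_H \<sigma> r W (G i) l) (W (Suc l)) r)) (?R \<times> {..<dw (Suc l) r})
    ((\<Prod>i=1..r. p (Suc l) i) * (c * (c ^ l * ?P * x)))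
    ((\<Sum>l=1..l. \<Sum>i=1..r. \<tau> l i) + (\<Sum>i=1..r. \<tau> (Suc l) i))
    ((2 * real (dbar\<^sup>2)) ^ (\<Sum>l=1..l. \<Sum>i=1..r. k l i) * (2 * real (dbar\<^sup>2)) ^ (\<Sum>i=1..r. k (Suc l) i))"
  proof (rule chain_covered[where d = "dw (Suc l)" and q = r, OF _ _ weights_gnn[OF _ l] _ _ _ _ _ k_gnn[OF l]])
    show "At i * gin_H \<sigma> r W (G i) l \<in> carrier_mat (nnodes (G i)) ?d" if "W \<in> weights" "i < N" for W i
      using At[OF that(2)] H[OF that(2,1)] by (rule mult_carrier_mat)
    have "0 \<le> ?P" using Suc.prems by (intro prod_nonneg ballI p_gnn) auto
    then show "0 \<le> c * (c ^ l * ?P * x)" using c(2) x_nonneg by simp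
    show "0 \<le> \<kappa> (Suc l) i" "0 \<le> b (Suc l) i" if "i \<in> {1..r}" for i
      using kappa_gnn[OF l that] b_gnn[OF l that] by auto
    show "dw (Suc l) (i - 1) * dw (Suc l) i \<le> dbar\<^sup>2" if "i \<in> {1..r}" for i
      using that by (intro width_prod dbar(2)[OF l]) auto
    show "1 \<le> dbar\<^sup>2" using dbar(1) by (simp add: power2_eq_square)
  qed (use sigma in auto)
  then show ?case
    using width_step[of l] Suc.prems by (simp add: At_def power_add mult_ac)
qed

text \<open>By Cauchy-Schwarz a mean of n numbers is at most their l2 norm over sqrt n, hence at
  most the l2 norm. For a graph without nodes the mean is 0 by the convention on division.\<close>

lemma readout_covered:
  "covered weights (\<lambda>W. entries (\<lambda>i. readout W (G i))) (stack_rows N (\<lambda>_. 1) \<times> {..<dw (L+1) 0})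
    (c ^ L * (\<Prod>l=1..L. \<Prod>i=1..r. p l i) * x) (\<Sum>l=1..L. \<Sum>i=1..r. \<tau> l i)
    ((2 * real (dbar\<^sup>2)) ^ (\<Sum>l=1..L. \<Sum>i=1..r. k l i))"
proof -
  let ?R = "stack_rows N (\<lambda>i. nnodes (G i))"
  let ?d = "dw (Suc L) 0"
  define \<Phi> where "\<Phi> Y = (\<lambda>((i, v::nat), j). (1 / real (nnodes (G i))) * (\<Sum>w<nnodes (G i). Y ((i, w), j)))"
    for Y :: "(nat \<times> nat) \<times> nat \<Rightarrow> real"
  have "covered weights (\<lambda>W. entries (\<lambda>i. readout W (G i))) (stack_rows N (\<lambda>_. 1) \<times> {..<?d})
    (1 * (c ^ L * (\<Prod>l=1..L. \<Prod>i=1..r. p l i) * x)) (\<Sum>l=1..L. \<Sum>i=1..r. \<tau> l i)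
    ((2 * real (dbar\<^sup>2)) ^ (\<Sum>l=1..L. \<Sum>i=1..r. k l i))"
  proof (rule covered_lipschitz[OF gin_covered[OF order_refl], where \<Phi> = \<Phi>])
    show "L2_set (\<lambda>x. \<Phi> X x - \<Phi> Y x) (stack_rows N (\<lambda>_. 1) \<times> {..<?d})
        \<le> 1 * L2_set (\<lambda>x. X x - Y x) (?R \<times> {..<?d})" for X Y
    proof (rule L2_set_block_le)
      fix i j assume i: "i < N"
      let ?n = "nnodes (G i)"
      let ?x = "\<lambda>w. X ((i, w), j) - Y ((i, w), j)"
      have "L2_set (\<lambda>v. \<Phi> X ((i, v), j) - \<Phi> Y ((i, v), j)) {..<1::nat}
          = \<bar>1 / real ?n * (\<Sum>w<?n. ?x w)\<bar>"
        by (simp add: \<Phi>_def sum_subtractf diff_divide_distrib L2_set_def lessThan_Suc)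
      also have "\<dots> \<le> L2_set ?x {..<?n}"
      proof (cases "?n = 0")
        case False
        then have n: "real ?n \<ge> 1" by simp
        have "\<bar>\<Sum>w<?n. ?x w\<bar> \<le> (\<Sum>w<?n. \<bar>1\<bar> * \<bar>?x w\<bar>)" by simp
        also have "\<dots> \<le> L2_set (\<lambda>_. 1) {..<?n} * L2_set ?x {..<?n}" by (rule L2_set_mult_ineq)
        also have "\<dots> \<le> real ?n * L2_set ?x {..<?n}"
          using n by (intro mult_right_mono) (auto simp: L2_set_constant real_sqrt_le_iff intro!: real_le_lsqrt self_le_power)
        finally show ?thesis using n by (simp add: abs_mult field_simps)
      qed simp
      finally show "L2_set (\<lambda>v. \<Phi> X ((i, v), j) - \<Phi> Y ((i, v), j)) {..<1::nat} \<le> 1 * L2_set ?x {..<?n}"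
        by simp
    qed simp
    show "\<Phi> (\<lambda>_. 0) x = 0" for x by (simp add: \<Phi>_def split_beta)
    fix W y assume W: "W \<in> weights" and y: "y \<in> stack_rows N (\<lambda>_. 1) \<times> {..<?d}"
    obtain i j where y': "y = ((i, 0), j)" "i < N" "j < ?d"
      using y by (auto simp: stack_rows_def)
    have Hc: "gin_H \<sigma> r W (G i) L \<in> carrier_mat (nnodes (G i)) ?d"
      by (rule gin_H_carrier[OF G[OF y'(2)] W order_refl])
    have "(mat 1 (nnodes (G i)) (\<lambda>_. 1) * gin_H \<sigma> r W (G i) L) $$ (0, j)
        = (\<Sum>a<nnodes (G i). mat 1 (nnodes (G i)) (\<lambda>_. 1) $$ (0, a) * gin_H \<sigma> r W (G i) L $$ (a, j))"
      by (rule index_mult_carrier[OF _ Hc _ y'(3)]) auto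
    also have "\<dots> = (\<Sum>a<nnodes (G i). gin_H \<sigma> r W (G i) L $$ (a, j))" by (rule sum.cong) auto
    finally show "entries (\<lambda>i. readout W (G i)) y = \<Phi> (entries (\<lambda>i. gin_H \<sigma> r W (G i) L)) y"
      using Hc y'(3) by (simp add: entries_def \<Phi>_def y'(1) readout_def)
  qed simp
  then show ?thesis by simp
qed

lemma network_covered:
  "covered weights (\<lambda>W. entries (\<lambda>i. chain \<sigma> (readout W (G i)) (W (L+1)) r')) (stack_rows N (\<lambda>_. 1) \<times> {..<K})
    ((\<Prod>i=1..r'. p (L+1) i) * (c ^ L * (\<Prod>l=1..L. \<Prod>i=1..r. p l i) * x))
    ((\<Sum>l=1..L. \<Sum>i=1..r. \<tau> l i) + (\<Sum>i=1..r'. \<tau> (L+1) i))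
    ((2 * real (dbar\<^sup>2)) ^ (\<Sum>l=1..L. \<Sum>i=1..r. k l i) * (2 * real (dbar\<^sup>2)) ^ (\<Sum>i=1..r'. k (L+1) i))"
  unfolding widths(4)[symmetric]
proof (rule chain_covered[where d = "dw (L+1)" and q = r', OF readout_covered])
  show "readout W (G i) \<in> carrier_mat 1 (dw (L+1) 0)" if "W \<in> weights" "i < N" for W i
    by (rule readout_carrier[OF G[OF that(2)] that(1)])
  have "0 \<le> (\<Prod>l=1..L. \<Prod>i=1..r. p l i)" by (intro prod_nonneg ballI p_gnn)
  then show "0 \<le> c ^ L * (\<Prod>l=1..L. \<Prod>i=1..r. p l i) * x" using c(2) x_nonneg by simp
  show "1 \<le> dbar\<^sup>2" using dbar(1) by (simp add: power2_eq_square)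
  show "dw (L+1) (i - 1) * dw (L+1) i \<le> dbar\<^sup>2" if "i \<in> {1..r'}" for i
    using that by (intro width_prod dbar(3)) auto
  show "0 \<le> \<kappa> (L+1) i" "0 \<le> b (L+1) i" if "i \<in> {1..r'}" for i
    using kappa_mlp[OF that] b_mlp[OF that] by auto
qed (use sigma k_mlp weights_mlp in auto)

end

end

section \<open>Continuity in the weights and covering of the losses\<close>

lemma prod_layers:
  fixes f :: "nat \<times> nat \<Rightarrow> real"
  shows "(\<Prod>j\<in>{1..L} \<times> {1..r} \<union> {L+1} \<times> {1..r'}. f j)
    = (\<Prod>l=1..L. \<Prod>i=1..r. f (l, i)) * (\<Prod>i=1..r'. f (L+1, i))"
proof -
  have "(\<Prod>j\<in>{1..L} \<times> {1..r} \<union> {L+1} \<times> {1..r'}. f j) = prod f ({1..L} \<times> {1..r}) * prod f ({L+1} \<times> {1..r'})"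
    by (rule prod.union_disjoint) auto
  also have "prod f ({1..L} \<times> {1..r}) = (\<Prod>l=1..L. \<Prod>i=1..r. f (l, i))"
    by (simp add: prod.cartesian_product)
  also have "prod f ({L+1} \<times> {1..r'}) = (\<Prod>i=1..r'. f (L+1, i))"
    using prod.cartesian_product[of "\<lambda>l i. f (l, i)" "{1..r'}" "{L+1}"] by simp
  finally show ?thesis .
qed

lemma sum_layers:
  fixes f :: "nat \<times> nat \<Rightarrow> 'b::comm_monoid_add"
  shows "(\<Sum>j\<in>{1..L} \<times> {1..r} \<union> {L+1} \<times> {1..r'}. f j)
    = (\<Sum>l=1..L. \<Sum>i=1..r. f (l, i)) + (\<Sum>i=1..r'. f (L+1, i))"
proof -
  have "(\<Sum>j\<in>{1..L} \<times> {1..r} \<union> {L+1} \<times> {1..r'}. f j) = sum f ({1..L} \<times> {1..r}) + sum f ({L+1} \<times> {1..r'})"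
    by (rule sum.union_disjoint) auto
  also have "sum f ({1..L} \<times> {1..r}) = (\<Sum>l=1..L. \<Sum>i=1..r. f (l, i))"
    by (simp add: sum.cartesian_product)
  also have "sum f ({L+1} \<times> {1..r'}) = (\<Sum>i=1..r'. f (L+1, i))"
    using sum.cartesian_product[of "\<lambda>l i. f (l, i)" "{1..r'}" "{L+1}"] by simp
  finally show ?thesis .
qed

section \<open>Entrywise limits of weights and networks\<close>

lemma tendsto_lipschitz:
  fixes \<sigma> :: "real \<Rightarrow> real"
  assumes \<sigma>: "\<And>x y. \<bar>\<sigma> x - \<sigma> y\<bar> \<le> \<bar>x - y\<bar>" and X: "X \<longlonglongrightarrow> x"
  shows "(\<lambda>n. \<sigma> (X n)) \<longlonglongrightarrow> \<sigma> x"
proof -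
  have "(\<lambda>n. X n - x) \<longlonglongrightarrow> 0" using X by (simp add: LIM_zero_iff)
  then have "(\<lambda>n. \<bar>X n - x\<bar>) \<longlonglongrightarrow> 0" by (rule tendsto_rabs_zero)
  then have "(\<lambda>n. \<sigma> (X n) - \<sigma> x) \<longlonglongrightarrow> 0"
    by (rule Lim_null_comparison[rotated]) (use \<sigma> in auto)
  then show ?thesis by (simp add: LIM_zero_iff)
qed

text \<open>Dimensions are part of the notion because the entry formula of a product is used along
  the whole sequence.\<close>

definition mat_tendsto :: "(nat \<Rightarrow> real mat) \<Rightarrow> real mat \<Rightarrow> nat \<Rightarrow> nat \<Rightarrow> bool" where
  "mat_tendsto X A n d \<longleftrightarrow> A \<in> carrier_mat n d \<and> (\<forall>k. X k \<in> carrier_mat n d) \<and>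
     (\<forall>i<n. \<forall>j<d. (\<lambda>k. X k $$ (i, j)) \<longlonglongrightarrow> A $$ (i, j))"

lemma mat_tendsto_const: "A \<in> carrier_mat n d \<Longrightarrow> mat_tendsto (\<lambda>_. A) A n d"
  by (simp add: mat_tendsto_def)

lemma mat_tendsto_mult:
  assumes "mat_tendsto X A n d" "mat_tendsto Y B d m"
  shows "mat_tendsto (\<lambda>k. X k * Y k) (A * B) n m"
  unfolding mat_tendsto_def
proof (intro conjI allI impI)
  fix i j assume ij: "i < n" "j < m"
  have "(X k * Y k) $$ (i, j) = (\<Sum>a<d. X k $$ (i, a) * Y k $$ (a, j))" for k
    using assms ij by (intro index_mult_carrier) (auto simp: mat_tendsto_def)
  moreover have "(A * B) $$ (i, j) = (\<Sum>a<d. A $$ (i, a) * B $$ (a, j))"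
    using assms ij by (intro index_mult_carrier) (auto simp: mat_tendsto_def)
  moreover have "(\<lambda>k. \<Sum>a<d. X k $$ (i, a) * Y k $$ (a, j)) \<longlonglongrightarrow> (\<Sum>a<d. A $$ (i, a) * B $$ (a, j))"
    using assms ij by (intro tendsto_sum tendsto_mult) (auto simp: mat_tendsto_def)
  ultimately show "(\<lambda>k. (X k * Y k) $$ (i, j)) \<longlonglongrightarrow> (A * B) $$ (i, j)" by simp
qed (use assms in \<open>auto simp: mat_tendsto_def intro!: mult_carrier_mat[of _ n d]\<close>)

lemma mat_tendsto_map:
  assumes "mat_tendsto X A n d" "\<And>x X. X \<longlonglongrightarrow> x \<Longrightarrow> (\<lambda>n. \<sigma> (X n)) \<longlonglongrightarrow> \<sigma> x"
  shows "mat_tendsto (\<lambda>k. map_mat \<sigma> (X k)) (map_mat \<sigma> A) n d"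
  unfolding mat_tendsto_def
proof (intro conjI allI impI)
  fix i j assume ij: "i < n" "j < d"
  have c: "X k \<in> carrier_mat n d" "A \<in> carrier_mat n d" for k using assms(1) by (auto simp: mat_tendsto_def)
  have "(\<lambda>k. \<sigma> (X k $$ (i, j))) \<longlonglongrightarrow> \<sigma> (A $$ (i, j))"
    by (rule assms(2)) (use assms(1) ij in \<open>simp add: mat_tendsto_def\<close>)
  moreover have "map_mat \<sigma> (X k) $$ (i, j) = \<sigma> (X k $$ (i, j))" for k using c(1)[of k] ij by simp
  moreover have "map_mat \<sigma> A $$ (i, j) = \<sigma> (A $$ (i, j))" using c(2) ij by simp
  ultimately show "(\<lambda>k. map_mat \<sigma> (X k) $$ (i, j)) \<longlonglongrightarrow> map_mat \<sigma> A $$ (i, j)" by simp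
qed (use assms in \<open>auto simp: mat_tendsto_def\<close>)

lemma mat_tendsto_smult: "mat_tendsto X A n d \<Longrightarrow> mat_tendsto (\<lambda>k. c \<cdot>\<^sub>m X k) (c \<cdot>\<^sub>m A) n d"
  unfolding smult_mat_def by (rule mat_tendsto_map) (auto intro: tendsto_mult_left)

lemma chain_tendsto:
  assumes M: "mat_tendsto X A n (d 0)"
    and W: "\<And>i. i \<in> {1..q} \<Longrightarrow> mat_tendsto (\<lambda>k. V k i) (W i) (d (i - 1)) (d i)"
    and \<sigma>: "\<And>x y. \<bar>\<sigma> x - \<sigma> y\<bar> \<le> \<bar>x - y\<bar>" and m: "m \<le> q"
  shows "mat_tendsto (\<lambda>k. chain \<sigma> (X k) (V k) m) (chain \<sigma> A W m) n (d m)"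
  using m
proof (induction m)
  case (Suc m)
  have "mat_tendsto (\<lambda>k. V k (Suc m)) (W (Suc m)) (d m) (d (Suc m))" using W[of "Suc m"] Suc.prems by simp
  moreover have "mat_tendsto (\<lambda>k. if m = 0 then X k else map_mat \<sigma> (chain \<sigma> (X k) (V k) m))
      (if m = 0 then A else map_mat \<sigma> (chain \<sigma> A W m)) n (d m)"
    using M Suc mat_tendsto_map[OF _ tendsto_lipschitz[OF \<sigma>]] by (cases "m = 0") auto
  ultimately show ?case unfolding chain_Suc by (intro mat_tendsto_mult)
qed (use M in simp)

context gin_weights
begin

lemma gin_mean_tendsto:
  assumes G: "valid_graph d0 G" and W: "W \<in> weights" and V: "\<And>k. V k \<in> weights"
    and lim: "\<And>l i a j. (\<lambda>k. V k l i $$ (a, j)) \<longlonglongrightarrow> W l i $$ (a, j)"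
    and j: "j < K"
  shows "(\<lambda>k. net (V k) G $ j) \<longlonglongrightarrow> net W G $ j"
proof -
  have \<sigma>: "\<bar>\<sigma> x - \<sigma> y\<bar> \<le> \<bar>x - y\<bar>" for x y using sigma(1) by blast
  have gnn: "mat_tendsto (\<lambda>k. V k l i) (W l i) (dw l (i - 1)) (dw l i)" if "l \<in> {1..L}" "i \<in> {1..r}" for l i
    using weights_gnn[OF W that] weights_gnn[OF V that] lim by (auto simp: mat_tendsto_def)
  have mlp: "mat_tendsto (\<lambda>k. V k (L+1) i) (W (L+1) i) (dw (L+1) (i - 1)) (dw (L+1) i)" if "i \<in> {1..r'}" for i
    using weights_mlp[OF W that] weights_mlp[OF V that] lim by (auto simp: mat_tendsto_def)
  have H: "mat_tendsto (\<lambda>k. gin_H \<sigma> r (V k) G l) (gin_H \<sigma> r W G l) (nnodes G) (dw (Suc l) 0)" if "l \<le> L" for l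
    using that
  proof (induction l)
    case 0
    then show ?case using gin_H_carrier[OF G W, of 0] by (simp add: mat_tendsto_const)
  next
    case (Suc l)
    have "mat_tendsto (\<lambda>k. (fst G + 1\<^sub>m (nnodes G)) * gin_H \<sigma> r (V k) G l)
        ((fst G + 1\<^sub>m (nnodes G)) * gin_H \<sigma> r W G l) (nnodes G) (dw (Suc l) 0)"
      using Suc by (intro mat_tendsto_mult[OF mat_tendsto_const[OF self_loops_carrier[OF G]]]) auto
    from chain_tendsto[where d = "dw (Suc l)" and q = r, OF this gnn \<sigma> order_refl] Suc.prems
    show ?case using width_step[of l] by simp
  qed
  have "mat_tendsto (\<lambda>k. readout (V k) G) (readout W G) 1 (dw (L+1) 0)"
    unfolding readout_def using H[OF order_refl]
    by (intro mat_tendsto_smult mat_tendsto_mult[OF mat_tendsto_const]) auto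
  from chain_tendsto[where d = "dw (L+1)" and q = r', OF this mlp \<sigma> order_refl]
  have "mat_tendsto (\<lambda>k. chain \<sigma> (readout (V k) G) (V k (L+1)) r') (chain \<sigma> (readout W G) (W (L+1)) r') 1 K"
    by (simp add: widths(4)[simplified])
  moreover have "net V' G $ j = chain \<sigma> (readout V' G) (V' (L+1)) r' $$ (0, j)"
    if "V' \<in> weights" for V'
    using mlp_carrier[OF G that order_refl] j widths(4) by (auto simp: gin_mean_eq)
  ultimately show ?thesis
    using j V W by (simp add: mat_tendsto_def)
qed

text \<open>Weights are encoded as real functions of a countable index. In this product space every
  subset has a countable dense subset of its own, so the approximating weights satisfy the norm
  constraints exactly.\<close>

lemma weights_dense:
  "\<exists>\<phi> :: nat \<Rightarrow> nat \<Rightarrow> nat \<Rightarrow> real mat. (\<forall>n. \<phi> n \<in> weights) \<and>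
    (\<forall>W\<in>weights. \<exists>f. \<forall>l i a j. (\<lambda>k. \<phi> (f k) l i $$ (a, j)) \<longlonglongrightarrow> W l i $$ (a, j))"
proof -
  \<comment> \<open>All indices enter, even those outside the matrix dimensions, so that convergence
    holds for every entry expression without side conditions.\<close>
  define enc :: "(nat \<Rightarrow> nat \<Rightarrow> real mat) \<Rightarrow> nat \<times> nat \<times> nat \<times> nat \<Rightarrow> real"
    where "enc W = (\<lambda>(l, i, a, j). W l i $$ (a, j))" for W
  obtain T where T: "countable T" "T \<subseteq> enc ` weights" "enc ` weights \<subseteq> closure T"
    by (rule separable)
  have "W0 \<in> weights" using W0 by simp
  then have "T \<noteq> {}" using T(3) by auto
  define \<phi> where "\<phi> n = inv_into weights enc (from_nat_into T n)" for n
  have enc\<phi>: "enc (\<phi> n) = from_nat_into T n" "\<phi> n \<in> weights" for n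
  proof -
    have "from_nat_into T n \<in> enc ` weights" using from_nat_into[OF \<open>T \<noteq> {}\<close>, of n] T(2) by auto
    then show "enc (\<phi> n) = from_nat_into T n" "\<phi> n \<in> weights"
      unfolding \<phi>_def by (rule f_inv_into_f, rule inv_into_into)
  qed
  show ?thesis
  proof (intro exI[of _ \<phi>] conjI allI ballI enc\<phi>(2))
    fix W assume "W \<in> weights"
    then have "enc W \<in> closure T" using T(3) by auto
    then obtain t where t: "\<And>k. t k \<in> T" "t \<longlonglongrightarrow> enc W" unfolding closure_sequential by blast
    define f where "f k = to_nat_on T (t k)" for k
    have "enc (\<phi> (f k)) = t k" for k
      unfolding enc\<phi>(1) f_def by (rule from_nat_into_to_nat_on[OF T(1) t(1)])
    then have lim: "(\<lambda>k. enc (\<phi> (f k))) \<longlonglongrightarrow> enc W" using t(2) by simp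
    have "(\<lambda>k. \<phi> (f k) l i $$ (a, j)) \<longlonglongrightarrow> W l i $$ (a, j)" for l i a j
    proof -
      have "continuous_on UNIV (\<lambda>x :: nat \<times> nat \<times> nat \<times> nat \<Rightarrow> real. x (l, i, a, j))" by simp
      from continuous_on_tendsto_compose[OF this lim] show ?thesis by (simp add: enc_def)
    qed
    then show "\<exists>f. \<forall>l i a j. (\<lambda>k. \<phi> (f k) l i $$ (a, j)) \<longlonglongrightarrow> W l i $$ (a, j)" by blast
  qed
qed

text \<open>A cover of the outputs is pushed through the loss, which multiplies its radius by \<mu>.
  Hence the radii are allocated with T0 = \<mu> * c^L * x, and dbar^2 bounds the number of entries
  of a weight matrix.\<close>

lemma loss_entropy:
  fixes ls :: "real vec \<Rightarrow> nat \<Rightarrow> real" and y :: "nat \<Rightarrow> nat"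
  assumes G: "\<And>i. i < N \<Longrightarrow> valid_graph d0 (G i)" and y: "\<And>i. i < N \<Longrightarrow> y i \<in> {1..K}"
    and c: "\<And>i. i < N \<Longrightarrow> spec_norm (fst (G i) + 1\<^sub>m (nnodes (G i))) \<le> c" "0 \<le> c"
    and x: "L2_set (entries (\<lambda>i. snd (G i))) (stack_rows N (\<lambda>i. nnodes (G i)) \<times> {..<d0}) \<le> x"
    and lip: "\<And>u v y. dim_vec u = K \<Longrightarrow> dim_vec v = K \<Longrightarrow> y \<in> {1..K} \<Longrightarrow> \<bar>ls u y - ls v y\<bar> \<le> \<mu> * vnorm (u - v)"
    and \<mu>: "0 \<le> \<mu>" and \<epsilon>: "0 < \<epsilon>"
  shows "\<exists>C. finite C \<and> real (card C) \<le> exp (2 * ((\<mu> * (c ^ L * x))\<^sup>2 * ((\<Prod>l=1..L. \<Prod>i=1..r. \<kappa> l i) * (\<Prod>i=1..r'. \<kappa> (L+1) i))\<^sup>2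
        * ln (2 * real (dbar\<^sup>2)) * ((\<Sum>l=1..L. \<Sum>i=1..r. (b l i / \<kappa> l i) powr (2/3)) + (\<Sum>i=1..r'. b (L+1) i / \<kappa> (L+1) i)) ^ 3) / \<epsilon>\<^sup>2)
    \<and> (\<forall>W\<in>weights. \<exists>z\<in>C. L2_set (\<lambda>i. ls (net W (G i)) (y i) - z i) {..<N} \<le> \<epsilon>)"
    (is "\<exists>C. _ \<and> _ \<le> ?e \<and> _")
proof -
  let ?J1 = "{1..L} \<times> {1..r}" and ?J2 = "{L+1} \<times> {1..r'}"
  let ?\<kappa> = "\<lambda>j. \<kappa> (fst j) (snd j)" and ?b = "\<lambda>j. b (fst j) (snd j)"
  have x0: "0 \<le> x" using x L2_set_nonneg order_trans by blast
  obtain \<tau> k where alloc: "(\<forall>j\<in>?J1 \<union> ?J2. radius_ok (min (?\<kappa> j) (?b j)) (?b j) (\<tau> j) (k j)) \<and>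
      (\<mu> * (c ^ L * x)) * (\<Prod>j\<in>?J1 \<union> ?J2. min (?\<kappa> j) (?b j)) * (\<Sum>j\<in>?J1 \<union> ?J2. \<tau> j) \<le> \<epsilon> \<and>
      (2 * real (dbar\<^sup>2)) ^ (\<Sum>j\<in>?J1 \<union> ?J2. k j)
        \<le> exp (2 * ((\<mu> * (c ^ L * x))\<^sup>2 * (\<Prod>j\<in>?J1 \<union> ?J2. ?\<kappa> j)\<^sup>2 * ln (2 * real (dbar\<^sup>2)) *
              ((\<Sum>j\<in>?J1. (?b j / ?\<kappa> j) powr (2/3)) + (\<Sum>j\<in>?J2. ?b j / ?\<kappa> j)) ^ 3) / \<epsilon>\<^sup>2)"
  proof -
    have fin: "finite ?J1" "finite ?J2" by auto
    have ne: "?J1 \<noteq> {}" "?J2 \<noteq> {}" "?J1 \<inter> ?J2 = {}" using LrR by auto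
    have pos: "0 < ?\<kappa> j" "0 \<le> ?b j" if "j \<in> ?J1 \<union> ?J2" for j
      using that kappa_gnn kappa_mlp b_gnn b_mlp by auto
    have T0: "0 \<le> \<mu> * (c ^ L * x)" using \<mu> c(2) x0 by simp
    have D: "1 \<le> dbar\<^sup>2" using dbar(1) by (simp add: power2_eq_square)
    show ?thesis
      by (rule exE[OF allocate_radii[where \<kappa> = ?\<kappa> and b = ?b, OF fin ne pos T0 D \<epsilon>]])
        (assumption | erule exE, rule that, assumption)+
  qed
  note \<tau>k = alloc[THEN conjunct1, rule_format]
    and rad = alloc[THEN conjunct2, THEN conjunct1]
    and card = alloc[THEN conjunct2, THEN conjunct2]
  let ?out = "\<lambda>W. entries (\<lambda>i. chain \<sigma> (readout W (G i)) (W (L+1)) r')"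
  let ?B = "(\<Prod>i=1..r'. p (L+1) i) * (c ^ L * (\<Prod>l=1..L. \<Prod>i=1..r. p l i) * x)"
  let ?\<tau> = "(\<Sum>l=1..L. \<Sum>i=1..r. \<tau> (l, i)) + (\<Sum>i=1..r'. \<tau> (L+1, i))"
  let ?A = "stack_rows N (\<lambda>_. 1) \<times> {..<K}"
  have "covered weights ?out ?A ?B ?\<tau>
    ((2 * real (dbar\<^sup>2)) ^ (\<Sum>l=1..L. \<Sum>i=1..r. k (l, i)) * (2 * real (dbar\<^sup>2)) ^ (\<Sum>i=1..r'. k (L+1, i)))"
  proof (rule network_covered[where \<tau> = "\<lambda>l i. \<tau> (l, i)" and k = "\<lambda>l i. k (l, i)"])
    show "radius_ok (p l i) (b l i) (\<tau> (l, i)) (k (l, i))"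
      if "l \<in> {1..L}" "i \<in> {1..r}" for l i
      using \<tau>k[of "(l, i)"] that by simp
    show "radius_ok (p (L+1) i) (b (L+1) i) (\<tau> (L+1, i)) (k (L+1, i))"
      if "i \<in> {1..r'}" for i
      using \<tau>k[of "(L+1, i)"] that by simp
  qed (use G c x in auto)
  then obtain C where C: "finite C"
    "real (card C) \<le> (2 * real (dbar\<^sup>2)) ^ (\<Sum>l=1..L. \<Sum>i=1..r. k (l, i)) * (2 * real (dbar\<^sup>2)) ^ (\<Sum>i=1..r'. k (L+1, i))"
    "\<forall>W\<in>weights. \<exists>Y\<in>C. L2_set (\<lambda>x. ?out W x - Y x) ?A \<le> ?B * ?\<tau>"
    unfolding covered_def by blast
  define h where "h Y i = ls (vec K (\<lambda>j. Y ((i, 0), j))) (y i)" for Y :: "(nat \<times> nat) \<times> nat \<Rightarrow> real" and i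
  have "real (card C) \<le> (2 * real (dbar\<^sup>2)) ^ (\<Sum>j\<in>?J1 \<union> ?J2. k j)"
    using C(2) unfolding sum_layers power_add .
  also note card
  also have "(\<Prod>j\<in>?J1 \<union> ?J2. ?\<kappa> j) = (\<Prod>l=1..L. \<Prod>i=1..r. \<kappa> l i) * (\<Prod>i=1..r'. \<kappa> (L+1) i)"
    unfolding prod_layers by simp
  also have "(\<Sum>j\<in>?J1. (?b j / ?\<kappa> j) powr (2/3)) = (\<Sum>l=1..L. \<Sum>i=1..r. (b l i / \<kappa> l i) powr (2/3))"
    by (simp add: sum.cartesian_product split_beta)
  also have "(\<Sum>j\<in>?J2. ?b j / ?\<kappa> j) = (\<Sum>l\<in>{L+1}. \<Sum>i=1..r'. b l i / \<kappa> l i)"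
    by (subst sum.cartesian_product) (rule sum.cong, auto)
  also have "\<dots> = (\<Sum>i=1..r'. b (L+1) i / \<kappa> (L+1) i)" by simp
  finally have cardC: "real (card C) \<le> ?e" .
  show ?thesis
  proof (intro exI[of _ "h ` C"] conjI ballI)
    show "finite (h ` C)" using C(1) by simp
    have "real (card (h ` C)) \<le> real (card C)" using card_image_le[OF C(1), of h] by simp
    also note cardC
    finally show "real (card (h ` C)) \<le> ?e" .
    fix W assume W: "W \<in> weights"
    obtain Y where Y: "Y \<in> C" "L2_set (\<lambda>x. ?out W x - Y x) ?A \<le> ?B * ?\<tau>" using C(3) W by blast
    define g where "g i = L2_set (\<lambda>j. ?out W ((i, 0), j) - Y ((i, 0), j)) {..<K}" for i
    have pt: "\<bar>ls (net W (G i)) (y i) - h Y i\<bar> \<le> \<mu> * g i" if i: "i < N" for i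
    proof -
      let ?u = "net W (G i)" and ?v = "vec K (\<lambda>j. Y ((i, 0), j))"
      have d: "dim_vec ?u = K" by (rule gin_mean_dim[OF G[OF i] W])
      have ch: "chain \<sigma> (readout W (G i)) (W (L+1)) r' \<in> carrier_mat 1 K"
        using mlp_carrier[OF G[OF i] W order_refl] by (simp add: widths(4)[simplified])
      have "\<bar>ls ?u (y i) - h Y i\<bar> \<le> \<mu> * vnorm (?u - ?v)"
        unfolding h_def by (rule lip) (use d y[OF i] in auto)
      also have "vnorm (?u - ?v) = g i"
        using d ch by (auto simp: vnorm_L2 g_def entries_def gin_mean_eq intro!: L2_set_cong)
      finally show ?thesis .
    qed
    have g0: "0 \<le> g i" for i by (simp add: g_def)
    have "L2_set (\<lambda>i. ls (net W (G i)) (y i) - h Y i) {..<N} \<le> L2_set (\<lambda>i. \<mu> * g i) {..<N}"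
      by (rule L2_set_mono_abs) (use pt \<mu> g0 in auto)
    also have "\<dots> = \<mu> * L2_set g {..<N}" by (rule L2_set_right_distrib[symmetric, OF \<mu>])
    also have "L2_set g {..<N} = L2_set (\<lambda>x. ?out W x - Y x) ?A"
    proof (rule power2_eq_imp_eq)
      show "(L2_set g {..<N})\<^sup>2 = (L2_set (\<lambda>x. ?out W x - Y x) ?A)\<^sup>2"
        unfolding L2_set_stack_square
        by (simp add: L2_set_square g_def lessThan_Suc)
    qed auto
    also have "\<mu> * L2_set (\<lambda>x. ?out W x - Y x) ?A \<le> \<mu> * (?B * ?\<tau>)" using Y(2) \<mu> by (rule mult_left_mono)
    also have "\<dots> \<le> \<epsilon>" using rad unfolding sum_layers prod_layers by (simp add: mult_ac)
    finally show "\<exists>z\<in>h ` C. L2_set (\<lambda>i. ls (net W (G i)) (y i) - z i) {..<N} \<le> \<epsilon>"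
      using Y(1) by blast
  qed
qed

end

section \<open>The generalisation bound\<close>

lemma sample_c_nonneg: "0 \<le> sample_c N S"
  by (simp add: sample_c_def Let_def spec_norm_nonneg)

lemma spec_norm_le_sample_c:
  assumes "\<And>i. i < N \<Longrightarrow> valid_graph d0 (fst (S i))" and i: "i < N"
  shows "spec_norm (fst (fst (S i)) + 1\<^sub>m (nnodes (fst (S i)))) \<le> sample_c N S"
proof -
  have sq: "dim_col (fst (fst (S i))) = dim_row (fst (fst (S i)))" if "i < N" for i
  proof -
    have "fst (fst (S i)) \<in> carrier_mat (dim_row (fst (fst (S i)))) (dim_row (fst (fst (S i))))"
      using assms(1)[OF that] unfolding valid_graph_def Let_def by blast
    then show ?thesis by (rule carrier_matD(2))
  qed
  let ?Ms = "map (\<lambda>i. fst (fst (S i))) [0..<N]"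
  have "spec_norm (fst (fst (S i)) + 1\<^sub>m (dim_row (fst (fst (S i)))))
      \<le> spec_norm (blockdiag ?Ms + 1\<^sub>m (dim_row (blockdiag ?Ms)))"
  proof (rule spec_norm_blockdiag)
    fix M assume "M \<in> set ?Ms"
    then obtain j where "j < N" "M = fst (fst (S j))" by auto
    then show "dim_row M = dim_col M" using sq by simp
  qed (use i in auto)
  then show ?thesis unfolding sample_c_def sample_A_def Let_def nnodes_def .
qed

lemma frob_norm_sample_X:
  assumes "\<And>i. i < N \<Longrightarrow> valid_graph d0 (fst (S i))"
  shows "L2_set (entries (\<lambda>i. snd (fst (S i)))) (stack_rows N (\<lambda>i. nnodes (fst (S i))) \<times> {..<d0})
    = frob_norm (sample_X d0 N S)"
proof (rule power2_eq_imp_eq)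
  have X: "dim_row (snd (fst (S i))) = nnodes (fst (S i))" "dim_col (snd (fst (S i))) = d0" if "i < N" for i
  proof -
    have "snd (fst (S i)) \<in> carrier_mat (nnodes (fst (S i))) d0"
      using assms[OF that] unfolding valid_graph_def Let_def nnodes_def by blast
    then show "dim_row (snd (fst (S i))) = nnodes (fst (S i))" "dim_col (snd (fst (S i))) = d0" by auto
  qed
  have "(frob_norm (sample_X d0 N S))\<^sup>2
      = (\<Sum>i\<leftarrow>[0..<N]. \<Sum>v<dim_row (snd (fst (S i))). \<Sum>j<d0. (snd (fst (S i)) $$ (v, j))\<^sup>2)"
    unfolding sample_X_def by (subst frob_norm_vstack) (use X in \<open>auto simp: comp_def\<close>)
  also have "\<dots> = (\<Sum>i<N. \<Sum>v<dim_row (snd (fst (S i))). \<Sum>j<d0. (snd (fst (S i)) $$ (v, j))\<^sup>2)"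
    by (simp add: interv_sum_list_conv_sum_set_nat lessThan_atLeast0)
  also have "\<dots> = (\<Sum>i<N. \<Sum>v<nnodes (fst (S i)). \<Sum>j<d0. (snd (fst (S i)) $$ (v, j))\<^sup>2)"
    by (rule sum.cong) (use X in auto)
  also have "\<dots> = (\<Sum>i<N. \<Sum>j<d0. \<Sum>v<nnodes (fst (S i)). (snd (fst (S i)) $$ (v, j))\<^sup>2)"
    by (rule sum.cong[OF refl], rule sum.swap)
  finally show "(L2_set (entries (\<lambda>i. snd (fst (S i)))) (stack_rows N (\<lambda>i. nnodes (fst (S i))) \<times> {..<d0}))\<^sup>2
      = (frob_norm (sample_X d0 N S))\<^sup>2"
    by (simp only: L2_set_stack_square, simp only: L2_set_square, simp add: entries_def)
qed (auto simp: frob_norm_def sum_nonneg)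

theorem theoremA1:
  fixes \<sigma> :: "real \<Rightarrow> real"
    and L r r' d0 K N :: nat
    and dw :: "nat \<Rightarrow> nat \<Rightarrow> nat"
    and \<kappa> b :: "nat \<Rightarrow> nat \<Rightarrow> real"
    and l\<gamma> :: "real vec \<Rightarrow> nat \<Rightarrow> real"
    and \<gamma> \<mu> \<delta> :: real
    and D :: "(graph \<times> nat) measure"
  assumes LrR: "L \<ge> 1" "r \<ge> 1" "r' \<ge> 1"
    and widths: "dw 1 0 = d0" "\<forall>l\<in>{2..L}. dw l 0 = dw (l-1) r"
                "dw (L+1) 0 = dw L r" "dw (L+1) r' = K"
    and kappa_pos: "\<forall>l\<in>{1..L+1}. \<forall>i\<in>{1..(if l = L+1 then r' else r)}. \<kappa> l i > 0"
    and sigma: "\<forall>x y. \<bar>\<sigma> x - \<sigma> y\<bar> \<le> \<bar>x - y\<bar>" "\<sigma> 0 = 0"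
    and loss_range: "\<forall>u y. dim_vec u = K \<longrightarrow> y \<in> {1..K} \<longrightarrow> 0 \<le> l\<gamma> u y \<and> l\<gamma> u y \<le> \<gamma>"
    and loss_lip: "\<forall>u v y. dim_vec u = K \<longrightarrow> dim_vec v = K \<longrightarrow> y \<in> {1..K} \<longrightarrow>
                      \<bar>l\<gamma> u y - l\<gamma> v y\<bar> \<le> \<mu> * vnorm (u - v)"
    and D: "prob_space D"
    and D_support: "\<forall>z\<in>space D. valid_graph d0 (fst z) \<and> snd z \<in> {1..K}"
    and D_meas: "\<forall>f\<in>GIN_mean_class \<sigma> L r r' dw \<kappa> b.
                   (\<lambda>z. l\<gamma> (f (fst z)) (snd z)) \<in> borel_measurable D"
    and delta: "0 < \<delta>" "\<delta> < 1"
    and N: "N \<ge> 1"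
  shows "\<exists>E \<in> sets (PiM {..<N} (\<lambda>_. D)).
           measure (PiM {..<N} (\<lambda>_. D)) E \<ge> 1 - \<delta> \<and>
           (\<forall>S\<in>E. \<forall>f\<in>GIN_mean_class \<sigma> L r r' dw \<kappa> b.
              let c = sample_c N S;
                  X = sample_X d0 N S;
                  dbar = Max ({dw l i | l i. l \<in> {1..L} \<and> i \<in> {0..r}} \<union>
                              {dw (L+1) i | i. i \<in> {0..r'}});
                  P = (\<Prod>l=1..L. (\<Prod>i=1..r. \<kappa> l i)^2);
                  C1 = (\<Sum>i=1..r'. b (L+1) i / \<kappa> (L+1) i);
                  C2 = (\<Sum>l=1..L. \<Sum>i=1..r. (b l i / \<kappa> l i) powr (2/3));
                  base = c^(2*L) * (frob_norm X)^2 * ln (2 * (real dbar)^2) * P;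
                  RG = base * C2^3;
                  RG' = base * (3 * C2^2 * C1 + 3 * C2 * C1^2 + C1^3)
              in true_risk D l\<gamma> f \<le> emp_risk N S l\<gamma> f
                   + 3 * \<gamma> * sqrt (ln (2 / \<delta>) / (2 * real N))
                   + (8 * \<gamma> + 24 * \<mu> * (\<Prod>i=1..r'. \<kappa> (L+1) i) * sqrt (RG + RG') * ln (real N))
                     / real N)"
proof (cases "\<exists>W0. admissible_weights L r r' dw \<kappa> b W0")
  \<comment> \<open>Without admissible weights the class is empty and the whole sample space is a
    suitable event.\<close>
  case False
  then have empty: "GIN_mean_class \<sigma> L r r' dw \<kappa> b = {}" by (auto simp: GIN_mean_class_def)
  interpret Q: prob_space "PiM {..<N} (\<lambda>_. D)" by (rule prob_space_PiM) (rule D)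
  show ?thesis
    unfolding empty using Q.prob_space delta by (intro bexI[of _ "space (PiM {..<N} (\<lambda>_. D))"]) auto
next
  case True
  then obtain W0 where W0: "admissible_weights L r r' dw \<kappa> b W0" ..
  interpret D: prob_space D by (rule D)
  obtain z0 where z0: "z0 \<in> space D" using D.not_empty by auto
  then have K: "K \<ge> 1" using D_support by fastforce
  \<comment> \<open>A label exists, so K >= 1 and there are two vectors at positive distance; the
    Lipschitz estimate for them rules out a negative \<mu>.\<close>
  have \<mu>0: "0 \<le> \<mu>"
  proof -
    have "\<bar>l\<gamma> (vec K (\<lambda>_. 1)) 1 - l\<gamma> (0\<^sub>v K) 1\<bar> \<le> \<mu> * vnorm (vec K (\<lambda>_. 1) - 0\<^sub>v K)"
      by (rule loss_lip[rule_format]) (use K in auto)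
    also have "vnorm (vec K (\<lambda>_. 1) - 0\<^sub>v K) = sqrt (real K)" by (simp add: vnorm_def)
    finally have "0 \<le> \<mu> * sqrt (real K)" by linarith
    then show ?thesis using K by (simp add: zero_le_mult_iff)
  qed
  let ?widths = "{dw l i | l i. l \<in> {1..L} \<and> i \<in> {0..r}} \<union> {dw (L+1) i | i. i \<in> {0..r'}}"
  define dbar where "dbar = Max ?widths"
  have fin: "finite ?widths"
  proof -
    have "?widths \<subseteq> (\<Union>l\<in>{1..L}. dw l ` {0..r}) \<union> dw (L+1) ` {0..r'}" by blast
    then show ?thesis by (rule finite_subset) simp
  qed
  have w1: "dw l i \<le> dbar" if "l \<in> {1..L}" "i \<in> {0..r}" for l i
    unfolding dbar_def by (rule Max_ge[OF fin]) (use that in blast)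
  have w2: "dw (L+1) i \<le> dbar" if "i \<in> {0..r'}" for i
    unfolding dbar_def by (rule Max_ge[OF fin]) (use that in blast)
  have dbar1: "1 \<le> dbar" using w2[of r'] widths(4) K by simp
  interpret gin_weights \<sigma> L r r' d0 K dw \<kappa> b W0 dbar
    by unfold_locales (fact LrR widths kappa_pos sigma W0 dbar1 w1 w2)+
  obtain \<phi> where \<phi>_dense: "(\<forall>n. \<phi> n \<in> weights) \<and>
    (\<forall>W\<in>weights. \<exists>f :: nat \<Rightarrow> nat. \<forall>l i a j. (\<lambda>k. \<phi> (f k) l i $$ (a, j)) \<longlonglongrightarrow> W l i $$ (a, j))"
    using weights_dense ..
  note \<phi> = spec[OF conjunct1[OF \<phi>_dense]] and dense = bspec[OF conjunct2[OF \<phi>_dense]]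
  define ls where "ls W z = l\<gamma> (net W (fst z)) (snd z)" for W and z :: "graph \<times> nat"
  have ls_meas: "ls W \<in> borel_measurable D" if "W \<in> weights" for W
    unfolding ls_def using D_meas that by (auto simp: GIN_mean_class_def)
  have ls_range: "0 \<le> ls W z \<and> ls W z \<le> \<gamma>" if "W \<in> weights" "z \<in> space D" for W z
    unfolding ls_def using gin_mean_dim[OF _ that(1)] D_support that(2) loss_range by simp
  have ls_tendsto: "(\<lambda>k. ls (V k) z) \<longlonglongrightarrow> ls W z"
    if W: "W \<in> weights" and V: "\<And>k. V k \<in> weights" and z: "z \<in> space D"
      and lim: "\<And>l i a j. (\<lambda>k. V k l i $$ (a, j)) \<longlonglongrightarrow> W l i $$ (a, j)" for W V z
  proof -
    let ?u = "\<lambda>k. net (V k) (fst z)" and ?v = "net W (fst z)"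
    have G: "valid_graph d0 (fst z)" "snd z \<in> {1..K}" using D_support z by auto
    have dims: "dim_vec (?u k) = K" "dim_vec ?v = K" for k using gin_mean_dim[OF G(1)] V W by auto
    have "(\<lambda>k. \<Sum>j<K. \<bar>?u k $ j - ?v $ j\<bar>) \<longlonglongrightarrow> (\<Sum>j<K. 0)"
    proof (rule tendsto_sum)
      fix j assume "j \<in> {..<K}"
      then have "(\<lambda>k. ?u k $ j) \<longlonglongrightarrow> ?v $ j" by (intro gin_mean_tendsto[OF G(1) W V lim]) simp
      then show "(\<lambda>k. \<bar>?u k $ j - ?v $ j\<bar>) \<longlonglongrightarrow> 0" by (intro tendsto_rabs_zero) (simp add: LIM_zero_iff)
    qed
    then have "(\<lambda>k. \<Sum>j<K. \<bar>?u k $ j - ?v $ j\<bar>) \<longlonglongrightarrow> 0" by simp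
    then have lim0: "(\<lambda>k. \<mu> * (\<Sum>j<K. \<bar>?u k $ j - ?v $ j\<bar>)) \<longlonglongrightarrow> 0"
      by (rule tendsto_mult_right_zero)
    have bound: "norm (ls (V k) z - ls W z) \<le> \<mu> * (\<Sum>j<K. \<bar>?u k $ j - ?v $ j\<bar>)" for k
    proof -
      have "norm (ls (V k) z - ls W z) \<le> \<mu> * vnorm (?u k - ?v)"
        unfolding ls_def real_norm_def using loss_lip dims G(2) by blast
      also have "vnorm (?u k - ?v) = L2_set (\<lambda>j. ?u k $ j - ?v $ j) {..<K}"
        using dims by (auto simp: vnorm_L2 intro!: L2_set_cong)
      also have "\<mu> * \<dots> \<le> \<mu> * (\<Sum>j<K. \<bar>?u k $ j - ?v $ j\<bar>)"
        by (intro mult_left_mono L2_set_le_sum_abs \<mu>0)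
      finally show ?thesis .
    qed
    have "(\<lambda>k. ls (V k) z - ls W z) \<longlonglongrightarrow> 0"
      by (rule Lim_null_comparison[OF always_eventually[OF allI[OF bound]] lim0])
    then show ?thesis by (simp add: LIM_zero_iff)
  qed
  define C1 where "C1 = (\<Sum>i=1..r'. b (L+1) i / \<kappa> (L+1) i)"
  define C2 where "C2 = (\<Sum>l=1..L. \<Sum>i=1..r. (b l i / \<kappa> l i) powr (2/3))"
  define \<Pi>\<kappa> where "\<Pi>\<kappa> = (\<Prod>i=1..r'. \<kappa> (L+1) i)"
  define P where "P = (\<Prod>l=1..L. (\<Prod>i=1..r. \<kappa> l i)^2)"
  \<comment> \<open>The sum of R_G and R_G': expanding the cube gives C2^3 and the bracket in R_G',
    as \<open>R_split\<close> records.\<close>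
  define R where "R S = sample_c N S ^ (2*L) * (frob_norm (sample_X d0 N S))^2 * ln (2 * (real dbar)^2) * P * (C2 + C1) ^ 3" for S
  have C1: "0 \<le> C1" unfolding C1_def by (intro sum_nonneg divide_nonneg_pos b_mlp kappa_mlp)
  have C2: "0 \<le> C2" unfolding C2_def by (intro sum_nonneg) simp
  have \<Pi>\<kappa>: "0 \<le> \<Pi>\<kappa>" unfolding \<Pi>\<kappa>_def by (intro prod_nonneg ballI less_imp_le kappa_mlp)
  have P: "0 \<le> P" unfolding P_def by (intro prod_nonneg) simp
  have dbar2: "(1::real) \<le> (real dbar)\<^sup>2" using dbar1 by simp
  have lnd: "0 \<le> ln (2 * (real dbar)^2)" using dbar2 by (intro ln_ge_zero) linarith
  have R0: "0 \<le> R S" for S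
    unfolding R_def by (intro mult_nonneg_nonneg zero_le_power2 zero_le_power lnd P add_nonneg_nonneg C1 C2 sample_c_nonneg)
  have lnN: "0 \<le> ln (real N)" using N by simp
  have R_split: "sample_c N S ^ (2*L) * (frob_norm (sample_X d0 N S))^2 * ln (2 * (real dbar)^2) * P * C2^3 +
      sample_c N S ^ (2*L) * (frob_norm (sample_X d0 N S))^2 * ln (2 * (real dbar)^2) * P *
        (3 * C2^2 * C1 + 3 * C2 * C1^2 + C1^3) = R S" for S
    unfolding R_def distrib_left[symmetric]
    by (rule arg_cong2[where f = "(*)"]) (auto simp: power2_eq_square power3_eq_cube algebra_simps)
  have "0 \<le> ls W0 z0 \<and> ls W0 z0 \<le> \<gamma>" by (rule ls_range[OF _ z0]) (use W0 in simp)
  then have \<gamma>0: "0 \<le> \<gamma>" by linarith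
  define Q where "Q S = 3 * \<gamma> * sqrt (ln (2 / \<delta>) / (2 * real N))
    + (8 * \<gamma> + 24 * \<mu> * \<Pi>\<kappa> * sqrt (R S) * ln (real N)) / real N" for S
  let ?PN = "PiM {..<N} (\<lambda>_. D)"
  let ?bound = "\<lambda>S W. true_risk D l\<gamma> (net W) \<le> emp_risk N S l\<gamma> (net W) + Q S"
  have "\<exists>E \<in> sets ?PN. measure ?PN E \<ge> 1 - \<delta> \<and>
      (\<forall>S\<in>E. \<forall>W\<in>weights. ?bound S W)"
  proof (cases "\<gamma> = 0")
    \<comment> \<open>All losses vanish. This case is separate because bounded differences and the
      dyadic radii require \<gamma> > 0.\<close>
    case True
    interpret Q: prob_space "?PN" by (rule prob_space_PiM) (rule D)
    show ?thesis
    proof (intro bexI[of _ "space ?PN"] conjI ballI)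
      fix S W assume S: "S \<in> space ?PN" and W: "W \<in> weights"
      have z: "ls W z = 0" if "z \<in> space D" for z using ls_range[OF W that] True by simp
      have "true_risk D l\<gamma> (net W) = (\<integral>z. 0 \<partial>D)"
        unfolding true_risk_def by (rule Bochner_Integration.integral_cong) (use z in \<open>auto simp: ls_def\<close>)
      moreover have "emp_risk N S l\<gamma> (net W) = 0"
      proof -
        have "ls W (S i) = 0" if "i < N" for i
          using S that by (intro z) (auto simp: space_PiM)
        then have "(\<Sum>i<N. ls W (S i)) = 0" by simp
        then show ?thesis by (simp add: emp_risk_def ls_def)
      qed
      moreover have "0 \<le> 24 * \<mu> * \<Pi>\<kappa> * sqrt (R S) * ln (real N)"
        using \<mu>0 \<Pi>\<kappa> R0[of S] lnN by simp
      ultimately show "?bound S W"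
        unfolding Q_def using True by simp
    qed (use Q.prob_space delta in auto)
  next
    case False
    then have \<gamma>: "0 < \<gamma>" using \<gamma>0 by simp
    interpret bounded_losses D "\<lambda>n. ls (\<phi> n)" \<gamma>
      by unfold_locales (use ls_meas ls_range \<phi> in auto)
    have "\<exists>E \<in> sets ?PN. measure ?PN E \<ge> 1 - \<delta> \<and>
        (\<forall>S\<in>E. \<forall>n. real (card {..<N}) * risk n \<le> (\<Sum>i\<in>{..<N}. ls (\<phi> n) (S i))
         + savg {..<N} (\<lambda>s. SUP n. \<Sum>i\<in>{..<N}. 2 * s i * ls (\<phi> n) (S i))
         + 3 * \<gamma> * sqrt (real (card {..<N}) * ln (1 / \<delta>) / 2))" (is "\<exists>E\<in>_. ?dev E")
      by (rule uniform_deviation) (use delta \<gamma> N in \<open>simp_all add: lessThan_empty_iff\<close>)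
    then obtain E where E1: "E \<in> sets ?PN" and E2: "?dev E"
      by (rule bexE)
    note E = E1 E2[THEN conjunct1] and dev = E2[THEN conjunct2, rule_format]
    show ?thesis
    proof (intro bexI[OF _ E(1)] conjI E(2) ballI)
      fix S W assume S: "S \<in> E" and W: "W \<in> weights"
      have Sp: "S \<in> space ?PN" using sets.sets_into_space[OF E(1)] S by auto
      have Si: "S i \<in> space D" if "i < N" for i using Sp that by (auto simp: space_PiM)
      have val: "valid_graph d0 (fst (S i))" "snd (S i) \<in> {1..K}" if "i < N" for i
        using D_support Si[OF that] by auto
      let ?c = "sample_c N S" and ?x = "frob_norm (sample_X d0 N S)"
      \<comment> \<open>The square of the Lipschitz constant and the readout norms is split off, so
        that its root becomes the factor in front of sqrt (R S).\<close>
      define R' where "R' = (\<mu> * \<Pi>\<kappa>)\<^sup>2 * R S"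
      have R'0: "0 \<le> R'" unfolding R'_def using R0[of S] by simp
      have R'eq: "(\<mu> * (?c ^ L * ?x))\<^sup>2 * ((\<Prod>l=1..L. \<Prod>i=1..r. \<kappa> l i) * (\<Prod>i=1..r'. \<kappa> (L+1) i))\<^sup>2
        * ln (2 * real (dbar\<^sup>2)) * ((\<Sum>l=1..L. \<Sum>i=1..r. (b l i / \<kappa> l i) powr (2/3)) + (\<Sum>i=1..r'. b (L+1) i / \<kappa> (L+1) i)) ^ 3 = R'"
        unfolding R'_def R_def P_def \<Pi>\<kappa>_def[symmetric] C1_def[symmetric] C2_def[symmetric]
        by (simp add: power_mult_distrib prod_power_distrib power_mult mult_ac power2_eq_square[of L] flip: power_mult)
      have ent: "\<exists>C. finite C \<and> real (card C) \<le> exp (2 * R' / \<epsilon>\<^sup>2) \<and>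
          (\<forall>n\<in>UNIV. \<exists>z\<in>C. L2_set (\<lambda>i. ls (\<phi> n) (S i) - z i) {..<N} \<le> \<epsilon>)" if "\<epsilon> > 0" for \<epsilon>
      proof -
        have "\<exists>C. finite C \<and> real (card C) \<le> exp (2 * R' / \<epsilon>\<^sup>2) \<and>
          (\<forall>W\<in>weights. \<exists>z\<in>C. L2_set (\<lambda>i. l\<gamma> (net W (fst (S i))) (snd (S i)) - z i) {..<N} \<le> \<epsilon>)"
          unfolding R'eq[symmetric]
        proof (rule loss_entropy[where G = "\<lambda>i. fst (S i)" and y = "\<lambda>i. snd (S i)"])
          show "spec_norm (fst (fst (S i)) + 1\<^sub>m (nnodes (fst (S i)))) \<le> ?c" if "i < N" for i
            by (rule spec_norm_le_sample_c[OF val(1) that])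
          show "L2_set (entries (\<lambda>i. snd (fst (S i)))) (stack_rows N (\<lambda>i. nnodes (fst (S i))) \<times> {..<d0}) \<le> ?x"
            using frob_norm_sample_X[OF val(1), of N] by simp
        qed (use val sample_c_nonneg loss_lip \<mu>0 that in auto)
        then obtain C where "finite C" "real (card C) \<le> exp (2 * R' / \<epsilon>\<^sup>2)"
          "\<forall>W\<in>weights. \<exists>z\<in>C. L2_set (\<lambda>i. l\<gamma> (net W (fst (S i))) (snd (S i)) - z i) {..<N} \<le> \<epsilon>"
          by blast
        then show ?thesis
        proof (intro exI[of _ C] conjI ballI)
          fix n
          assume *: "\<forall>W\<in>weights. \<exists>z\<in>C. L2_set (\<lambda>i. l\<gamma> (net W (fst (S i))) (snd (S i)) - z i) {..<N} \<le> \<epsilon>"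
          show "\<exists>z\<in>C. L2_set (\<lambda>i. ls (\<phi> n) (S i) - z i) {..<N} \<le> \<epsilon>"
            unfolding ls_def by (rule bspec[OF * \<phi>])
        qed
      qed
      have vb: "\<bar>ls (\<phi> n) (S i)\<bar> \<le> \<gamma>" if "i < N" for n i
        using ls_range[OF \<phi> Si[OF that], of n] by linarith
      obtain m where mm: "(\<forall>s\<in>signs {..<N}. \<forall>n\<in>UNIV. (\<Sum>i<N. s i * ls (\<phi> n) (S i)) \<le> m s) \<and>
          savg {..<N} m \<le> 4 * \<gamma> + 12 * sqrt R' * ln (real N)"
        using Dudley[where T = UNIV and v = "\<lambda>n i. ls (\<phi> n) (S i)", OF N \<gamma> vb R'0 ent UNIV_not_empty] ..
      have m: "(\<Sum>i<N. s i * ls (\<phi> n) (S i)) \<le> m s" if "s \<in> signs {..<N}" for s n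
        using mm[THEN conjunct1] that by blast
      note m2 = mm[THEN conjunct2]
      have "savg {..<N} (\<lambda>s. SUP n. \<Sum>i<N. 2 * s i * ls (\<phi> n) (S i)) \<le> savg {..<N} (\<lambda>s. 2 * m s)"
      proof (rule savg_mono)
        fix s assume s: "s \<in> signs {..<N}"
        show "(SUP n. \<Sum>i<N. 2 * s i * ls (\<phi> n) (S i)) \<le> 2 * m s"
        proof (rule cSUP_least)
          fix n
          have "(\<Sum>i<N. 2 * s i * ls (\<phi> n) (S i)) = 2 * (\<Sum>i<N. s i * ls (\<phi> n) (S i))"
            by (simp add: sum_distrib_left mult.assoc)
          then show "(\<Sum>i<N. 2 * s i * ls (\<phi> n) (S i)) \<le> 2 * m s" using m[OF s, of n] by simp
        qed simp
      qed
      also have "\<dots> \<le> 8 * \<gamma> + 24 * sqrt R' * ln (real N)" using m2 by (simp add: savg_cmult)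
      also have "sqrt R' = \<mu> * \<Pi>\<kappa> * sqrt (R S)"
        unfolding R'_def using \<mu>0 \<Pi>\<kappa> by (simp add: real_sqrt_mult)
      finally have rad: "savg {..<N} (\<lambda>s. SUP n. \<Sum>i<N. 2 * s i * ls (\<phi> n) (S i))
          \<le> 8 * \<gamma> + 24 * \<mu> * \<Pi>\<kappa> * sqrt (R S) * ln (real N)" by (simp add: mult.assoc)
      \<comment> \<open>The event was built with ln (1 / \<delta>), which the stated ln (2 /
        \<delta>) dominates; the factor \<open>real N\<close> prepares the division by the sample
        size.\<close>
      have sq: "sqrt (real N * ln (1 / \<delta>) / 2) \<le> real N * sqrt (ln (2 / \<delta>) / (2 * real N))"
      proof -
        have "ln (1 / \<delta>) \<le> ln (2 / \<delta>)" using delta by (simp add: divide_right_mono)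
        then have "real N * ln (1 / \<delta>) / 2 \<le> real N * ln (2 / \<delta>) / 2"
          by (intro divide_right_mono mult_left_mono) auto
        also have "\<dots> = (real N)\<^sup>2 * (ln (2 / \<delta>) / (2 * real N))" using N by (simp add: power2_eq_square)
        finally have "sqrt (real N * ln (1 / \<delta>) / 2) \<le> sqrt ((real N)\<^sup>2 * (ln (2 / \<delta>) / (2 * real N)))"
          by (rule real_sqrt_le_mono)
        then show ?thesis by (simp only: real_sqrt_mult real_sqrt_abs abs_of_nat)
      qed
      have seq: "integral\<^sup>L D (ls (\<phi> n)) \<le> (1 / real N) * (\<Sum>i<N. ls (\<phi> n) (S i)) + Q S" for n
      proof -
        have "real N * risk n \<le> (\<Sum>i<N. ls (\<phi> n) (S i)) + (8 * \<gamma> + 24 * \<mu> * \<Pi>\<kappa> * sqrt (R S) * ln (real N))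
            + 3 * \<gamma> * sqrt (real N * ln (1 / \<delta>) / 2)"
          using dev[OF S, of n] rad by simp
        also have "\<dots> \<le> (\<Sum>i<N. ls (\<phi> n) (S i)) + (8 * \<gamma> + 24 * \<mu> * \<Pi>\<kappa> * sqrt (R S) * ln (real N))
            + 3 * \<gamma> * (real N * sqrt (ln (2 / \<delta>) / (2 * real N)))"
          using sq \<gamma> by (intro add_left_mono mult_left_mono) auto
        also have "\<dots> = real N * ((1 / real N) * (\<Sum>i<N. ls (\<phi> n) (S i)) + Q S)"
          using N by (simp add: Q_def field_simps)
        finally have "risk n \<le> (1 / real N) * (\<Sum>i<N. ls (\<phi> n) (S i)) + Q S"
          using N by (simp add: mult_le_cancel_left)
        then show ?thesis by (simp add: risk_def)
      qed
      \<comment> \<open>Passage from the countable set to arbitrary weights: the risk converges by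
        dominated convergence, the empirical risk as a finite sum, and \<open>Q S\<close> does not
        depend on the weights. The event \<open>E\<close> stays the same.\<close>
      obtain f where f: "\<And>l i a j. (\<lambda>k. \<phi> (f k) l i $$ (a, j)) \<longlonglongrightarrow> W l i $$ (a, j)"
        using dense[OF W] by blast
      have lim: "(\<lambda>k. ls (\<phi> (f k)) z) \<longlonglongrightarrow> ls W z" if "z \<in> space D" for z
        by (rule ls_tendsto[OF W \<phi> that f])
      have "(\<lambda>k. integral\<^sup>L D (ls (\<phi> (f k)))) \<longlonglongrightarrow> integral\<^sup>L D (ls W)"
        by (rule integral_dominated_convergence[where w = "\<lambda>_. \<gamma>"])
           (use ls_meas[OF W] ls_meas[OF \<phi>] lim ls_range[OF \<phi>] in auto)
      moreover have "(\<lambda>k. (1 / real N) * (\<Sum>i<N. ls (\<phi> (f k)) (S i)) + Q S)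
          \<longlonglongrightarrow> (1 / real N) * (\<Sum>i<N. ls W (S i)) + Q S"
        by (intro tendsto_intros lim Si) simp
      ultimately have "integral\<^sup>L D (ls W) \<le> (1 / real N) * (\<Sum>i<N. ls W (S i)) + Q S"
        by (rule LIMSEQ_le) (use seq in blast)
      then show "?bound S W"
        unfolding true_risk_def emp_risk_def ls_def Q_def by simp
    qed
  qed
  from this[unfolded Q_def add.assoc[symmetric]] show ?thesis
    unfolding Let_def dbar_def[symmetric] C1_def[symmetric] C2_def[symmetric] \<Pi>\<kappa>_def[symmetric]
      P_def[symmetric] R_split GIN_mean_class_def
    by blast
qed

end
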